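(* Let $R$ be a ring. The following statements are equivalent. 1. The ring $R$ has a left Artinian left quotient ring $Q$. 2. The set $\overline{\mathcal{C}}$ is a left denominator set in the ring ${\rm gr}\, R$, $\overline{\mathcal{C}}^{-1}{\rm gr}\, R$ is a left Artinian ring, $\mathfrak{n}$ is a nilpotent ideal and $\mathcal{C}'\subseteq\mathcal{C}$. 3. The set $\overline{\mathcal{C}}$ is a left denominator set in the ring ${\rm gr}\, R$, the left quotient ring $Q({\rm gr}\, R/\tau)$ of the ring ${\rm gr}\, R/\tau$ is a left Artinian ring, $\mathfrak{n}$ is a nilpotent ideal and $\mathcal{C}'\subseteq \mathcal{C}$. If one of the equivalent conditions holds then ${\rm gr}\, Q\simeq Q({\rm gr}\, R/\tau)\simeq \overline{\mathcal{C}}^{-1}{\rm gr}\, R$, where ${\rm gr}\, Q$ is the associated graded ring of $Q$ with respect to its prime radical filtration.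
   Context: Rings have $1$; module means left module. For a ring $R$: $\mathcal{C}$ is the set of regular elements (non-zero-divisors) of $R$; the left quotient ring of $R$ is $Q=Q(R)=\mathcal{C}^{-1}R$ (it exists iff $\mathcal{C}$ is a left Ore set); $\mathfrak{n}$ is the prime radical of $R$; $\overline{R}:=R/\mathfrak{n}$; $\overline{\mathcal{C}}$ is the set of regular elements of $\overline{R}$; $\mathcal{C}':=\{c\in R\mid c+\mathfrak{n}\in\overline{\mathcal{C}}\}$. The prime radical filtration of $R$ is $\mathfrak{n}^0=R\supseteq\mathfrak{n}\supseteq\mathfrak{n}^2\supseteq\cdots$, and ${\rm gr}\, R:=\overline{R}\oplus\mathfrak{n}/\mathfrak{n}^2\oplus\cdots\oplus\mathfrak{n}^i/\mathfrak{n}^{i+1}\oplus\cdots$ is the associated graded ring; $\overline{\mathcal{C}}\subseteq\overline{R}$ is viewed as a subset of its degree-zero component. ${\rm gr}\, Q$ is defined in the same way from the prime radical of $Q$. A multiplicative set $S$ of a ring $A$ is a left denominator set if it is a left Ore set and, whenever $as=0$ with $a\in A$, $s\in S$, there is $s'\in S$ with $s'a=0$; then the ring of fractions $S^{-1}A=\{s^{-1}a\mid s\in S, a\in A\}$ exists. When $\overline{\mathcal{C}}$ is a left denominator set of ${\rm gr}\, R$, $\tau:=\{u\in{\rm gr}\, R\mid \overline{c}u=0\text{ for some }\overline{c}\in\overline{\mathcal{C}}\}$ is the $\overline{\mathcal{C}}$-torsion ideal of ${\rm gr}\, R$; it is homogeneous, $\tau=\bigoplus_{i\geq1}\tau_i$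 with $\tau_i$ the $\overline{\mathcal{C}}$-torsion submodule of the left $\overline{R}$-module $\mathfrak{n}^i/\mathfrak{n}^{i+1}$. Statement 3 includes the existence of the left quotient ring $Q({\rm gr}\, R/\tau)$. *)

theory Defs
  imports "HOL-Algebra.QuotRing" "HOL-Algebra.Ideal_Product"
begin

section \<open>Left Artinian rings, regular elements, prime radical\<close>

locale left_ideal = additive_subgroup I R + ring R for I and R (structure) +
  assumes l_closed: "\<lbrakk>a \<in> I; x \<in> carrier R\<rbrakk> \<Longrightarrow> x \<otimes> a \<in> I"

locale left_artinian_ring = ring +
  assumes descending_chain:
    "\<lbrakk>\<And>i::nat. left_ideal (J i) R; \<And>i. J (Suc i) \<subseteq> J i\<rbrakk> \<Longrightarrow> \<exists>m. \<forall>i\<ge>m. J i = J m"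

definition regular_elements :: "('a, 'b) ring_scheme \<Rightarrow> 'a set" where
  "regular_elements R =
     {c \<in> carrier R. \<forall>a \<in> carrier R.
        (c \<otimes>\<^bsub>R\<^esub> a = \<zero>\<^bsub>R\<^esub> \<longrightarrow> a = \<zero>\<^bsub>R\<^esub>) \<and> (a \<otimes>\<^bsub>R\<^esub> c = \<zero>\<^bsub>R\<^esub> \<longrightarrow> a = \<zero>\<^bsub>R\<^esub>)}"

text \<open>Prime ideals of noncommutative rings; the library's \<^const>\<open>primeideal\<close> is restricted to
  commutative rings.\<close>

locale nc_prime_ideal = ideal P R for P and R (structure) +
  assumes proper: "P \<noteq> carrier R"
    and prime: "\<lbrakk>ideal I R; ideal J R; I \<cdot> J \<subseteq> P\<rbrakk> \<Longrightarrow> I \<subseteq> P \<or> J \<subseteq> P"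

definition prime_radical :: "('a, 'b) ring_scheme \<Rightarrow> 'a set" where
  "prime_radical R = {x \<in> carrier R. \<forall>P. nc_prime_ideal P R \<longrightarrow> x \<in> P}"

primrec ideal_pow :: "('a, 'b) ring_scheme \<Rightarrow> 'a set \<Rightarrow> nat \<Rightarrow> 'a set" where
  "ideal_pow R I 0 = carrier R"
| "ideal_pow R I (Suc n) = ideal_pow R I n \<cdot>\<^bsub>R\<^esub> I"

definition nilpotent_ideal :: "('a, 'b) ring_scheme \<Rightarrow> 'a set \<Rightarrow> bool" where
  "nilpotent_ideal R I \<longleftrightarrow> ideal I R \<and> (\<exists>k. ideal_pow R I k = {\<zero>\<^bsub>R\<^esub>})"


section \<open>Left Ore sets and left rings of fractions\<close>

definition left_ore_set :: "('a, 'b) ring_scheme \<Rightarrow> 'a set \<Rightarrow> bool" where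
  "left_ore_set A S \<longleftrightarrow> submonoid S A \<and>
     (\<forall>a \<in> carrier A. \<forall>s \<in> S. \<exists>t \<in> S. \<exists>b \<in> carrier A. t \<otimes>\<^bsub>A\<^esub> a = b \<otimes>\<^bsub>A\<^esub> s)"

definition left_denominator_set :: "('a, 'b) ring_scheme \<Rightarrow> 'a set \<Rightarrow> bool" where
  "left_denominator_set A S \<longleftrightarrow> left_ore_set A S \<and>
     (\<forall>a \<in> carrier A. \<forall>s \<in> S. a \<otimes>\<^bsub>A\<^esub> s = \<zero>\<^bsub>A\<^esub> \<longrightarrow> (\<exists>t \<in> S. t \<otimes>\<^bsub>A\<^esub> a = \<zero>\<^bsub>A\<^esub>))"

text \<open>The left fraction \<open>s\<^sup>-\<^sup>1a\<close> is the class of the pair \<open>(s, a)\<close>: two left fractions agree iff they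
  can be expanded to one with the same denominator and the same numerator. Here \<open>c\<close> and \<open>d\<close> need
  not lie in \<open>S\<close>, only the common denominator.\<close>

definition frac_rel :: "('a, 'b) ring_scheme \<Rightarrow> 'a set \<Rightarrow> (('a \<times> 'a) \<times> ('a \<times> 'a)) set" where
  "frac_rel A S = {((s, a), (t, b)).
     s \<in> S \<and> a \<in> carrier A \<and> t \<in> S \<and> b \<in> carrier A \<and>
     (\<exists>c \<in> carrier A. \<exists>d \<in> carrier A.
        c \<otimes>\<^bsub>A\<^esub> s = d \<otimes>\<^bsub>A\<^esub> t \<and> c \<otimes>\<^bsub>A\<^esub> s \<in> S \<and> c \<otimes>\<^bsub>A\<^esub> a = d \<otimes>\<^bsub>A\<^esub> b)}"

definition left_frac :: "('a, 'b) ring_scheme \<Rightarrow> 'a set \<Rightarrow> 'a \<Rightarrow> 'a \<Rightarrow> ('a \<times> 'a) set" where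
  "left_frac A S s a = frac_rel A S `` {(s, a)}"

text \<open>The ring \<open>S\<^sup>-\<^sup>1A\<close>, meaningful when \<open>S\<close> is a left denominator set of \<open>A\<close>. The operations are
  \<open>s\<^sup>-\<^sup>1a + t\<^sup>-\<^sup>1b = (cs)\<^sup>-\<^sup>1(ca + db)\<close> if \<open>cs = dt \<in> S\<close>, and
  \<open>s\<^sup>-\<^sup>1a \<cdot> t\<^sup>-\<^sup>1b = (us)\<^sup>-\<^sup>1(cb)\<close> if \<open>u \<in> S\<close> and \<open>ua = ct\<close>. As for \<^const>\<open>rcoset_mult\<close>, the union
  over all choices is used; all choices give the same class.\<close>

definition left_fractions :: "('a, 'b) ring_scheme \<Rightarrow> 'a set \<Rightarrow> ('a \<times> 'a) set ring" where
  "left_fractions A S =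
     \<lparr>carrier = (S \<times> carrier A) // frac_rel A S,
      mult = (\<lambda>p q. \<Union> {left_frac A S (u \<otimes>\<^bsub>A\<^esub> s) (c \<otimes>\<^bsub>A\<^esub> b) | s a t b u c.
                (s, a) \<in> p \<and> (t, b) \<in> q \<and> u \<in> S \<and> c \<in> carrier A \<and>
                u \<otimes>\<^bsub>A\<^esub> a = c \<otimes>\<^bsub>A\<^esub> t}),
      one = left_frac A S \<one>\<^bsub>A\<^esub> \<one>\<^bsub>A\<^esub>,
      zero = left_frac A S \<one>\<^bsub>A\<^esub> \<zero>\<^bsub>A\<^esub>,
      add = (\<lambda>p q. \<Union> {left_frac A S (c \<otimes>\<^bsub>A\<^esub> s) ((c \<otimes>\<^bsub>A\<^esub> a) \<oplus>\<^bsub>A\<^esub> (d \<otimes>\<^bsub>A\<^esub> b)) | s a t b c d.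
                (s, a) \<in> p \<and> (t, b) \<in> q \<and> c \<in> carrier A \<and> d \<in> carrier A \<and>
                c \<otimes>\<^bsub>A\<^esub> s = d \<otimes>\<^bsub>A\<^esub> t \<and> c \<otimes>\<^bsub>A\<^esub> s \<in> S})\<rparr>"

text \<open>For the set of regular elements the extra condition on left denominator sets is vacuous.\<close>

definition has_left_quotient_ring :: "('a, 'b) ring_scheme \<Rightarrow> bool" where
  "has_left_quotient_ring R \<longleftrightarrow> left_ore_set R (regular_elements R)"

definition left_quotient_ring :: "('a, 'b) ring_scheme \<Rightarrow> ('a \<times> 'a) set ring" where
  "left_quotient_ring R = left_fractions R (regular_elements R)"


section \<open>The associated graded ring of the prime radical filtration\<close>

text \<open>An element is a finitely supported sequence whose \<open>i\<close>-th entry is a coset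
  \<open>x + \<nn>\<^sup>i\<^sup>+\<^sup>1\<close> with \<open>x \<in> \<nn>\<^sup>i\<close>. The product of homogeneous components
  \<open>(x + \<nn>\<^sup>i\<^sup>+\<^sup>1)(y + \<nn>\<^sup>j\<^sup>+\<^sup>1) = xy + \<nn>\<^sup>i\<^sup>+\<^sup>j\<^sup>+\<^sup>1\<close> is expressed by \<^const>\<open>rcoset_mult\<close>, and the
  component \<open>\<nn>\<^sup>k/\<nn>\<^sup>k\<^sup>+\<^sup>1\<close> is an additive subgroup of \<open>R/\<nn>\<^sup>k\<^sup>+\<^sup>1\<close>, where the products
  of total degree \<open>k\<close> are summed.\<close>

definition gr :: "('a, 'b) ring_scheme \<Rightarrow> (nat \<Rightarrow> 'a set) ring" where
  "gr R = (let N = ideal_pow R (prime_radical R) in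
     \<lparr>carrier = {f. (\<forall>i. f i \<in> (\<lambda>x. N (Suc i) +>\<^bsub>R\<^esub> x) ` N i) \<and>
                    finite {i. f i \<noteq> N (Suc i)}},
      mult = (\<lambda>f g k. \<Oplus>\<^bsub>R Quot N (Suc k)\<^esub> i \<in> {..k}.
                rcoset_mult R (N (Suc k)) (f i) (g (k - i))),
      one = (\<lambda>i. if i = 0 then N (Suc i) +>\<^bsub>R\<^esub> \<one>\<^bsub>R\<^esub> else N (Suc i)),
      zero = (\<lambda>i. N (Suc i)),
      add = (\<lambda>f g i. f i <+>\<^bsub>R\<^esub> g i)\<rparr>)"

definition gr_degree_zero :: "('a, 'b) ring_scheme \<Rightarrow> 'a set \<Rightarrow> (nat \<Rightarrow> 'a set)" where
  "gr_degree_zero R y = (\<lambda>i. if i = 0 then y else ideal_pow R (prime_radical R) (Suc i))"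

text \<open>\<open>C_bar R\<close> is the set of regular elements of \<open>R/\<nn>\<close>, viewed inside \<open>gr R\<close>; \<open>C_prime R\<close> is
  the set of all \<open>c \<in> R\<close> that are regular modulo \<open>\<nn>\<close>.\<close>

definition C_bar :: "('a, 'b) ring_scheme \<Rightarrow> (nat \<Rightarrow> 'a set) set" where
  "C_bar R = gr_degree_zero R ` regular_elements (R Quot prime_radical R)"

definition C_prime :: "('a, 'b) ring_scheme \<Rightarrow> 'a set" where
  "C_prime R =
     {c \<in> carrier R. prime_radical R +>\<^bsub>R\<^esub> c \<in> regular_elements (R Quot prime_radical R)}"

definition gr_torsion :: "('a, 'b) ring_scheme \<Rightarrow> (nat \<Rightarrow> 'a set) set" where
  "gr_torsion R = {u \<in> carrier (gr R). \<exists>c \<in> C_bar R. c \<otimes>\<^bsub>gr R\<^esub> u = \<zero>\<^bsub>gr R\<^esub>}"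

end

theory Submission
  imports Defs "HOL-Algebra.UnivPoly"
begin

text \<open>Left ideals of a localization \<open>S\<^sup>-\<^sup>1A\<close> correspond to the left ideals \<open>I\<close> of \<open>A\<close> that are
  saturated (\<open>sx \<in> I\<close> with \<open>s \<in> S\<close> implies \<open>x \<in> I\<close>), so \<open>S\<^sup>-\<^sup>1A\<close> is left Artinian iff \<open>A\<close>
  satisfies the descending chain condition on these. If \<open>Q = Q(R)\<close> is left Artinian and \<open>I\<close> is an
  ideal of \<open>R\<close>, the chain \<open>QI \<supseteq> QIc \<supseteq> QIc\<^sup>2 \<supseteq> \<dots>\<close> stops, whence \<open>QI\<close> is an ideal of \<open>Q\<close>. It follows
  that \<open>\<nn>\<close> is the contraction of the nilpotent prime radical \<open>N\<close> of \<open>Q\<close>, that \<open>Q\<nn>\<^sup>i = N\<^sup>i\<close>, that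
  \<open>C' = C\<close>, and that \<open>gr Q\<close>, which is left Artinian by a leading-term argument, is a localization of
  \<open>gr R\<close> at \<open>C_bar\<close>. Conversely, when \<open>\<nn>\<close> is nilpotent, the Ore condition and the chain condition on
  saturated left ideals lift from \<open>gr R\<close> to \<open>R\<close> degree by degree. Finally, the part of positive
  degree is nilpotent, so a regular element of \<open>gr R/\<tau>\<close> has its degree-zero component in \<open>C_bar\<close> and
  then has a left multiple in \<open>C_bar\<close>; hence \<open>Q(gr R/\<tau>)\<close> is a localization of \<open>gr R\<close> at \<open>C_bar\<close> as
  well, and the isomorphisms are instances of the uniqueness of localizations.\<close>

section \<open>Rings of left fractions\<close>

text \<open>The three rings to be compared have unrelated carriers, and \<open>gr R\<close> may have
  \<open>C_bar R\<close>-torsion, so maps into localizations cannot be treated as inclusions. This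
  is why localizations are handled through the locale \<open>left_localization\<close>, whose map
  may have a torsion kernel, and Artinianity through a chain condition that mentions only the ring
  and the denominators. A second obstacle: the lifting arguments give the Ore and chain conditions
  for \<open>C_prime R\<close>, or for the image of \<open>C_bar R\<close> in the torsion-free
  quotient, whereas a left quotient ring inverts all regular elements. The chain condition itself
  closes this gap: every regular element has a left multiple among the given denominators. That QI
  is an ideal of Q matters because it makes the passage from I to QI multiplicative; from this,
  primes of Q contract to primes and powers of the radical extend to powers. Nilpotency of N comes
  straight from the definition by primes: zero is a finite product of primes, each containing
  N.\<close>

lemma (in ring) minus_eq_zero_iff:
  assumes "a \<in> carrier R" "b \<in> carrier R"
  shows "a \<ominus> b = \<zero> \<longleftrightarrow> a = b"
  using assms by (metis a_minus_def add.inv_closed add.inv_equality add.r_inv minus_minus)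

locale left_denominator = ring A for A (structure) and S +
  assumes denominator: "left_denominator_set A S"
begin

abbreviation frac :: "'a \<Rightarrow> 'a \<Rightarrow> ('a \<times> 'a) set" where
  "frac s a \<equiv> left_frac A S s a"

lemma submonoid_S: "submonoid S A"
  using denominator by (simp add: left_denominator_set_def left_ore_set_def)

lemma S_carrier [simp]: "s \<in> S \<Longrightarrow> s \<in> carrier A"
  using submonoid_S by (meson submonoid.mem_carrier)

lemma S_mult [simp]: "s \<in> S \<Longrightarrow> t \<in> S \<Longrightarrow> s \<otimes> t \<in> S"
  using submonoid_S by (simp add: submonoid.m_closed)

lemma S_one [simp]: "\<one> \<in> S"
  using submonoid_S by (simp add: submonoid.one_closed)

lemma ore:
  assumes "a \<in> carrier A" "s \<in> S"
  obtains t b where "t \<in> S" "b \<in> carrier A" "t \<otimes> a = b \<otimes> s"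
  using assms denominator by (auto simp: left_denominator_set_def left_ore_set_def) (meson that)

text \<open>This is the denominator condition for \<open>a \<ominus> b\<close>: cancelling a
  denominator on the right costs a left factor \<open>t\<close>. Such factors are the reason why the
  computations below multiply by several auxiliary elements of \<open>S\<close>.\<close>

lemma cancel:
  assumes "a \<in> carrier A" "b \<in> carrier A" "s \<in> S" "a \<otimes> s = b \<otimes> s"
  obtains t where "t \<in> S" "t \<otimes> a = t \<otimes> b"
proof -
  have "(a \<ominus> b) \<otimes> s = \<zero>"
    using assms by (simp add: minus_eq l_distr l_minus r_neg)
  then obtain t where t: "t \<in> S" "t \<otimes> (a \<ominus> b) = \<zero>"
    using assms denominator by (auto simp: left_denominator_set_def)
  then have "t \<otimes> a = t \<otimes> b"
    using assms S_carrier[OF t(1)] minus_eq_zero_iff[of "t \<otimes> a" "t \<otimes> b"]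
    by (simp add: minus_eq r_distr r_minus)
  with t that show thesis by blast
qed

section \<open>Equality of left fractions\<close>

lemma frac_rel_iff:
  "((s, a), (t, b)) \<in> frac_rel A S \<longleftrightarrow> s \<in> S \<and> a \<in> carrier A \<and> t \<in> S \<and> b \<in> carrier A \<and>
     (\<exists>c \<in> carrier A. \<exists>d \<in> carrier A. c \<otimes> s = d \<otimes> t \<and> c \<otimes> s \<in> S \<and> c \<otimes> a = d \<otimes> b)"
  by (simp add: frac_rel_def)

text \<open>The Ore condition brings the two expansions \<open>d t\<close> and \<open>c' t\<close>
  of the middle denominator to a common left multiple, \<open>x d t = y c' t\<close>; the right
  factor \<open>t\<close> disappears only after a further left factor \<open>z\<close>.\<close>

lemma frac_rel_trans:
  assumes 1: "((s, a), (t, b)) \<in> frac_rel A S" and 2: "((t, b), (v, e)) \<in> frac_rel A S"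
  shows "((s, a), (v, e)) \<in> frac_rel A S"
proof -
  obtain c d where cd: "c \<in> carrier A" "d \<in> carrier A" "c \<otimes> s = d \<otimes> t" "c \<otimes> s \<in> S" "c \<otimes> a = d \<otimes> b"
    using 1 by (auto simp: frac_rel_iff)
  obtain c' d' where cd': "c' \<in> carrier A" "d' \<in> carrier A" "c' \<otimes> t = d' \<otimes> v" "c' \<otimes> t \<in> S"
      "c' \<otimes> b = d' \<otimes> e"
    using 2 by (auto simp: frac_rel_iff)
  have mem: "s \<in> S" "a \<in> carrier A" "t \<in> S" "b \<in> carrier A" "v \<in> S" "e \<in> carrier A"
    using 1 2 by (auto simp: frac_rel_iff)
  obtain x y where xy: "x \<in> S" "y \<in> carrier A" "x \<otimes> (d \<otimes> t) = y \<otimes> (c' \<otimes> t)"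
    using ore[of "d \<otimes> t" "c' \<otimes> t"] cd cd' mem by auto
  then obtain z where z: "z \<in> S" "z \<otimes> (x \<otimes> d) = z \<otimes> (y \<otimes> c')"
    using cancel[of "x \<otimes> d" "y \<otimes> c'" t] mem cd cd' by (auto simp: m_assoc)
  note [simp] = cd(1,2) cd'(1,2) mem xy(1,2) z(1)
  have "(z \<otimes> x \<otimes> c) \<otimes> s = (z \<otimes> (x \<otimes> d)) \<otimes> t"
    using cd(3) by (simp add: m_assoc)
  also have "\<dots> = (z \<otimes> y \<otimes> d') \<otimes> v"
    using cd'(3) by (simp add: z(2) m_assoc)
  finally have 1: "(z \<otimes> x \<otimes> c) \<otimes> s = (z \<otimes> y \<otimes> d') \<otimes> v" .
  have "(z \<otimes> x \<otimes> c) \<otimes> a = (z \<otimes> (x \<otimes> d)) \<otimes> b"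
    using cd(5) by (simp add: m_assoc)
  also have "\<dots> = (z \<otimes> y \<otimes> d') \<otimes> e"
    using cd'(5) by (simp add: z(2) m_assoc)
  finally have 2: "(z \<otimes> x \<otimes> c) \<otimes> a = (z \<otimes> y \<otimes> d') \<otimes> e" .
  have "(z \<otimes> x) \<otimes> (c \<otimes> s) \<in> S"
    using cd(4) by simp
  then have 3: "(z \<otimes> x \<otimes> c) \<otimes> s \<in> S"
    by (simp add: m_assoc)
  show ?thesis
    unfolding frac_rel_iff using 1 2 3 by (intro conjI bexI) auto
qed

lemma equiv_frac_rel: "equiv (S \<times> carrier A) (frac_rel A S)"
proof (rule equivI)
  show "frac_rel A S \<subseteq> (S \<times> carrier A) \<times> S \<times> carrier A"
    by (auto simp: frac_rel_def)
  show "refl_on (S \<times> carrier A) (frac_rel A S)"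
    by (auto simp: refl_on_def frac_rel_iff intro!: bexI[of _ \<one>])
  show "sym (frac_rel A S)"
  proof (rule symI)
    fix p q assume "(p, q) \<in> frac_rel A S"
    then show "(q, p) \<in> frac_rel A S"
      by (cases p; cases q) (clarsimp simp: frac_rel_iff, metis)
  qed
  show "trans (frac_rel A S)"
    using frac_rel_trans by (auto intro!: transI)
qed

lemma frac_eq_iff:
  assumes "s \<in> S" "a \<in> carrier A" "t \<in> S" "b \<in> carrier A"
  shows "frac s a = frac t b \<longleftrightarrow>
    (\<exists>c \<in> carrier A. \<exists>d \<in> carrier A. c \<otimes> s = d \<otimes> t \<and> c \<otimes> s \<in> S \<and> c \<otimes> a = d \<otimes> b)"
  unfolding left_frac_def
  using eq_equiv_class_iff[OF equiv_frac_rel, of "(s, a)" "(t, b)"] assms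
  by (simp add: frac_rel_iff)

lemma frac_eqI:
  assumes "s \<in> S" "a \<in> carrier A" "t \<in> S" "b \<in> carrier A"
    "c \<in> carrier A" "d \<in> carrier A" "c \<otimes> s = d \<otimes> t" "c \<otimes> s \<in> S" "c \<otimes> a = d \<otimes> b"
  shows "frac s a = frac t b"
  using assms frac_eq_iff by blast

lemma frac_expand:
  assumes "s \<in> S" "a \<in> carrier A" "c \<in> carrier A" "c \<otimes> s \<in> S"
  shows "frac (c \<otimes> s) (c \<otimes> a) = frac s a"
  using assms by (intro frac_eqI[of _ _ _ _ \<one> c]) auto

lemma mem_frac_iff:
  assumes "t \<in> S" "b \<in> carrier A"
  shows "(s, a) \<in> frac t b \<longleftrightarrow> s \<in> S \<and> a \<in> carrier A \<and> frac s a = frac t b"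
proof -
  have "(s, a) \<in> frac t b \<longleftrightarrow> ((t, b), (s, a)) \<in> frac_rel A S"
    by (simp add: left_frac_def)
  also have "\<dots> \<longleftrightarrow> s \<in> S \<and> a \<in> carrier A \<and> frac t b = frac s a"
    using assms frac_eq_iff[of t b s a] by (auto simp: frac_rel_iff)
  finally show ?thesis by auto
qed

lemma frac_carrier [simp]:
  "s \<in> S \<Longrightarrow> a \<in> carrier A \<Longrightarrow> frac s a \<in> carrier (left_fractions A S)"
  by (auto simp: left_fractions_def left_frac_def quotient_def)

lemma carrier_fracE:
  assumes "p \<in> carrier (left_fractions A S)"
  obtains s a where "s \<in> S" "a \<in> carrier A" "p = frac s a"
  using assms by (auto simp: left_fractions_def left_frac_def quotient_def)

text \<open>The multipliers \<open>u\<close> and \<open>u'\<close> are only required to carry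
  \<open>s\<close> into \<open>S\<close>, because the multiplier \<open>v x\<close> that compares
  two representatives in \<open>frac_mult\<close> need not lie in \<open>S\<close>. Cancelling
  \<open>s\<close> costs the factor \<open>z\<close>, cancelling \<open>t\<close> the factor
  \<open>w\<close>.\<close>

lemma mult_choice_independent:
  assumes [simp]: "s \<in> S" "t \<in> S" "a \<in> carrier A" "b \<in> carrier A"
    "u \<in> carrier A" "u' \<in> carrier A" "c \<in> carrier A" "c' \<in> carrier A"
    and us: "u \<otimes> s \<in> S" "u' \<otimes> s \<in> S" and uc: "u \<otimes> a = c \<otimes> t" "u' \<otimes> a = c' \<otimes> t"
  shows "frac (u \<otimes> s) (c \<otimes> b) = frac (u' \<otimes> s) (c' \<otimes> b)"
proof -
  obtain x y where xy [simp]: "x \<in> S" "y \<in> carrier A" and xy': "x \<otimes> (u \<otimes> s) = y \<otimes> (u' \<otimes> s)"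
    using ore[of "u \<otimes> s" "u' \<otimes> s"] us by auto
  obtain z where z [simp]: "z \<in> S" and z': "z \<otimes> (x \<otimes> u) = z \<otimes> (y \<otimes> u')"
    using cancel[of "x \<otimes> u" "y \<otimes> u'" s] xy' by (auto simp: m_assoc)
  have "(z \<otimes> x \<otimes> c) \<otimes> t = (z \<otimes> (x \<otimes> u)) \<otimes> a"
    using uc by (simp add: m_assoc)
  also have "\<dots> = (z \<otimes> y \<otimes> c') \<otimes> t"
    using uc by (simp add: z' m_assoc)
  finally obtain w where w [simp]: "w \<in> S" and w': "w \<otimes> (z \<otimes> x \<otimes> c) = w \<otimes> (z \<otimes> y \<otimes> c')"
    using cancel[of "z \<otimes> x \<otimes> c" "z \<otimes> y \<otimes> c'" t] by auto
  have "w \<otimes> z \<otimes> (x \<otimes> (u \<otimes> s)) \<in> S"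
    using us by simp
  then have 1: "w \<otimes> z \<otimes> x \<otimes> (u \<otimes> s) \<in> S"
    using us by (simp add: m_assoc)
  have 2: "w \<otimes> z \<otimes> x \<otimes> (u \<otimes> s) = w \<otimes> z \<otimes> y \<otimes> (u' \<otimes> s)"
    using xy' by (simp add: m_assoc)
  have 3: "w \<otimes> z \<otimes> x \<otimes> (c \<otimes> b) = w \<otimes> z \<otimes> y \<otimes> (c' \<otimes> b)"
  proof -
    have "w \<otimes> z \<otimes> x \<otimes> (c \<otimes> b) = w \<otimes> (z \<otimes> x \<otimes> c) \<otimes> b" by (simp add: m_assoc)
    also have "\<dots> = w \<otimes> z \<otimes> y \<otimes> (c' \<otimes> b)" by (subst w') (simp add: m_assoc)
    finally show ?thesis .
  qed
  show ?thesis
    using us 1 2 3 by (intro frac_eqI[of _ _ _ _ "w \<otimes> z \<otimes> x" "w \<otimes> z \<otimes> y"]) simp_all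
qed

lemma frac_mult:
  assumes "s \<in> S" "a \<in> carrier A" "t \<in> S" "b \<in> carrier A"
    "u \<in> carrier A" "c \<in> carrier A" "u \<otimes> s \<in> S" "u \<otimes> a = c \<otimes> t"
  shows "frac s a \<otimes>\<^bsub>left_fractions A S\<^esub> frac t b = frac (u \<otimes> s) (c \<otimes> b)"
proof -
  have indep: "frac (u' \<otimes> s') (c' \<otimes> b') = frac (u \<otimes> s) (c \<otimes> b)"
    if "(s', a') \<in> frac s a" "(t', b') \<in> frac t b" "u' \<in> S" "c' \<in> carrier A" "u' \<otimes> a' = c' \<otimes> t'"
    for s' a' t' b' u' c'
  proof -
    have [simp]: "s' \<in> S" "a' \<in> carrier A" "t' \<in> S" "b' \<in> carrier A" "u' \<in> S" "c' \<in> carrier A"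
      and "frac s a = frac s' a'" "frac t b = frac t' b'"
      using that assms by (auto simp: mem_frac_iff)
    note [simp] = assms(1-6)
    obtain x x' where x: "x \<in> carrier A" "x' \<in> carrier A" "x \<otimes> s = x' \<otimes> s'" "x \<otimes> s \<in> S"
        "x \<otimes> a = x' \<otimes> a'"
      using \<open>frac s a = frac s' a'\<close> frac_eq_iff[of s a s' a'] by auto
    obtain y y' where y: "y \<in> carrier A" "y' \<in> carrier A" "y \<otimes> t = y' \<otimes> t'" "y \<otimes> t \<in> S"
        "y \<otimes> b = y' \<otimes> b'"
      using \<open>frac t b = frac t' b'\<close> frac_eq_iff[of t b t' b'] by auto
    note [simp] = x(1,2) y(1,2)
    \<comment> \<open>The product is computed once more from the common expansions
      \<open>(x s, x a)\<close> and \<open>(y t, y b)\<close>, which can be read off from either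
      pair of representatives.\<close>
    obtain v d where v [simp]: "v \<in> S" "d \<in> carrier A"
        and vd: "v \<otimes> (x \<otimes> a) = d \<otimes> (y \<otimes> t)"
      using ore[of "x \<otimes> a" "y \<otimes> t"] y by auto
    have "frac (u \<otimes> s) (c \<otimes> b) = frac ((v \<otimes> x) \<otimes> s) ((d \<otimes> y) \<otimes> b)"
    proof (rule mult_choice_independent[where a = a and t = t])
      show "(v \<otimes> x) \<otimes> s \<in> S" using x by (simp add: m_assoc)
      show "(v \<otimes> x) \<otimes> a = (d \<otimes> y) \<otimes> t" using vd by (simp add: m_assoc)
    qed (use assms in auto)
    also have "\<dots> = frac ((v \<otimes> x') \<otimes> s') ((d \<otimes> y') \<otimes> b')"
      using x y by (simp add: m_assoc)
    also have "\<dots> = frac (u' \<otimes> s') (c' \<otimes> b')"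
    proof (rule mult_choice_independent[where a = a' and t = t'])
      show "(v \<otimes> x') \<otimes> s' \<in> S" using x by (simp add: m_assoc)
      show "(v \<otimes> x') \<otimes> a' = (d \<otimes> y') \<otimes> t'" using vd x y by (simp add: m_assoc)
    qed (use that in auto)
    finally show ?thesis by simp
  qed
  \<comment> \<open>The union in the definition ranges over multipliers in \<open>S\<close>, while
    the given \<open>u\<close> only satisfies \<open>u s \<in> S\<close>. The Ore condition supplies
    an admissible choice, so the set of values is the singleton and not empty.\<close>
  obtain u' c' where u': "u' \<in> S" "c' \<in> carrier A" "u' \<otimes> a = c' \<otimes> t"
    using ore[of a t] assms by auto
  have sa: "(s, a) \<in> frac s a" and tb: "(t, b) \<in> frac t b"
    using assms by (auto simp: mem_frac_iff)
  have "{frac (u' \<otimes> s') (c' \<otimes> b') | s' a' t' b' u' c'.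
      (s', a') \<in> frac s a \<and> (t', b') \<in> frac t b \<and> u' \<in> S \<and> c' \<in> carrier A \<and>
      u' \<otimes> a' = c' \<otimes> t'} = {frac (u \<otimes> s) (c \<otimes> b)}" (is "?M = _")
  proof (intro equalityI subsetI)
    fix p assume "p \<in> {frac (u \<otimes> s) (c \<otimes> b)}"
    then have "p = frac (u' \<otimes> s) (c' \<otimes> b)"
      using indep sa tb u' by simp
    then show "p \<in> ?M"
      using sa tb u' by blast
  qed (use indep in blast)
  then show ?thesis
    by (simp add: left_fractions_def)
qed

text \<open>Both denominators have to be cancelled: \<open>z\<close> makes the multipliers of
  \<open>a\<close> agree, \<open>w\<close> those of \<open>b\<close>.\<close>

lemma add_choice_independent:
  assumes [simp]: "s \<in> S" "t \<in> S" "a \<in> carrier A" "b \<in> carrier A"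
    "c \<in> carrier A" "c' \<in> carrier A" "d \<in> carrier A" "d' \<in> carrier A"
    and cd: "c \<otimes> s = d \<otimes> t" "c' \<otimes> s = d' \<otimes> t" "c \<otimes> s \<in> S" "c' \<otimes> s \<in> S"
  shows "frac (c \<otimes> s) (c \<otimes> a \<oplus> d \<otimes> b) = frac (c' \<otimes> s) (c' \<otimes> a \<oplus> d' \<otimes> b)"
proof -
  obtain x y where xy [simp]: "x \<in> S" "y \<in> carrier A" and xy': "x \<otimes> (c \<otimes> s) = y \<otimes> (c' \<otimes> s)"
    using ore[of "c \<otimes> s" "c' \<otimes> s"] cd by auto
  obtain z where z [simp]: "z \<in> S" and z': "z \<otimes> (x \<otimes> c) = z \<otimes> (y \<otimes> c')"
    using cancel[of "x \<otimes> c" "y \<otimes> c'" s] xy' by (auto simp: m_assoc)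
  have "(x \<otimes> d) \<otimes> t = (y \<otimes> d') \<otimes> t"
    using xy' cd by (simp add: m_assoc)
  then have "(z \<otimes> (x \<otimes> d)) \<otimes> t = (z \<otimes> (y \<otimes> d')) \<otimes> t"
    by (simp add: m_assoc)
  then obtain w where w [simp]: "w \<in> S" and w': "w \<otimes> (z \<otimes> (x \<otimes> d)) = w \<otimes> (z \<otimes> (y \<otimes> d'))"
    using cancel[of "z \<otimes> (x \<otimes> d)" "z \<otimes> (y \<otimes> d')" t] by auto
  have 1: "w \<otimes> z \<otimes> x \<otimes> c = w \<otimes> z \<otimes> y \<otimes> c'"
    using z' by (simp add: m_assoc)
  have 2: "w \<otimes> z \<otimes> x \<otimes> d = w \<otimes> z \<otimes> y \<otimes> d'"
    using w' by (simp add: m_assoc)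
  have "w \<otimes> z \<otimes> (x \<otimes> (c \<otimes> s)) \<in> S"
    using cd by simp
  then have 3: "w \<otimes> z \<otimes> x \<otimes> (c \<otimes> s) \<in> S"
    using cd by (simp add: m_assoc)
  have 4: "w \<otimes> z \<otimes> x \<otimes> (c \<otimes> s) = w \<otimes> z \<otimes> y \<otimes> (c' \<otimes> s)"
    using xy' by (simp add: m_assoc)
  have "w \<otimes> z \<otimes> x \<otimes> (c \<otimes> a \<oplus> d \<otimes> b) = (w \<otimes> z \<otimes> x \<otimes> c) \<otimes> a \<oplus> (w \<otimes> z \<otimes> x \<otimes> d) \<otimes> b"
    by (simp add: m_assoc r_distr)
  also have "\<dots> = w \<otimes> z \<otimes> y \<otimes> (c' \<otimes> a \<oplus> d' \<otimes> b)"
    unfolding 1 2 by (simp add: m_assoc r_distr)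
  finally show ?thesis
    using cd(3,4) 3 4 by (intro frac_eqI[of _ _ _ _ "w \<otimes> z \<otimes> x" "w \<otimes> z \<otimes> y"]) auto
qed

lemma frac_add:
  assumes "s \<in> S" "a \<in> carrier A" "t \<in> S" "b \<in> carrier A"
    "c \<in> carrier A" "d \<in> carrier A" "c \<otimes> s = d \<otimes> t" "c \<otimes> s \<in> S"
  shows "frac s a \<oplus>\<^bsub>left_fractions A S\<^esub> frac t b = frac (c \<otimes> s) (c \<otimes> a \<oplus> d \<otimes> b)"
proof -
  have indep: "frac (c' \<otimes> s') (c' \<otimes> a' \<oplus> d' \<otimes> b') = frac (c \<otimes> s) (c \<otimes> a \<oplus> d \<otimes> b)"
    if "(s', a') \<in> frac s a" "(t', b') \<in> frac t b" "c' \<in> carrier A" "d' \<in> carrier A"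
      "c' \<otimes> s' = d' \<otimes> t'" "c' \<otimes> s' \<in> S" for s' a' t' b' c' d'
  proof -
    have [simp]: "s' \<in> S" "a' \<in> carrier A" "t' \<in> S" "b' \<in> carrier A" "c' \<in> carrier A" "d' \<in> carrier A"
      and "frac s a = frac s' a'" "frac t b = frac t' b'"
      using that assms by (auto simp: mem_frac_iff)
    note [simp] = assms(1-6)
    obtain x x' where x: "x \<in> carrier A" "x' \<in> carrier A" "x \<otimes> s = x' \<otimes> s'" "x \<otimes> s \<in> S"
        "x \<otimes> a = x' \<otimes> a'"
      using \<open>frac s a = frac s' a'\<close> frac_eq_iff[of s a s' a'] by auto
    obtain y y' where y: "y \<in> carrier A" "y' \<in> carrier A" "y \<otimes> t = y' \<otimes> t'" "y \<otimes> t \<in> S"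
        "y \<otimes> b = y' \<otimes> b'"
      using \<open>frac t b = frac t' b'\<close> frac_eq_iff[of t b t' b'] by auto
    note [simp] = x(1,2) y(1,2)
    obtain v e where v [simp]: "v \<in> S" "e \<in> carrier A"
        and ve: "v \<otimes> (x \<otimes> s) = e \<otimes> (y \<otimes> t)"
      using ore[of "x \<otimes> s" "y \<otimes> t"] y by auto
    have "frac (c \<otimes> s) (c \<otimes> a \<oplus> d \<otimes> b) =
        frac ((v \<otimes> x) \<otimes> s) ((v \<otimes> x) \<otimes> a \<oplus> (e \<otimes> y) \<otimes> b)"
    proof (rule add_choice_independent[where a = a and t = t])
      show "(v \<otimes> x) \<otimes> s \<in> S" using x by (simp add: m_assoc)
      show "(v \<otimes> x) \<otimes> s = (e \<otimes> y) \<otimes> t" using ve by (simp add: m_assoc)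
    qed (use assms in auto)
    also have "\<dots> = frac ((v \<otimes> x') \<otimes> s') ((v \<otimes> x') \<otimes> a' \<oplus> (e \<otimes> y') \<otimes> b')"
      using x y by (simp add: m_assoc)
    also have "\<dots> = frac (c' \<otimes> s') (c' \<otimes> a' \<oplus> d' \<otimes> b')"
    proof (rule add_choice_independent[where a = a' and t = t'])
      show "(v \<otimes> x') \<otimes> s' \<in> S" using x by (simp add: m_assoc)
      show "(v \<otimes> x') \<otimes> s' = (e \<otimes> y') \<otimes> t'" using ve x y by (simp add: m_assoc)
    qed (use that in auto)
    finally show ?thesis by simp
  qed
  have sa: "(s, a) \<in> frac s a" and tb: "(t, b) \<in> frac t b"
    using assms by (auto simp: mem_frac_iff)
  have "{frac (c' \<otimes> s') (c' \<otimes> a' \<oplus> d' \<otimes> b') | s' a' t' b' c' d'.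
      (s', a') \<in> frac s a \<and> (t', b') \<in> frac t b \<and> c' \<in> carrier A \<and> d' \<in> carrier A \<and>
      c' \<otimes> s' = d' \<otimes> t' \<and> c' \<otimes> s' \<in> S} = {frac (c \<otimes> s) (c \<otimes> a \<oplus> d \<otimes> b)}" (is "?M = _")
  proof (intro equalityI subsetI)
    fix p assume "p \<in> {frac (c \<otimes> s) (c \<otimes> a \<oplus> d \<otimes> b)}"
    then show "p \<in> ?M"
      using sa tb assms by blast
  qed (use indep in blast)
  then show ?thesis
    by (simp add: left_fractions_def)
qed


section \<open>The ring axioms for the left fractions\<close>

abbreviation loc where "loc \<equiv> left_fractions A S"

lemma common_denominator:
  assumes "p \<in> carrier loc" "q \<in> carrier loc"
  obtains s a b where "s \<in> S" "a \<in> carrier A" "b \<in> carrier A" "p = frac s a" "q = frac s b"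
proof -
  obtain s a where sa: "s \<in> S" "a \<in> carrier A" "p = frac s a"
    using assms carrier_fracE by blast
  obtain t b where tb: "t \<in> S" "b \<in> carrier A" "q = frac t b"
    using assms carrier_fracE by blast
  obtain u c where uc: "u \<in> S" "c \<in> carrier A" "u \<otimes> s = c \<otimes> t"
    using ore[of s t] sa tb by auto
  have us: "u \<otimes> s \<in> S"
    by (rule S_mult[OF uc(1) sa(1)])
  have "p = frac (u \<otimes> s) (u \<otimes> a)"
    by (simp only: sa(3) frac_expand[OF sa(1,2) S_carrier[OF uc(1)] us])
  moreover have "q = frac (u \<otimes> s) (c \<otimes> b)"
    unfolding uc(3) using tb uc us by (simp only: frac_expand)
  ultimately show thesis
    using that[OF us] sa(2) S_carrier[OF uc(1)] uc(2) tb(2) by blast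
qed

text \<open>A chain of factors can be written so that neighbouring denominators cancel.\<close>

lemma left_multiple_representation:
  assumes "p \<in> carrier loc" "t \<in> S"
  obtains s a where "s \<in> S" "a \<in> carrier A" "p = frac s (a \<otimes> t)"
proof -
  obtain s a where sa: "s \<in> S" "a \<in> carrier A" "p = frac s a"
    using assms carrier_fracE by blast
  obtain u c where uc: "u \<in> S" "c \<in> carrier A" "u \<otimes> a = c \<otimes> t"
    using ore[of a t] sa assms by auto
  have "p = frac (u \<otimes> s) (c \<otimes> t)"
    using sa uc frac_expand[of s a u] by simp
  then show thesis
    using that[of "u \<otimes> s" c] sa uc by simp
qed

lemma frac_add_same:
  assumes "s \<in> S" "a \<in> carrier A" "b \<in> carrier A"
  shows "frac s a \<oplus>\<^bsub>loc\<^esub> frac s b = frac s (a \<oplus> b)"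
  using frac_add[of s a s b \<one> \<one>] assms by simp

lemma frac_mult_cancel:
  assumes "s \<in> S" "a \<in> carrier A" "t \<in> S" "b \<in> carrier A"
  shows "frac s (a \<otimes> t) \<otimes>\<^bsub>loc\<^esub> frac t b = frac s (a \<otimes> b)"
  using frac_mult[of s "a \<otimes> t" t b \<one> a] assms by simp

lemma loc_one: "\<one>\<^bsub>loc\<^esub> = frac \<one> \<one>" and loc_zero: "\<zero>\<^bsub>loc\<^esub> = frac \<one> \<zero>"
  by (simp_all add: left_fractions_def)

lemma frac_self: "s \<in> S \<Longrightarrow> frac s s = frac \<one> \<one>"
  using frac_expand[of \<one> \<one> s] by simp

lemma frac_zero: "s \<in> S \<Longrightarrow> frac s \<zero> = frac \<one> \<zero>"
  using frac_expand[of \<one> \<zero> s] by simp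

lemma left_fractions_abelian_group: "abelian_group loc"
proof (rule abelian_groupI)
  fix p q assume pq: "p \<in> carrier loc" "q \<in> carrier loc"
  obtain s a b where "s \<in> S" "a \<in> carrier A" "b \<in> carrier A" "p = frac s a" "q = frac s b"
    by (rule common_denominator[OF pq])
  then show "p \<oplus>\<^bsub>loc\<^esub> q \<in> carrier loc" "p \<oplus>\<^bsub>loc\<^esub> q = q \<oplus>\<^bsub>loc\<^esub> p"
    by (simp_all add: frac_add_same a_comm)
next
  fix p q r assume pqr: "p \<in> carrier loc" "q \<in> carrier loc" "r \<in> carrier loc"
  obtain s a b where s: "s \<in> S" "a \<in> carrier A" "b \<in> carrier A" "p = frac s a" "q = frac s b"
    by (rule common_denominator[OF pqr(1,2)])
  \<comment> \<open>Bringing \<open>frac s \<one>\<close> and \<open>r\<close> to one denominator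
    records how \<open>s\<close> has to be expanded: comparing \<open>frac s \<one>\<close> with
    \<open>frac t e\<close> gives \<open>u s = v t\<close>, a denominator shared by
    \<open>p\<close>, \<open>q\<close> and \<open>r\<close>.\<close>
  obtain t e d where t: "t \<in> S" "e \<in> carrier A" "d \<in> carrier A"
      "frac s \<one> = frac t e" "r = frac t d"
    using common_denominator[of "frac s \<one>" r] pqr s frac_carrier one_closed by metis
  have "\<exists>u \<in> carrier A. \<exists>v \<in> carrier A. u \<otimes> s = v \<otimes> t \<and> u \<otimes> s \<in> S \<and> u \<otimes> \<one> = v \<otimes> e"
    using frac_eq_iff[of s \<one> t e] s t by simp
  then obtain u v where uv: "u \<in> carrier A" "v \<in> carrier A" "u \<otimes> s = v \<otimes> t" "u \<otimes> s \<in> S"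
    by blast
  have "p = frac (u \<otimes> s) (u \<otimes> a)" "q = frac (u \<otimes> s) (u \<otimes> b)"
    by (simp_all only: s(4,5) frac_expand[OF s(1,2) uv(1,4)] frac_expand[OF s(1,3) uv(1,4)])
  moreover have "r = frac (u \<otimes> s) (v \<otimes> d)"
    unfolding t(5) uv(3) using t(1-3) uv by (simp only: frac_expand)
  ultimately show "p \<oplus>\<^bsub>loc\<^esub> q \<oplus>\<^bsub>loc\<^esub> r = p \<oplus>\<^bsub>loc\<^esub> (q \<oplus>\<^bsub>loc\<^esub> r)"
    using s t uv by (simp add: frac_add_same a_assoc)
next
  fix p assume p: "p \<in> carrier loc"
  obtain s a where sa: "s \<in> S" "a \<in> carrier A" "p = frac s a"
    by (rule carrier_fracE[OF p])
  then show "\<zero>\<^bsub>loc\<^esub> \<oplus>\<^bsub>loc\<^esub> p = p"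
    using frac_add_same[of s \<zero> a] by (simp add: loc_zero frac_zero[OF sa(1)])
  show "\<exists>q\<in>carrier loc. q \<oplus>\<^bsub>loc\<^esub> p = \<zero>\<^bsub>loc\<^esub>"
    using sa frac_add_same[of s "\<ominus> a" a]
    by (intro bexI[of _ "frac s (\<ominus> a)"]) (simp_all add: loc_zero frac_zero[OF sa(1)] l_neg)
qed (simp add: loc_zero)

lemma left_fractions_ring: "ring loc"
proof (rule ringI[OF left_fractions_abelian_group])
  show "Group.monoid loc"
  proof (rule monoidI)
    fix p q assume p: "p \<in> carrier loc" and q: "q \<in> carrier loc"
    obtain t b where tb: "t \<in> S" "b \<in> carrier A" "q = frac t b"
      by (rule carrier_fracE[OF q])
    obtain s a where "s \<in> S" "a \<in> carrier A" "p = frac s (a \<otimes> t)"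
      by (rule left_multiple_representation[OF p tb(1)])
    with tb show "p \<otimes>\<^bsub>loc\<^esub> q \<in> carrier loc"
      by (simp add: frac_mult_cancel)
  next
    fix p q r assume p: "p \<in> carrier loc" and q: "q \<in> carrier loc" and r: "r \<in> carrier loc"
    obtain v d where v: "v \<in> S" "d \<in> carrier A" "r = frac v d"
      by (rule carrier_fracE[OF r])
    obtain t b where t: "t \<in> S" "b \<in> carrier A" "q = frac t (b \<otimes> v)"
      by (rule left_multiple_representation[OF q v(1)])
    obtain s a where s: "s \<in> S" "a \<in> carrier A" "p = frac s (a \<otimes> t)"
      by (rule left_multiple_representation[OF p t(1)])
    have "p \<otimes>\<^bsub>loc\<^esub> q = frac s ((a \<otimes> b) \<otimes> v)"
      using s t v by (simp add: frac_mult_cancel m_assoc)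
    then show "p \<otimes>\<^bsub>loc\<^esub> q \<otimes>\<^bsub>loc\<^esub> r = p \<otimes>\<^bsub>loc\<^esub> (q \<otimes>\<^bsub>loc\<^esub> r)"
      using s t v by (simp only: frac_mult_cancel m_closed S_carrier) (simp add: m_assoc)
  next
    fix p assume p: "p \<in> carrier loc"
    obtain s a where s: "s \<in> S" "a \<in> carrier A" "p = frac s a"
      by (rule carrier_fracE[OF p])
    show "\<one>\<^bsub>loc\<^esub> \<otimes>\<^bsub>loc\<^esub> p = p"
      using frac_mult_cancel[of s \<one> s a] s by (simp add: loc_one frac_self[OF s(1)])
    show "p \<otimes>\<^bsub>loc\<^esub> \<one>\<^bsub>loc\<^esub> = p"
      using frac_mult_cancel[of s a \<one> \<one>] s by (simp add: loc_one)
  qed (simp add: loc_one)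
next
  fix p q r assume pqr: "p \<in> carrier loc" "q \<in> carrier loc" "r \<in> carrier loc"
  obtain s a b where s: "s \<in> S" "a \<in> carrier A" "b \<in> carrier A" "p = frac s a" "q = frac s b"
    by (rule common_denominator[OF pqr(1,2)])
  obtain t d where t: "t \<in> S" "d \<in> carrier A" "r = frac t d"
    by (rule carrier_fracE[OF pqr(3)])
  \<comment> \<open>Two Ore steps in a row: \<open>u\<close> turns the first numerator into a left
    multiple of \<open>t\<close>, then \<open>v\<close> does so for the second, and multiplying the
    first by \<open>v\<close> does no harm.\<close>
  obtain u c where u: "u \<in> S" "c \<in> carrier A" "u \<otimes> a = c \<otimes> t"
    using ore[of a t] s t by auto
  obtain v e where v: "v \<in> S" "e \<in> carrier A" "v \<otimes> (u \<otimes> b) = e \<otimes> t"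
    using ore[of "u \<otimes> b" t] s t u by auto
  have "p = frac (v \<otimes> u \<otimes> s) (v \<otimes> u \<otimes> a)" "q = frac (v \<otimes> u \<otimes> s) (v \<otimes> u \<otimes> b)"
    using s u v frac_expand by simp_all
  then have "p = frac (v \<otimes> u \<otimes> s) (v \<otimes> c \<otimes> t)" "q = frac (v \<otimes> u \<otimes> s) (e \<otimes> t)"
    using s t u v by (simp_all add: m_assoc)
  moreover from this have "p \<oplus>\<^bsub>loc\<^esub> q = frac (v \<otimes> u \<otimes> s) ((v \<otimes> c \<oplus> e) \<otimes> t)"
    using s(1) t u v by (simp add: frac_add_same l_distr)
  ultimately show "(p \<oplus>\<^bsub>loc\<^esub> q) \<otimes>\<^bsub>loc\<^esub> r = p \<otimes>\<^bsub>loc\<^esub> r \<oplus>\<^bsub>loc\<^esub> q \<otimes>\<^bsub>loc\<^esub> r"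
    using s(1) t u(1,2) v(1,2)
    by (simp only: frac_mult_cancel S_carrier S_mult m_closed a_closed)
      (simp add: frac_add_same l_distr)
next
  fix p q r assume pqr: "p \<in> carrier loc" "q \<in> carrier loc" "r \<in> carrier loc"
  obtain s a b where s: "s \<in> S" "a \<in> carrier A" "b \<in> carrier A" "p = frac s a" "q = frac s b"
    by (rule common_denominator[OF pqr(1,2)])
  obtain t d where t: "t \<in> S" "d \<in> carrier A" "r = frac t (d \<otimes> s)"
    by (rule left_multiple_representation[OF pqr(3) s(1)])
  show "r \<otimes>\<^bsub>loc\<^esub> (p \<oplus>\<^bsub>loc\<^esub> q) = r \<otimes>\<^bsub>loc\<^esub> p \<oplus>\<^bsub>loc\<^esub> r \<otimes>\<^bsub>loc\<^esub> q"
    using s t by (simp add: frac_mult_cancel frac_add_same r_distr)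
qed

end

section \<open>Left ideals and chain conditions\<close>

text \<open>Closure under negation comes from left multiplication by
  \<open>\<ominus> \<one>\<close>.\<close>

lemma (in ring) left_idealI:
  assumes "I \<subseteq> carrier R" "\<zero> \<in> I" "\<And>x y. x \<in> I \<Longrightarrow> y \<in> I \<Longrightarrow> x \<oplus> y \<in> I"
    and l: "\<And>x a. x \<in> I \<Longrightarrow> a \<in> carrier R \<Longrightarrow> a \<otimes> x \<in> I"
  shows "left_ideal I R"
proof -
  have "\<ominus> x \<in> I" if "x \<in> I" for x
    using l[OF that, of "\<ominus> \<one>"] that assms(1) by (auto simp: l_minus)
  then have "additive_subgroup I R"
    using assms by (intro additive_subgroupI subgroup.intro) (auto simp flip: a_inv_def)
  then show ?thesis
    using l by (simp add: left_ideal_def left_ideal_axioms_def ring_axioms)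
qed

lemma (in ring) idealI':
  assumes "left_ideal I R" and "\<And>x a. x \<in> I \<Longrightarrow> a \<in> carrier R \<Longrightarrow> x \<otimes> a \<in> I"
  shows "ideal I R"
proof -
  interpret left_ideal I R by fact
  show ?thesis
    by (rule idealI) (use assms a_subgroup l_closed ring_axioms in auto)
qed

lemma (in ideal) is_left_ideal: "left_ideal I R"
  by (intro left_ideal.intro left_ideal_axioms.intro is_additive_subgroup ring_axioms)
    (rule I_l_closed)

lemma antimono_chain:
  assumes "\<And>i::nat. J (Suc i) \<subseteq> J i" "i \<le> j"
  shows "J j \<subseteq> J i"
  using assms(2) by (rule lift_Suc_antimono_le[rotated]) (rule assms(1))

text \<open>In module terms: the left module \<open>A/I\<close> has no nonzero element killed by an
  element of \<open>S\<close>.\<close>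

definition saturated_left_ideal :: "('a, 'b) ring_scheme \<Rightarrow> 'a set \<Rightarrow> 'a set \<Rightarrow> bool" where
  "saturated_left_ideal A S I \<longleftrightarrow> left_ideal I A \<and>
     (\<forall>s \<in> S. \<forall>x \<in> carrier A. s \<otimes>\<^bsub>A\<^esub> x \<in> I \<longrightarrow> x \<in> I)"

definition saturated_dcc :: "('a, 'b) ring_scheme \<Rightarrow> 'a set \<Rightarrow> bool" where
  "saturated_dcc A S \<longleftrightarrow> (\<forall>J :: nat \<Rightarrow> 'a set.
     (\<forall>i. saturated_left_ideal A S (J i)) \<and> (\<forall>i. J (Suc i) \<subseteq> J i) \<longrightarrow> (\<exists>m. \<forall>i\<ge>m. J i = J m))"

lemma saturated_dccD:
  assumes "saturated_dcc A S" "\<And>i. saturated_left_ideal A S (J i)" "\<And>i::nat. J (Suc i) \<subseteq> J i"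
  obtains m where "\<And>i. i \<ge> m \<Longrightarrow> J i = J m"
  using assms unfolding saturated_dcc_def by meson

text \<open>A larger set of denominators leaves fewer saturated left ideals. This carries the chain
  condition from \<open>C_prime R\<close>, or from the image of \<open>C_bar R\<close>, to the set
  of all regular elements.\<close>

lemma saturated_dcc_mono:
  assumes "saturated_dcc A S" "S \<subseteq> T"
  shows "saturated_dcc A T"
  using assms unfolding saturated_dcc_def saturated_left_ideal_def by (meson subsetD)

text \<open>The left ideals \<open>J i = R c^i + N\<close> descend. Where they stop,
  \<open>(\<one> \<ominus> q c) c^m\<close> lies in \<open>N\<close>, and \<open>c^m\<close> can be
  cancelled modulo \<open>N\<close>. The case \<open>N = 0\<close> produces units; the case of the
  prime radical deals with elements that are regular modulo it.\<close>

lemma (in left_artinian_ring) right_cancellable_left_invertible_mod: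
  assumes "ideal N R" and c: "c \<in> carrier R"
    and inj: "\<And>q. q \<in> carrier R \<Longrightarrow> q \<otimes> c \<in> N \<Longrightarrow> q \<in> N"
  obtains q where "q \<in> carrier R" "\<one> \<ominus> q \<otimes> c \<in> N"
proof -
  interpret N: ideal N R by fact
  have inj_pow: "q \<in> N" if "q \<in> carrier R" "q \<otimes> c [^] (m::nat) \<in> N" for q m
    using that
  proof (induction m arbitrary: q)
    case (Suc m)
    have "q \<otimes> c [^] m \<otimes> c \<in> N" using Suc.prems c by (simp add: m_assoc)
    then have "q \<otimes> c [^] m \<in> N" using inj[of "q \<otimes> c [^] m"] Suc.prems(1) c by simp
    then show ?case using Suc.IH Suc.prems(1) by blast
  qed simp
  define J where "J i = {x \<in> carrier R. \<exists>q \<in> carrier R. x \<ominus> q \<otimes> c [^] i \<in> N}" for i :: nat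
  have J_I: "x \<in> J i" if "x \<in> carrier R" "q \<in> carrier R" "x \<ominus> q \<otimes> c [^] i \<in> N" for x q i
    using that by (auto simp: J_def)
  have J_E: "\<exists>q \<in> carrier R. x \<in> carrier R \<and> x \<ominus> q \<otimes> c [^] i \<in> N" if "x \<in> J i" for x i
    using that by (auto simp: J_def)
  have "left_ideal (J i) R" for i
  proof (rule left_idealI)
    have "\<zero> \<ominus> \<zero> \<otimes> c [^] i \<in> N" using c by (simp add: minus_eq)
    then show "\<zero> \<in> J i" by (rule J_I[rotated 2]) simp_all
    show "J i \<subseteq> carrier R" by (auto simp: J_def)
    fix x y assume "x \<in> J i" "y \<in> J i"
    then obtain p q where pq: "p \<in> carrier R" "q \<in> carrier R" "x \<in> carrier R" "y \<in> carrier R"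
        "x \<ominus> p \<otimes> c [^] i \<in> N" "y \<ominus> q \<otimes> c [^] i \<in> N"
      using J_E by metis
    have "(x \<oplus> y) \<ominus> (p \<oplus> q) \<otimes> c [^] i = (x \<ominus> p \<otimes> c [^] i) \<oplus> (y \<ominus> q \<otimes> c [^] i)"
      using pq(1-4) c by (simp add: minus_eq l_distr minus_add a_ac)
    then show "x \<oplus> y \<in> J i"
      using pq by (intro J_I[of _ "p \<oplus> q"]) auto
  next
    fix x a assume "x \<in> J i" and a: "a \<in> carrier R"
    then obtain p where p: "p \<in> carrier R" "x \<in> carrier R" "x \<ominus> p \<otimes> c [^] i \<in> N"
      using J_E by metis
    have "a \<otimes> x \<ominus> (a \<otimes> p) \<otimes> c [^] i = a \<otimes> (x \<ominus> p \<otimes> c [^] i)"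
      using p(1,2) a c by (simp add: minus_eq r_distr r_minus m_assoc)
    then show "a \<otimes> x \<in> J i"
      using p a N.I_l_closed[OF p(3) a] by (intro J_I[of _ "a \<otimes> p"]) auto
  qed
  moreover have "J (Suc i) \<subseteq> J i" for i
  proof
    fix x assume "x \<in> J (Suc i)"
    then obtain p where p: "p \<in> carrier R" "x \<in> carrier R" "x \<ominus> p \<otimes> c [^] Suc i \<in> N"
      using J_E by metis
    then have "x \<ominus> (p \<otimes> c) \<otimes> c [^] i \<in> N"
      using c by (simp only: nat_pow_Suc2 m_assoc nat_pow_closed)
    then show "x \<in> J i"
      using c p by (intro J_I[of _ "p \<otimes> c"]) auto
  qed
  ultimately obtain m where m: "\<forall>i\<ge>m. J i = J m"
    using descending_chain[of J] by auto
  have "c [^] m \<ominus> \<one> \<otimes> c [^] m \<in> N"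
    using c by (simp add: minus_eq r_neg)
  then have "c [^] m \<in> J m"
    using c by (intro J_I[of _ \<one>]) auto
  moreover have "J (Suc m) = J m"
    by (rule m[rule_format]) simp
  ultimately obtain q where q: "q \<in> carrier R" "c [^] m \<ominus> q \<otimes> c [^] Suc m \<in> N"
    using J_E by metis
  have "(\<one> \<ominus> q \<otimes> c) \<otimes> c [^] m = c [^] m \<ominus> q \<otimes> (c \<otimes> c [^] m)"
    using c q(1) by (simp add: minus_eq l_distr l_minus m_assoc)
  also have "\<dots> \<in> N"
    using q(2) by (simp only: nat_pow_Suc2[OF c])
  finally have "\<one> \<ominus> q \<otimes> c \<in> N"
    using q(1) c inj_pow[of "\<one> \<ominus> q \<otimes> c" m] by simp
  with q(1) show thesis by (rule that)
qed

text \<open>The chain condition gives a left inverse \<open>q\<close>. Then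
  \<open>(c q \<ominus> \<one>) c = 0\<close>, so the same cancellation property shows that
  \<open>q\<close> is also a right inverse.\<close>

lemma (in left_artinian_ring) right_cancellable_Units:
  assumes c: "c \<in> carrier R" and inj: "\<And>q. q \<in> carrier R \<Longrightarrow> q \<otimes> c = \<zero> \<Longrightarrow> q = \<zero>"
  shows "c \<in> Units R"
proof -
  obtain q where q: "q \<in> carrier R" "\<one> \<ominus> q \<otimes> c \<in> {\<zero>}"
    using right_cancellable_left_invertible_mod[OF zeroideal c] inj by blast
  then have qc: "q \<otimes> c = \<one>"
    using c minus_eq_zero_iff[of \<one> "q \<otimes> c"] by simp
  have "(c \<otimes> q \<ominus> \<one>) \<otimes> c = c \<otimes> (q \<otimes> c) \<ominus> c"
    using c q(1) by (simp add: minus_eq l_distr l_minus m_assoc)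
  also have "\<dots> = \<zero>"
    using qc c by (simp add: minus_eq r_neg)
  finally have "c \<otimes> q = \<one>"
    using q(1) c inj[of "c \<otimes> q \<ominus> \<one>"] minus_eq_zero_iff[of "c \<otimes> q" \<one>] by simp
  then show ?thesis
    using c q(1) qc by (auto simp: Units_def)
qed

section \<open>Left localizations\<close>

text \<open>These properties characterize S^{-1}A up to isomorphism, so that rings built
  differently, such as \<open>gr Q\<close> or the left quotient ring of the torsion-free quotient,
  can be recognized as localizations of \<open>gr R\<close>. The Ore and denominator conditions on
  \<open>S\<close> are consequences.\<close>

locale left_localization = ring_hom_ring A B f for A (structure) and B (structure) and f +
  fixes S
  assumes submonoid_S: "submonoid S A"
    and f_Units: "s \<in> S \<Longrightarrow> f s \<in> Units B"
    and fraction_ex: "b \<in> carrier B \<Longrightarrow> \<exists>s \<in> S. \<exists>a \<in> carrier A. f s \<otimes>\<^bsub>B\<^esub> b = f a"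
    and kernel_torsion: "a \<in> carrier A \<Longrightarrow> f a = \<zero>\<^bsub>B\<^esub> \<Longrightarrow> \<exists>s \<in> S. s \<otimes> a = \<zero>"
begin

lemma S_carrier [simp]: "s \<in> S \<Longrightarrow> s \<in> carrier A"
  using submonoid_S by (meson submonoid.mem_carrier)

lemma S_mult [simp]: "s \<in> S \<Longrightarrow> t \<in> S \<Longrightarrow> s \<otimes> t \<in> S"
  using submonoid_S by (simp add: submonoid.m_closed)

lemma S_one [simp]: "\<one> \<in> S"
  using submonoid_S by (simp add: submonoid.one_closed)

lemma f_cancel:
  assumes "s \<in> S" "x \<in> carrier B" "y \<in> carrier B" "f s \<otimes>\<^bsub>B\<^esub> x = f s \<otimes>\<^bsub>B\<^esub> y"
  shows "x = y"
  using assms f_Units S.Units_l_cancel by blast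

lemma f_inv [simp]: "s \<in> S \<Longrightarrow> inv\<^bsub>B\<^esub> f s \<in> carrier B"
  "s \<in> S \<Longrightarrow> f s \<otimes>\<^bsub>B\<^esub> inv\<^bsub>B\<^esub> f s = \<one>\<^bsub>B\<^esub>"
  "s \<in> S \<Longrightarrow> inv\<^bsub>B\<^esub> f s \<otimes>\<^bsub>B\<^esub> f s = \<one>\<^bsub>B\<^esub>"
  using f_Units by auto

lemma eq_imp_torsion:
  assumes "a \<in> carrier A" "b \<in> carrier A" "f a = f b"
  obtains t where "t \<in> S" "t \<otimes> a = t \<otimes> b"
proof -
  have "f (a \<ominus> b) = \<zero>\<^bsub>B\<^esub>"
    using assms by (simp add: R.minus_eq S.r_neg)
  then obtain t where t: "t \<in> S" "t \<otimes> (a \<ominus> b) = \<zero>"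
    using kernel_torsion assms by (meson R.minus_closed)
  then have "t \<otimes> a = t \<otimes> b"
    using assms S_carrier[OF t(1)] R.minus_eq_zero_iff[of "t \<otimes> a" "t \<otimes> b"]
    by (simp add: R.minus_eq R.r_distr R.r_minus)
  with t that show thesis by blast
qed

text \<open>The element \<open>f a (f s)^{-1}\<close> of \<open>B\<close> is a left fraction.
  Clearing its denominators gives the Ore equation in \<open>B\<close>; since the kernel is torsion,
  it holds in \<open>A\<close> after multiplication by some \<open>u \<in> S\<close>.\<close>

lemma ore:
  assumes "a \<in> carrier A" "s \<in> S"
  obtains t b where "t \<in> S" "b \<in> carrier A" "t \<otimes> a = b \<otimes> s"
proof -
  obtain t b where tb: "t \<in> S" "b \<in> carrier A" "f t \<otimes>\<^bsub>B\<^esub> (f a \<otimes>\<^bsub>B\<^esub> inv\<^bsub>B\<^esub> f s) = f b"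
    using fraction_ex[of "f a \<otimes>\<^bsub>B\<^esub> inv\<^bsub>B\<^esub> f s"] assms by auto
  have "f (t \<otimes> a) = f t \<otimes>\<^bsub>B\<^esub> (f a \<otimes>\<^bsub>B\<^esub> inv\<^bsub>B\<^esub> f s) \<otimes>\<^bsub>B\<^esub> f s"
    using assms tb(1,2) by (simp add: S.m_assoc)
  also have "\<dots> = f (b \<otimes> s)"
    using tb assms by simp
  finally obtain u where "u \<in> S" "u \<otimes> (t \<otimes> a) = u \<otimes> (b \<otimes> s)"
    using eq_imp_torsion[of "t \<otimes> a" "b \<otimes> s"] assms tb by auto
  then show thesis
    using that[of "u \<otimes> t" "u \<otimes> b"] assms tb by (simp add: R.m_assoc)
qed

lemma left_denominator_set: "left_denominator_set A S"
  unfolding left_denominator_set_def left_ore_set_def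
proof (intro conjI ballI impI submonoid_S)
  fix a s assume as: "a \<in> carrier A" "s \<in> S"
  show "\<exists>t\<in>S. \<exists>b\<in>carrier A. t \<otimes> a = b \<otimes> s"
    using ore[OF as] by metis
  assume "a \<otimes> s = \<zero>"
  then have "f a \<otimes>\<^bsub>B\<^esub> f s = \<zero>\<^bsub>B\<^esub>"
    using as by (metis S_carrier hom_mult hom_zero)
  then have "f a \<otimes>\<^bsub>B\<^esub> f s \<otimes>\<^bsub>B\<^esub> inv\<^bsub>B\<^esub> f s = \<zero>\<^bsub>B\<^esub>"
    using as by simp
  then have "f a = \<zero>\<^bsub>B\<^esub>"
    using as by (simp add: S.m_assoc)
  then show "\<exists>t\<in>S. t \<otimes> a = \<zero>"
    using kernel_torsion as by blast
qed

text \<open>For a left ideal \<open>I\<close> this is S^{-1}I, the left ideal of \<open>B\<close>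
  generated by the image of \<open>I\<close>.\<close>

definition extension :: "'a set \<Rightarrow> 'c set" where
  "extension I = {q \<in> carrier B. \<exists>s \<in> S. \<exists>x \<in> I. f s \<otimes>\<^bsub>B\<^esub> q = f x}"

definition contraction :: "'c set \<Rightarrow> 'a set" where
  "contraction L = {a \<in> carrier A. f a \<in> L}"

lemma extensionI:
  "q \<in> carrier B \<Longrightarrow> s \<in> S \<Longrightarrow> x \<in> I \<Longrightarrow> f s \<otimes>\<^bsub>B\<^esub> q = f x \<Longrightarrow> q \<in> extension I"
  by (auto simp: extension_def)

lemma extensionE:
  assumes "q \<in> extension I"
  obtains s x where "q \<in> carrier B" "s \<in> S" "x \<in> I" "f s \<otimes>\<^bsub>B\<^esub> q = f x"
  using assms by (auto simp: extension_def)

lemma extension_carrier_subset: "extension I \<subseteq> carrier B"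
  by (auto simp: extension_def)

lemma f_in_extension: "I \<subseteq> carrier A \<Longrightarrow> x \<in> I \<Longrightarrow> f x \<in> extension I"
  by (intro extensionI[of _ \<one> x]) auto

lemma extension_carrier [simp]: "extension (carrier A) = carrier B"
  using fraction_ex by (auto simp: extension_def)

lemma extension_mono: "I \<subseteq> J \<Longrightarrow> extension I \<subseteq> extension J"
  by (auto simp: extension_def)

text \<open>The left ideal may vary with the index because the coefficients of an element of the
  graded ring lie in different powers of the radical. An Ore step reconciles the new denominator
  with the old one, and the numerators stay in \<open>I i\<close> since they are only multiplied
  from the left.\<close>

lemma common_denominator:
  assumes "finite F" "\<And>i. i \<in> F \<Longrightarrow> left_ideal (I i) A" "\<And>i. i \<in> F \<Longrightarrow> q i \<in> extension (I i)"
  shows "\<exists>s \<in> S. \<forall>i \<in> F. \<exists>x \<in> I i. f s \<otimes>\<^bsub>B\<^esub> q i = f x"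
  using assms
proof (induction F)
  case empty
  then show ?case using S_one by blast
next
  case (insert j F)
  then obtain s where s: "s \<in> S" "\<And>i. i \<in> F \<Longrightarrow> \<exists>x \<in> I i. f s \<otimes>\<^bsub>B\<^esub> q i = f x"
    by auto
  obtain t y where t: "t \<in> S" "y \<in> I j" "f t \<otimes>\<^bsub>B\<^esub> q j = f y"
    using insert.prems(2)[of j] by (auto elim: extensionE)
  obtain u v where uv: "u \<in> S" "v \<in> carrier A" "u \<otimes> t = v \<otimes> s"
    using ore[of t s] s t by auto
  have "\<exists>x \<in> I i. f (u \<otimes> t) \<otimes>\<^bsub>B\<^esub> q i = f x" if i: "i \<in> insert j F" for i
  proof -
    interpret I: left_ideal "I i" A using insert.prems i by blast
    have [simp]: "q i \<in> carrier B"
      using insert.prems(2)[of i] i extension_carrier_subset by blast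
    show ?thesis
    proof (cases "i = j")
      case True
      then have "f (u \<otimes> t) \<otimes>\<^bsub>B\<^esub> q i = f (u \<otimes> y)"
        using t uv(1,2) \<open>q i \<in> carrier B\<close> I.a_Hcarr[of y] by (simp add: S.m_assoc)
      then show ?thesis using True t(2) uv(1) I.l_closed[of y u]
        by (intro bexI[of _ "u \<otimes> y"]) simp_all
    next
      case False
      then obtain x where x: "x \<in> I i" "f s \<otimes>\<^bsub>B\<^esub> q i = f x"
        using s i by blast
      then have "f (u \<otimes> t) \<otimes>\<^bsub>B\<^esub> q i = f (v \<otimes> x)"
        unfolding uv(3) using s uv(1,2) \<open>q i \<in> carrier B\<close> I.a_Hcarr[of x]
        by (simp add: S.m_assoc)
      then show ?thesis using x uv I.l_closed[of x v] by blast
    qed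
  qed
  then show ?case using uv t S_mult by blast
qed

lemma common_denominator2:
  assumes "left_ideal I A" "left_ideal J A" "p \<in> extension I" "q \<in> extension J"
  obtains s x y where "s \<in> S" "x \<in> I" "y \<in> J" "f s \<otimes>\<^bsub>B\<^esub> p = f x" "f s \<otimes>\<^bsub>B\<^esub> q = f y"
proof -
  have "\<exists>s \<in> S. \<forall>i \<in> {True, False}. \<exists>x \<in> (if i then I else J).
      f s \<otimes>\<^bsub>B\<^esub> (if i then p else q) = f x"
    by (rule common_denominator) (use assms in auto)
  then show thesis using that by auto
qed

lemma left_ideal_extension:
  assumes "left_ideal I A"
  shows "left_ideal (extension I) B"
proof -
  interpret I: left_ideal I A by fact
  show ?thesis
  proof (rule S.left_idealI)
    show "extension I \<subseteq> carrier B" by (rule extension_carrier_subset)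
    show "\<zero>\<^bsub>B\<^esub> \<in> extension I"
      by (intro extensionI[of _ \<one> \<zero>]) simp_all
    fix p q assume p: "p \<in> extension I" and q: "q \<in> extension I"
    obtain s x y where s: "s \<in> S" "x \<in> I" "y \<in> I" "f s \<otimes>\<^bsub>B\<^esub> p = f x" "f s \<otimes>\<^bsub>B\<^esub> q = f y"
      by (rule common_denominator2[OF assms assms p q])
    moreover have "p \<in> carrier B" "q \<in> carrier B"
      using p q extension_carrier_subset by auto
    ultimately show "p \<oplus>\<^bsub>B\<^esub> q \<in> extension I"
      by (intro extensionI[of _ s "x \<oplus> y"]) (simp_all add: S.r_distr)
  next
    fix q b assume q: "q \<in> extension I" and b: "b \<in> carrier B"
    from q obtain s x where s: "q \<in> carrier B" "s \<in> S" "x \<in> I" "f s \<otimes>\<^bsub>B\<^esub> q = f x"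
      by (rule extensionE)
    obtain t a where t: "t \<in> S" "a \<in> carrier A" "f t \<otimes>\<^bsub>B\<^esub> b = f a"
      using fraction_ex b by blast
    \<comment> \<open>The Ore step moves the denominator \<open>s\<close> of \<open>q\<close> to the
      left of the numerator \<open>a\<close> of \<open>b\<close>.\<close>
    obtain u c where u: "u \<in> S" "c \<in> carrier A" "u \<otimes> a = c \<otimes> s"
      using ore[of a s] s t by auto
    have "f (u \<otimes> t) \<otimes>\<^bsub>B\<^esub> (b \<otimes>\<^bsub>B\<^esub> q) = f u \<otimes>\<^bsub>B\<^esub> (f t \<otimes>\<^bsub>B\<^esub> b) \<otimes>\<^bsub>B\<^esub> q"
      using u(1,2) t(1,2) b s(1,2) by (simp add: S.m_assoc)
    also have "\<dots> = f (u \<otimes> a) \<otimes>\<^bsub>B\<^esub> q"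
      unfolding t(3) using u(1) t(2) by simp
    also have "\<dots> = f c \<otimes>\<^bsub>B\<^esub> (f s \<otimes>\<^bsub>B\<^esub> q)"
      unfolding u(3) using u(1,2) s by (simp add: S.m_assoc)
    also have "\<dots> = f (c \<otimes> x)"
      using s u(1,2) by simp
    finally show "b \<otimes>\<^bsub>B\<^esub> q \<in> extension I"
      using s(1,3) t(1) b u(1,2) I.l_closed[of x c]
      by (intro extensionI[of _ "u \<otimes> t" "c \<otimes> x"]) simp_all
  qed
qed

lemma saturated_contraction:
  assumes "left_ideal L B"
  shows "saturated_left_ideal A S (contraction L)"
proof -
  interpret L: left_ideal L B by fact
  have "left_ideal (contraction L) A"
    by (rule R.left_idealI) (auto simp: contraction_def L.l_closed)
  moreover have "x \<in> contraction L" if "s \<in> S" "x \<in> carrier A" "s \<otimes> x \<in> contraction L" for s x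
  proof -
    have "inv\<^bsub>B\<^esub> f s \<otimes>\<^bsub>B\<^esub> f (s \<otimes> x) \<in> L"
      using that L.l_closed[of "f (s \<otimes> x)" "inv\<^bsub>B\<^esub> f s"] by (simp add: contraction_def)
    then have "f x \<in> L"
      using that by (simp flip: S.m_assoc)
    then show ?thesis using that by (simp add: contraction_def)
  qed
  ultimately show ?thesis by (auto simp: saturated_left_ideal_def)
qed

lemma extension_contraction:
  assumes "left_ideal L B"
  shows "extension (contraction L) = L"
proof -
  interpret L: left_ideal L B by fact
  show ?thesis
  proof (intro equalityI subsetI)
    fix q assume "q \<in> extension (contraction L)"
    then obtain s x where s: "q \<in> carrier B" "s \<in> S" "f x \<in> L" "f s \<otimes>\<^bsub>B\<^esub> q = f x"
      by (auto simp: extension_def contraction_def)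
    then have "inv\<^bsub>B\<^esub> f s \<otimes>\<^bsub>B\<^esub> (f s \<otimes>\<^bsub>B\<^esub> q) \<in> L"
      using L.l_closed[of "f x" "inv\<^bsub>B\<^esub> f s"] by simp
    then show "q \<in> L" using s(1,2) by (simp flip: S.m_assoc)
  next
    fix q assume q: "q \<in> L"
    then have qc: "q \<in> carrier B" by simp
    then obtain s a where s: "s \<in> S" "a \<in> carrier A" "f s \<otimes>\<^bsub>B\<^esub> q = f a"
      using fraction_ex by blast
    then have "a \<in> contraction L"
      using L.l_closed[OF q, of "f s"] by (simp add: contraction_def)
    then show "q \<in> extension (contraction L)"
      using s qc by (intro extensionI[of _ s a])
  qed
qed

lemma contraction_extension:
  assumes "saturated_left_ideal A S I"
  shows "contraction (extension I) = I"
proof -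
  interpret I: left_ideal I A using assms by (simp add: saturated_left_ideal_def)
  have sat: "x \<in> I" if "s \<in> S" "x \<in> carrier A" "s \<otimes> x \<in> I" for s x
    using assms that unfolding saturated_left_ideal_def by blast
  show ?thesis
  proof (intro equalityI subsetI)
    fix a assume "a \<in> contraction (extension I)"
    then obtain s x where s: "a \<in> carrier A" "s \<in> S" "x \<in> I" "f s \<otimes>\<^bsub>B\<^esub> f a = f x"
      by (auto simp: extension_def contraction_def)
    then obtain t where "t \<in> S" "t \<otimes> (s \<otimes> a) = t \<otimes> x"
      using eq_imp_torsion[of "s \<otimes> a" x] by auto
    then have "(t \<otimes> s) \<otimes> a \<in> I"
      using s I.l_closed[of x t] by (simp add: R.m_assoc)
    then show "a \<in> I" using sat[of "t \<otimes> s" a] s \<open>t \<in> S\<close> by simp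
  next
    fix a assume "a \<in> I"
    then show "a \<in> contraction (extension I)"
      using I.a_subset f_in_extension by (auto simp: contraction_def)
  qed
qed

text \<open>Since the right-hand side does not mention \<open>B\<close>, Artinianity passes between
  any two localizations of \<open>A\<close> at \<open>S\<close>.\<close>

theorem left_artinian_iff: "left_artinian_ring B \<longleftrightarrow> saturated_dcc A S"
proof
  assume "left_artinian_ring B"
  then interpret B: left_artinian_ring B .
  show "saturated_dcc A S"
    unfolding saturated_dcc_def
  proof (intro allI impI; elim conjE)
    fix J :: "nat \<Rightarrow> 'a set"
    assume J: "\<forall>i. saturated_left_ideal A S (J i)" "\<forall>i. J (Suc i) \<subseteq> J i"
    then have "\<exists>m. \<forall>i\<ge>m. extension (J i) = extension (J m)"
      by (intro B.descending_chain left_ideal_extension extension_mono)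
        (auto simp: saturated_left_ideal_def)
    then show "\<exists>m. \<forall>i\<ge>m. J i = J m"
      using J(1) contraction_extension by (metis (no_types, lifting))
  qed
next
  assume dcc: "saturated_dcc A S"
  show "left_artinian_ring B"
  proof
    fix J :: "nat \<Rightarrow> 'c set"
    assume J: "\<And>i. left_ideal (J i) B" "\<And>i. J (Suc i) \<subseteq> J i"
    have "contraction (J (Suc i)) \<subseteq> contraction (J i)" for i
      using J(2)[of i] by (auto simp: contraction_def)
    then obtain m where "\<And>i. i \<ge> m \<Longrightarrow> contraction (J i) = contraction (J m)"
      using saturated_dccD[where J = "\<lambda>i. contraction (J i)", OF dcc saturated_contraction[OF J(1)]]
      by auto
    then show "\<exists>m. \<forall>i\<ge>m. J i = J m"
      using J(1) extension_contraction by metis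
  qed
qed

end

theorem (in left_denominator) left_localization_left_fractions:
  "left_localization A (left_fractions A S) (frac \<one>) S"
proof -
  interpret loc: ring loc by (rule left_fractions_ring)
  have mult: "frac \<one> a \<otimes>\<^bsub>loc\<^esub> frac \<one> b = frac \<one> (a \<otimes> b)"
    if "a \<in> carrier A" "b \<in> carrier A" for a b
    using frac_mult_cancel[of \<one> a \<one> b] that by simp
  show ?thesis
  proof (intro left_localization.intro ring_hom_ringI left_localization_axioms.intro
      ring_axioms loc.ring_axioms submonoid_S)
    fix s assume s: "s \<in> S"
    have "frac \<one> s \<otimes>\<^bsub>loc\<^esub> frac s \<one> = \<one>\<^bsub>loc\<^esub>"
      using frac_mult_cancel[of \<one> \<one> s \<one>] s by (simp add: loc_one)
    moreover have "frac s \<one> \<otimes>\<^bsub>loc\<^esub> frac \<one> s = \<one>\<^bsub>loc\<^esub>"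
      using frac_mult_cancel[of s \<one> \<one> s] s by (simp add: loc_one frac_self[OF s])
    ultimately show "frac \<one> s \<in> Units loc"
      using s by (auto simp: Units_def intro!: bexI[of _ "frac s \<one>"])
  next
    fix b assume b: "b \<in> carrier loc"
    obtain s a where s: "s \<in> S" "a \<in> carrier A" "b = frac s a"
      by (rule carrier_fracE[OF b])
    have "frac \<one> s \<otimes>\<^bsub>loc\<^esub> b = frac \<one> a"
      using frac_mult_cancel[of \<one> \<one> s a] s by simp
    then show "\<exists>s\<in>S. \<exists>a\<in>carrier A. frac \<one> s \<otimes>\<^bsub>loc\<^esub> b = frac \<one> a"
      using s by blast
  next
    fix a assume a: "a \<in> carrier A" "frac \<one> a = \<zero>\<^bsub>loc\<^esub>"
    then obtain c d where "c \<in> carrier A" "d \<in> carrier A" "c \<otimes> \<one> = d \<otimes> \<one>" "c \<otimes> \<one> \<in> S"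
        "c \<otimes> a = d \<otimes> \<zero>"
      using frac_eq_iff[of \<one> a \<one> \<zero>] by (auto simp: loc_zero)
    then show "\<exists>s\<in>S. s \<otimes> a = \<zero>" by auto
  qed (simp_all add: mult frac_add_same loc_one)
qed

section \<open>Uniqueness of localizations\<close>

text \<open>This is the graph of the isomorphism: \<open>b\<close> and \<open>b'\<close> are related
  if both are the fraction s^{-1}a for one pair \<open>s\<close>, \<open>a\<close>. The relation is
  symmetric in the two localizations, so a property proved in one direction is available in the
  other.\<close>

definition fraction_rel where
  "fraction_rel A S B f B' g b b' \<longleftrightarrow> b \<in> carrier B \<and> b' \<in> carrier B' \<and>
     (\<exists>s \<in> S. \<exists>a \<in> carrier A. f s \<otimes>\<^bsub>B\<^esub> b = f a \<and> g s \<otimes>\<^bsub>B'\<^esub> b' = g a)"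

lemma fraction_rel_sym: "fraction_rel A S B f B' g b b' \<longleftrightarrow> fraction_rel A S B' g B f b' b"
  by (auto simp: fraction_rel_def)

locale two_localizations =
  B1: left_localization A B f S + B2: left_localization A B' g S
  for A (structure) and B (structure) and f and S and B' (structure) and g
begin

abbreviation rel where "rel \<equiv> fraction_rel A S B f B' g"

lemma relI:
  "b \<in> carrier B \<Longrightarrow> b' \<in> carrier B' \<Longrightarrow> s \<in> S \<Longrightarrow> a \<in> carrier A \<Longrightarrow>
    f s \<otimes>\<^bsub>B\<^esub> b = f a \<Longrightarrow> g s \<otimes>\<^bsub>B'\<^esub> b' = g a \<Longrightarrow> rel b b'"
  by (auto simp: fraction_rel_def)

lemma relE:
  assumes "rel b b'"
  obtains s a where "b \<in> carrier B" "b' \<in> carrier B'" "s \<in> S" "a \<in> carrier A"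
    "f s \<otimes>\<^bsub>B\<^esub> b = f a" "g s \<otimes>\<^bsub>B'\<^esub> b' = g a"
  using assms by (auto simp: fraction_rel_def)

lemma rel_total:
  assumes "b \<in> carrier B"
  obtains b' where "rel b b'"
proof -
  obtain s a where s: "s \<in> S" "a \<in> carrier A" "f s \<otimes>\<^bsub>B\<^esub> b = f a"
    using B1.fraction_ex assms by blast
  have "g s \<otimes>\<^bsub>B'\<^esub> (inv\<^bsub>B'\<^esub> g s \<otimes>\<^bsub>B'\<^esub> g a) = g a"
    using s by (simp flip: B2.S.m_assoc)
  then show thesis
    using s assms by (intro that[of "inv\<^bsub>B'\<^esub> g s \<otimes>\<^bsub>B'\<^esub> g a"] relI[of _ _ s a]) simp_all
qed

lemma rel_common:
  assumes "rel b b'" "rel c c'"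
  obtains s x y where "s \<in> S" "x \<in> carrier A" "y \<in> carrier A"
    "f s \<otimes>\<^bsub>B\<^esub> b = f x" "g s \<otimes>\<^bsub>B'\<^esub> b' = g x" "f s \<otimes>\<^bsub>B\<^esub> c = f y" "g s \<otimes>\<^bsub>B'\<^esub> c' = g y"
proof -
  obtain s a where s: "b \<in> carrier B" "b' \<in> carrier B'" "s \<in> S" "a \<in> carrier A"
      "f s \<otimes>\<^bsub>B\<^esub> b = f a" "g s \<otimes>\<^bsub>B'\<^esub> b' = g a"
    using assms(1) by (rule relE)
  obtain t e where t: "c \<in> carrier B" "c' \<in> carrier B'" "t \<in> S" "e \<in> carrier A"
      "f t \<otimes>\<^bsub>B\<^esub> c = f e" "g t \<otimes>\<^bsub>B'\<^esub> c' = g e"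
    using assms(2) by (rule relE)
  obtain u v where uv: "u \<in> S" "v \<in> carrier A" "u \<otimes> s = v \<otimes> t"
    using B1.ore[of s t] s t by auto
  have 1: "f (u \<otimes> s) \<otimes>\<^bsub>B\<^esub> b = f (u \<otimes> a)" "g (u \<otimes> s) \<otimes>\<^bsub>B'\<^esub> b' = g (u \<otimes> a)"
    using s uv(1,2) by (simp_all add: B1.S.m_assoc B2.S.m_assoc)
  have 2: "f (u \<otimes> s) \<otimes>\<^bsub>B\<^esub> c = f (v \<otimes> e)" "g (u \<otimes> s) \<otimes>\<^bsub>B'\<^esub> c' = g (v \<otimes> e)"
    unfolding uv(3) using t uv(1,2) by (simp_all add: B1.S.m_assoc B2.S.m_assoc)
  show thesis
    by (rule that[OF _ _ _ 1 2]) (use s t uv(1,2) in simp_all)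
qed

lemma rel_functional:
  assumes "rel b b'" "rel b c'"
  shows "b' = c'"
proof -
  have mem: "b' \<in> carrier B'" "c' \<in> carrier B'"
    using assms by (auto simp: fraction_rel_def)
  obtain s x y where s: "s \<in> S" "x \<in> carrier A" "y \<in> carrier A"
    "f s \<otimes>\<^bsub>B\<^esub> b = f x" "g s \<otimes>\<^bsub>B'\<^esub> b' = g x" "f s \<otimes>\<^bsub>B\<^esub> b = f y" "g s \<otimes>\<^bsub>B'\<^esub> c' = g y"
    using assms by (rule rel_common)
  then obtain t where t: "t \<in> S" "t \<otimes> x = t \<otimes> y"
    using B1.eq_imp_torsion[of x y] by auto
  then have "g t \<otimes>\<^bsub>B'\<^esub> g x = g t \<otimes>\<^bsub>B'\<^esub> g y"
    using s(2,3) by (metis B1.S_carrier B2.hom_mult)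
  then have "g x = g y"
    using t s(2,3) B2.f_cancel[of t "g x" "g y"] by simp
  then show ?thesis
    using s mem B2.f_cancel[of s b' c'] by simp
qed

lemma rel_add:
  assumes "rel b b'" "rel c c'"
  shows "rel (b \<oplus>\<^bsub>B\<^esub> c) (b' \<oplus>\<^bsub>B'\<^esub> c')"
proof -
  have mem: "b \<in> carrier B" "c \<in> carrier B" "b' \<in> carrier B'" "c' \<in> carrier B'"
    using assms by (auto simp: fraction_rel_def)
  obtain s x y where "s \<in> S" "x \<in> carrier A" "y \<in> carrier A"
    "f s \<otimes>\<^bsub>B\<^esub> b = f x" "g s \<otimes>\<^bsub>B'\<^esub> b' = g x" "f s \<otimes>\<^bsub>B\<^esub> c = f y" "g s \<otimes>\<^bsub>B'\<^esub> c' = g y"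
    using assms by (rule rel_common)
  then show ?thesis
    using mem by (intro relI[of _ _ s "x \<oplus> y"]) (simp_all add: B1.S.r_distr B2.S.r_distr)
qed

lemma rel_mult:
  assumes "rel b b'" "rel c c'"
  shows "rel (b \<otimes>\<^bsub>B\<^esub> c) (b' \<otimes>\<^bsub>B'\<^esub> c')"
proof -
  obtain s a where s: "b \<in> carrier B" "b' \<in> carrier B'" "s \<in> S" "a \<in> carrier A"
      "f s \<otimes>\<^bsub>B\<^esub> b = f a" "g s \<otimes>\<^bsub>B'\<^esub> b' = g a"
    using assms(1) by (rule relE)
  obtain t e where t: "c \<in> carrier B" "c' \<in> carrier B'" "t \<in> S" "e \<in> carrier A"
      "f t \<otimes>\<^bsub>B\<^esub> c = f e" "g t \<otimes>\<^bsub>B'\<^esub> c' = g e"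
    using assms(2) by (rule relE)
  obtain u v where uv: "u \<in> S" "v \<in> carrier A" "u \<otimes> a = v \<otimes> t"
    using B1.ore[of a t] s t by auto
  have "f (u \<otimes> s) \<otimes>\<^bsub>B\<^esub> (b \<otimes>\<^bsub>B\<^esub> c) = f u \<otimes>\<^bsub>B\<^esub> (f s \<otimes>\<^bsub>B\<^esub> b) \<otimes>\<^bsub>B\<^esub> c"
    using s(1-4) t(1-4) uv(1,2) by (simp add: B1.S.m_assoc)
  also have "\<dots> = f (u \<otimes> a) \<otimes>\<^bsub>B\<^esub> c"
    using s(4) uv(1) by (simp add: s(5))
  also have "\<dots> = f v \<otimes>\<^bsub>B\<^esub> (f t \<otimes>\<^bsub>B\<^esub> c)"
    unfolding uv(3) using t(1-4) uv(1,2) by (simp add: B1.S.m_assoc)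
  also have "\<dots> = f (v \<otimes> e)"
    using t(4) uv(2) by (simp add: t(5))
  finally have 1: "f (u \<otimes> s) \<otimes>\<^bsub>B\<^esub> (b \<otimes>\<^bsub>B\<^esub> c) = f (v \<otimes> e)" .
  have "g (u \<otimes> s) \<otimes>\<^bsub>B'\<^esub> (b' \<otimes>\<^bsub>B'\<^esub> c') = g u \<otimes>\<^bsub>B'\<^esub> (g s \<otimes>\<^bsub>B'\<^esub> b') \<otimes>\<^bsub>B'\<^esub> c'"
    using s(1-4) t(1-4) uv(1,2) by (simp add: B2.S.m_assoc)
  also have "\<dots> = g (u \<otimes> a) \<otimes>\<^bsub>B'\<^esub> c'"
    using s(4) uv(1) by (simp add: s(6))
  also have "\<dots> = g v \<otimes>\<^bsub>B'\<^esub> (g t \<otimes>\<^bsub>B'\<^esub> c')"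
    unfolding uv(3) using t(1-4) uv(1,2) by (simp add: B2.S.m_assoc)
  also have "\<dots> = g (v \<otimes> e)"
    using t(4) uv(2) by (simp add: t(6))
  finally have 2: "g (u \<otimes> s) \<otimes>\<^bsub>B'\<^esub> (b' \<otimes>\<^bsub>B'\<^esub> c') = g (v \<otimes> e)" .
  show ?thesis
    by (rule relI[OF _ _ _ _ 1 2]) (use s t uv(1,2) in simp_all)
qed

lemma rel_one: "rel \<one>\<^bsub>B\<^esub> \<one>\<^bsub>B'\<^esub>"
  by (rule relI[of _ _ \<one> \<one>]) simp_all

end

theorem left_localization_unique:
  assumes "left_localization A B f S" "left_localization A B' g S"
  shows "B \<simeq> B'"
proof -
  interpret X: two_localizations A B f S B' g
    using assms by (simp add: two_localizations_def)
  \<comment> \<open>With the roles of \<open>B\<close> and \<open>B'\<close> exchanged,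
    functionality and totality of the relation become injectivity and surjectivity of
    \<open>h\<close>.\<close>
  interpret Y: two_localizations A B' g S B f
    using assms by (simp add: two_localizations_def)
  define h where "h b = (THE b'. X.rel b b')" for b
  have h_eq: "h b = b'" if "X.rel b b'" for b b'
    unfolding h_def using that X.rel_functional by (intro the_equality) auto
  have h: "X.rel b (h b)" if b: "b \<in> carrier B" for b
  proof -
    obtain b' where "X.rel b b'" using b by (rule X.rel_total)
    then show ?thesis using h_eq by metis
  qed
  have closed: "b \<in> carrier B" "b' \<in> carrier B'" if "X.rel b b'" for b b'
    using that by (auto simp: fraction_rel_def)
  have inj: "b = c" if "X.rel b d" "X.rel c d" for b c d
    using Y.rel_functional[of d b c] that by (simp add: fraction_rel_sym[of A S B' g B f])
  have "h \<in> ring_hom B B'"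
  proof (rule ring_hom_memI)
    fix b assume "b \<in> carrier B"
    then show "h b \<in> carrier B'" using h closed by blast
  next
    fix b c assume "b \<in> carrier B" "c \<in> carrier B"
    then show "h (b \<otimes>\<^bsub>B\<^esub> c) = h b \<otimes>\<^bsub>B'\<^esub> h c" "h (b \<oplus>\<^bsub>B\<^esub> c) = h b \<oplus>\<^bsub>B'\<^esub> h c"
      using h X.rel_mult X.rel_add by (auto intro!: h_eq)
  qed (intro h_eq X.rel_one)
  moreover have "inj_on h (carrier B)"
    using h inj by (intro inj_onI) metis
  moreover have "carrier B' \<subseteq> h ` carrier B"
  proof
    fix d assume "d \<in> carrier B'"
    then obtain b where "Y.rel d b" by (rule Y.rel_total)
    then have "X.rel b d" by (simp add: fraction_rel_sym[of A S B' g B f])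
    then show "d \<in> h ` carrier B" using h_eq closed by blast
  qed
  ultimately have "h \<in> ring_iso B B'"
    by (auto simp: ring_iso_def bij_betw_def dest: ring_hom_memE(1))
  then show ?thesis by (auto simp: is_ring_iso_def)
qed

section \<open>Regular elements\<close>

context ring
begin

lemma regular_elements_iff:
  "c \<in> regular_elements R \<longleftrightarrow> c \<in> carrier R \<and>
    (\<forall>a \<in> carrier R. (c \<otimes> a = \<zero> \<longrightarrow> a = \<zero>) \<and> (a \<otimes> c = \<zero> \<longrightarrow> a = \<zero>))"
  by (simp add: regular_elements_def)

lemma regular_elementsI:
  assumes "c \<in> carrier R" "\<And>a. a \<in> carrier R \<Longrightarrow> c \<otimes> a = \<zero> \<Longrightarrow> a = \<zero>"
    "\<And>a. a \<in> carrier R \<Longrightarrow> a \<otimes> c = \<zero> \<Longrightarrow> a = \<zero>"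
  shows "c \<in> regular_elements R"
  using assms(1) by (simp add: regular_elements_iff) (metis assms(2,3))

lemma regular_elementsD:
  assumes "c \<in> regular_elements R"
  shows "c \<in> carrier R" "a \<in> carrier R \<Longrightarrow> c \<otimes> a = \<zero> \<Longrightarrow> a = \<zero>"
    "a \<in> carrier R \<Longrightarrow> a \<otimes> c = \<zero> \<Longrightarrow> a = \<zero>"
  using assms unfolding regular_elements_iff by blast+

lemma submonoid_regular_elements: "submonoid (regular_elements R) R"
proof
  show "regular_elements R \<subseteq> carrier R" by (auto simp: regular_elements_def)
  show "\<one> \<in> regular_elements R" by (rule regular_elementsI) simp_all
  fix c d assume c: "c \<in> regular_elements R" and d: "d \<in> regular_elements R"
  note [simp] = regular_elementsD(1)[OF c] regular_elementsD(1)[OF d]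
  show "c \<otimes> d \<in> regular_elements R"
  proof (rule regular_elementsI)
    show "a = \<zero>" if "a \<in> carrier R" "(c \<otimes> d) \<otimes> a = \<zero>" for a
      using regular_elementsD(2)[OF c, of "d \<otimes> a"] regular_elementsD(2)[OF d, of a] that
      by (simp add: m_assoc)
    show "a = \<zero>" if "a \<in> carrier R" "a \<otimes> (c \<otimes> d) = \<zero>" for a
      using regular_elementsD(3)[OF d, of "a \<otimes> c"] regular_elementsD(3)[OF c, of a] that
      by (simp add: m_assoc)
  qed simp
qed

lemma left_denominator_set_regular:
  assumes "left_ore_set R S" "S \<subseteq> regular_elements R"
  shows "left_denominator_set R S"
  unfolding left_denominator_set_def
proof (intro conjI ballI impI assms(1))
  fix a s assume a: "a \<in> carrier R" "s \<in> S" "a \<otimes> s = \<zero>"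
  then have "a = \<zero>" using assms(2) regular_elementsD(3) by blast
  moreover have "\<one> \<in> S"
    using assms(1) by (simp add: left_ore_set_def submonoid.one_closed)
  ultimately show "\<exists>t\<in>S. t \<otimes> a = \<zero>" by (intro bexI[of _ \<one>]) simp_all
qed

lemma regular_cancel:
  assumes "c \<in> regular_elements R" "a \<in> carrier R" "b \<in> carrier R" "a \<otimes> c = b \<otimes> c"
  shows "a = b"
proof -
  have c: "c \<in> carrier R" using assms(1) by (rule regular_elementsD(1))
  have "(a \<ominus> b) \<otimes> c = \<zero>"
    using assms(2-4) c by (simp add: minus_eq l_distr l_minus r_neg)
  then have "a \<ominus> b = \<zero>"
    by (rule regular_elementsD(3)[OF assms(1), rotated]) (use assms(2,3) in simp)
  then show ?thesis using assms(2,3) minus_eq_zero_iff by blast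
qed

text \<open>For a regular \<open>c\<close> the saturations of \<open>R, Rc, Rc\<^sup>2, \<dots>\<close> form a descending chain of
  saturated left ideals; where it stops, some \<open>s \<in> S\<close> is a left multiple of \<open>c\<close>.\<close>

lemma saturated_dcc_regular_left_multiple:
  assumes ore: "left_ore_set R S" and reg: "S \<subseteq> regular_elements R"
    and dcc: "saturated_dcc R S" and c: "c \<in> regular_elements R"
  obtains s b where "s \<in> S" "b \<in> carrier R" "s = b \<otimes> c"
proof -
  interpret left_denominator R S
    by (intro left_denominator.intro left_denominator_axioms.intro ring_axioms
        left_denominator_set_regular ore reg)
  have cc [simp]: "c \<in> carrier R" using c by (rule regular_elementsD(1))
  define J where "J i = {x \<in> carrier R. \<exists>s \<in> S. \<exists>b \<in> carrier R. s \<otimes> x = b \<otimes> c [^] i}" for i :: nat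
  have J_I: "x \<in> J i" if "x \<in> carrier R" "s \<in> S" "b \<in> carrier R" "s \<otimes> x = b \<otimes> c [^] i" for x s b i
    using that by (auto simp: J_def)
  have J_E: "\<exists>s \<in> S. \<exists>b \<in> carrier R. x \<in> carrier R \<and> s \<otimes> x = b \<otimes> c [^] i" if "x \<in> J i" for x i
    using that by (auto simp: J_def)
  have "saturated_left_ideal R S (J i)" for i
    unfolding saturated_left_ideal_def
  proof (intro conjI ballI impI left_idealI)
    show "J i \<subseteq> carrier R" by (auto simp: J_def)
    show "\<zero> \<in> J i" by (rule J_I[of _ \<one> \<zero>]) simp_all
  next
    fix x y assume "x \<in> J i" "y \<in> J i"
    then obtain s b t d where s: "s \<in> S" "b \<in> carrier R" "x \<in> carrier R" "s \<otimes> x = b \<otimes> c [^] i"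
      and t: "t \<in> S" "d \<in> carrier R" "y \<in> carrier R" "t \<otimes> y = d \<otimes> c [^] i"
      using J_E by metis
    obtain u v where u: "u \<in> S" "v \<in> carrier R" "u \<otimes> s = v \<otimes> t"
      using local.ore[of s t] s t by auto
    have "(u \<otimes> s) \<otimes> x = (u \<otimes> b) \<otimes> c [^] i"
      using s u(1,2) by (simp add: m_assoc)
    moreover have "(u \<otimes> s) \<otimes> y = (v \<otimes> d) \<otimes> c [^] i"
      unfolding u(3) using t u(1,2) by (simp add: m_assoc)
    ultimately have "(u \<otimes> s) \<otimes> (x \<oplus> y) = (u \<otimes> b \<oplus> v \<otimes> d) \<otimes> c [^] i"
      using s(1-3) t(1-3) u(1,2) by (simp add: r_distr l_distr)
    then show "x \<oplus> y \<in> J i"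
      by (rule J_I[rotated 3]) (use s(1-3) t(1-3) u(1,2) in auto)
  next
    fix x a assume "x \<in> J i" and a: "a \<in> carrier R"
    then obtain s b where s: "s \<in> S" "b \<in> carrier R" "x \<in> carrier R" "s \<otimes> x = b \<otimes> c [^] i"
      using J_E by metis
    obtain u v where u: "u \<in> S" "v \<in> carrier R" "u \<otimes> a = v \<otimes> s"
      using local.ore[of a s] s a by auto
    have "u \<otimes> (a \<otimes> x) = (u \<otimes> a) \<otimes> x"
      using u(1) a s(3) by (simp add: m_assoc)
    also have "\<dots> = (v \<otimes> b) \<otimes> c [^] i"
      unfolding u(3) using u(1,2) a s by (simp add: m_assoc)
    finally show "a \<otimes> x \<in> J i"
      by (rule J_I[rotated 3]) (use s(1-3) a u(1,2) in auto)
  next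
    fix s x assume sx: "s \<in> S" "x \<in> carrier R" "s \<otimes> x \<in> J i"
    then obtain t b where t: "t \<in> S" "b \<in> carrier R" "t \<otimes> (s \<otimes> x) = b \<otimes> c [^] i"
      using J_E by metis
    then have "(t \<otimes> s) \<otimes> x = b \<otimes> c [^] i"
      using sx by (simp add: m_assoc)
    then show "x \<in> J i"
      by (rule J_I[rotated 3]) (use sx t in auto)
  qed
  moreover have "J (Suc i) \<subseteq> J i" for i
  proof
    fix x assume "x \<in> J (Suc i)"
    then obtain s b where s: "s \<in> S" "b \<in> carrier R" "x \<in> carrier R" "s \<otimes> x = b \<otimes> c [^] Suc i"
      using J_E by metis
    then have "s \<otimes> x = (b \<otimes> c) \<otimes> c [^] i"
      by (simp only: nat_pow_Suc2 m_assoc nat_pow_closed cc)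
    then show "x \<in> J i"
      by (rule J_I[rotated 3]) (use s in auto)
  qed
  ultimately obtain m where m: "\<And>i. i \<ge> m \<Longrightarrow> J i = J m"
    using saturated_dccD[OF dcc, of J] by blast
  have "c [^] m \<in> J m"
    by (rule J_I[of _ \<one> \<one>]) simp_all
  then have "c [^] m \<in> J (Suc m)"
    using m[of "Suc m"] by simp
  then obtain s b where s: "s \<in> S" "b \<in> carrier R" "s \<otimes> c [^] m = b \<otimes> c [^] Suc m"
    using J_E by metis
  \<comment> \<open>Powers of \<open>c\<close> are regular, so \<open>c^m\<close> cancels on the
    right in \<open>s c^m = (b c) c^m\<close>.\<close>
  have reg_pow: "c [^] k \<in> regular_elements R" for k :: nat
    by (induction k) (simp_all add: c submonoid.one_closed[OF submonoid_regular_elements]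
        submonoid.m_closed[OF submonoid_regular_elements])
  have "s \<otimes> c [^] m = (b \<otimes> c) \<otimes> c [^] m"
    using s by (simp only: nat_pow_Suc2 m_assoc nat_pow_closed cc)
  then have "s = b \<otimes> c"
    by (rule regular_cancel[OF reg_pow, rotated 2]) (use s(1,2) in auto)
  then show thesis using that s by blast
qed

text \<open>A regular \<open>c\<close> has a left multiple \<open>s = b c\<close> in
  \<open>S\<close>, and the Ore equation \<open>t a = d s\<close> for \<open>s\<close> reads
  \<open>t a = (d b) c\<close>. So a sufficiently rich Ore set of regular elements forces the Ore
  condition for all of them.\<close>

lemma left_ore_set_regular_elements:
  assumes ore: "left_ore_set R S" and reg: "S \<subseteq> regular_elements R"
    and dcc: "saturated_dcc R S"
  shows "left_ore_set R (regular_elements R)"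
  unfolding left_ore_set_def
proof (intro conjI ballI submonoid_regular_elements)
  fix a c assume a: "a \<in> carrier R" and c: "c \<in> regular_elements R"
  obtain s b where s: "s \<in> S" "b \<in> carrier R" "s = b \<otimes> c"
    by (rule saturated_dcc_regular_left_multiple[OF assms c])
  obtain t d where t: "t \<in> S" "d \<in> carrier R" "t \<otimes> a = d \<otimes> s"
    using ore a s(1) unfolding left_ore_set_def by blast
  have "t \<otimes> a = (d \<otimes> b) \<otimes> c"
    using t s regular_elementsD(1)[OF c] regular_elementsD(1)[of t] reg by (simp add: m_assoc)
  then show "\<exists>t\<in>regular_elements R. \<exists>b\<in>carrier R. t \<otimes> a = b \<otimes> c"
    using t(1,2) s(2) reg by (intro bexI[of _ t] bexI[of _ "d \<otimes> b"]) auto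
qed

lemma left_localization_left_quotient_ring:
  assumes "has_left_quotient_ring R"
  shows "left_localization R (left_quotient_ring R)
    (left_frac R (regular_elements R) \<one>) (regular_elements R)"
proof -
  interpret left_denominator R "regular_elements R"
    using assms by (intro left_denominator.intro left_denominator_axioms.intro ring_axioms
        left_denominator_set_regular) (auto simp: has_left_quotient_ring_def)
  show ?thesis
    unfolding left_quotient_ring_def by (rule left_localization_left_fractions)
qed

end

section \<open>Powers of ideals and the prime radical\<close>

context ring
begin

lemma ideal_pow_ideal:
  assumes "ideal I R"
  shows "ideal (ideal_pow R I n) R"
  by (induction n) (simp_all add: oneideal ideal_prod_is_ideal assms)

lemma ideal_pow_subset_carrier:
  assumes "ideal I R"
  shows "ideal_pow R I n \<subseteq> carrier R"
  using ideal.Icarr[OF ideal_pow_ideal[OF assms]] by blast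

lemma ideal_prod_subsetI:
  assumes "ideal K R" "\<And>i j. i \<in> I \<Longrightarrow> j \<in> J \<Longrightarrow> i \<otimes> j \<in> K"
  shows "I \<cdot> J \<subseteq> K"
proof
  fix x assume "x \<in> I \<cdot> J"
  then show "x \<in> K"
    by (induction rule: ideal_prod.induct)
      (use assms additive_subgroup.a_closed[OF ideal.axioms(1)[OF assms(1)]] in blast)+
qed

lemma ideal_prod_mono: "I \<subseteq> I' \<Longrightarrow> J \<subseteq> J' \<Longrightarrow> I \<cdot> J \<subseteq> I' \<cdot> J'"
proof
  fix x assume *: "I \<subseteq> I'" "J \<subseteq> J'" and "x \<in> I \<cdot> J"
  from this(3) show "x \<in> I' \<cdot> J'"
    by (induction rule: ideal_prod.induct) (use * in \<open>auto intro: ideal_prod.intros\<close>)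
qed

lemma ideal_pow_Suc_subset:
  assumes "ideal I R"
  shows "ideal_pow R I (Suc n) \<subseteq> ideal_pow R I n"
  using ideal_prod_inter[OF ideal_pow_ideal[OF assms, of n] assms] by auto

lemma ideal_pow_antimono:
  assumes "ideal I R" "m \<le> n"
  shows "ideal_pow R I n \<subseteq> ideal_pow R I m"
  using antimono_chain[of "ideal_pow R I", OF ideal_pow_Suc_subset[OF assms(1)] assms(2)] .

text \<open>Powers grow by a factor on the right, so the induction on \<open>j\<close> moves one
  factor at a time: \<open>x (a b) = (x a) b\<close> with \<open>x a\<close> in the power of
  exponent \<open>i + j\<close>.\<close>

lemma ideal_pow_mult:
  assumes "ideal I R" "x \<in> ideal_pow R I i" "y \<in> ideal_pow R I j"
  shows "x \<otimes> y \<in> ideal_pow R I (i + j)"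
  using assms(2,3)
proof (induction j arbitrary: x y)
  case 0
  then show ?case
    using ideal.I_r_closed[OF ideal_pow_ideal[OF assms(1)], of x i y] by simp
next
  case (Suc j)
  interpret K: ideal "ideal_pow R I (i + Suc j)" R
    by (rule ideal_pow_ideal[OF assms(1)])
  have x: "x \<in> carrier R"
    using Suc.prems(1) ideal_pow_subset_carrier[OF assms(1)] by blast
  from Suc.prems(2) have "y \<in> ideal_pow R I j \<cdot> I" by simp
  \<comment> \<open>Membership in the carrier is carried along because distributivity in the case of
    a sum depends on it.\<close>
  then have "y \<in> carrier R \<and> x \<otimes> y \<in> ideal_pow R I (i + Suc j)"
  proof (induction rule: ideal_prod.induct)
    case (prod a b)
    then have "a \<in> carrier R" "b \<in> carrier R"
      using ideal_pow_subset_carrier[OF assms(1)] ideal.Icarr[OF assms(1)] by blast+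
    moreover have "(x \<otimes> a) \<otimes> b \<in> ideal_pow R I (i + j) \<cdot> I"
      using Suc.IH[OF Suc.prems(1) prod(1)] prod(2) by (rule ideal_prod.prod)
    ultimately show ?case using x by (simp add: m_assoc)
  next
    case (sum a b)
    then show ?case using x K.a_closed by (simp add: r_distr)
  qed
  then show ?case ..
qed

lemma ideal_pow_one:
  assumes "ideal I R"
  shows "ideal_pow R I (Suc 0) = I"
proof
  show "ideal_pow R I (Suc 0) \<subseteq> I"
    using ideal_prod_inter[OF oneideal assms] by auto
  show "I \<subseteq> ideal_pow R I (Suc 0)"
  proof
    fix x assume x: "x \<in> I"
    then have "\<one> \<otimes> x \<in> carrier R \<cdot> I" by (intro ideal_prod.prod) auto
    then show "x \<in> ideal_pow R I (Suc 0)" using x ideal.Icarr[OF assms] by simp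
  qed
qed

lemma nc_prime_ideal_pow:
  assumes "nc_prime_ideal P R" "ideal I R" "ideal_pow R I k \<subseteq> P"
  shows "I \<subseteq> P"
  using assms(3)
proof (induction k)
  case 0
  then show ?case
    using ideal.Icarr[OF assms(2)] by auto
next
  case (Suc k)
  have "ideal_pow R I k \<cdot> I \<subseteq> P"
    using Suc.prems by simp
  then have "ideal_pow R I k \<subseteq> P \<or> I \<subseteq> P"
    by (rule nc_prime_ideal.prime[OF assms(1) ideal_pow_ideal[OF assms(2)] assms(2)])
  then show ?case using Suc.IH by blast
qed

lemma prime_radical_ideal: "ideal (prime_radical R) R"
proof -
  \<comment> \<open>Inserting \<open>carrier R\<close> covers a ring without prime ideals, where the
    intersection of the empty family would be the whole type.\<close>
  have "prime_radical R = \<Inter> (insert (carrier R) {P. nc_prime_ideal P R})"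
    by (auto simp: prime_radical_def)
  moreover have "ideal (\<Inter> (insert (carrier R) {P. nc_prime_ideal P R})) R"
    by (rule i_Intersect) (auto simp: oneideal nc_prime_ideal_def)
  ultimately show ?thesis by simp
qed

lemma prime_radical_subset: "nc_prime_ideal P R \<Longrightarrow> prime_radical R \<subseteq> P"
  by (auto simp: prime_radical_def)

text \<open>Semiprimeness of the prime radical: an ideal with a power inside it lies in every
  prime.\<close>

lemma ideal_pow_subset_prime_radical:
  assumes "ideal I R" "ideal_pow R I k \<subseteq> prime_radical R"
  shows "I \<subseteq> prime_radical R"
proof -
  have "I \<subseteq> P" if "nc_prime_ideal P R" for P
    using nc_prime_ideal_pow[OF that assms(1)] assms(2) prime_radical_subset[OF that] by blast
  then show ?thesis
    using ideal.Icarr[OF assms(1)] by (auto simp: prime_radical_def)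
qed

lemma C_prime_iff:
  "c \<in> C_prime R \<longleftrightarrow> c \<in> carrier R \<and> (\<forall>a \<in> carrier R.
     (c \<otimes> a \<in> prime_radical R \<longrightarrow> a \<in> prime_radical R) \<and>
     (a \<otimes> c \<in> prime_radical R \<longrightarrow> a \<in> prime_radical R))"
proof -
  interpret N: ideal "prime_radical R" R by (rule prime_radical_ideal)
  have eq: "prime_radical R +> x = prime_radical R \<longleftrightarrow> x \<in> prime_radical R" if "x \<in> carrier R" for x
    using that N.a_rcos_const N.rcos_const_imp_mem by blast
  let ?Q = "R Quot prime_radical R"
  have carrier: "carrier ?Q = (\<lambda>x. prime_radical R +> x) ` carrier R"
    by (auto simp: FactRing_def A_RCOSETS_def' a_r_coset_def')
  have mult: "(prime_radical R +> x) \<otimes>\<^bsub>?Q\<^esub> (prime_radical R +> y) = prime_radical R +> (x \<otimes> y)"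
    if "x \<in> carrier R" "y \<in> carrier R" for x y
    using that by (simp add: FactRing_def N.rcoset_mult_add)
  have zero: "\<zero>\<^bsub>?Q\<^esub> = prime_radical R"
    by (simp add: FactRing_def)
  show ?thesis
  proof (cases "c \<in> carrier R")
    case True
    then have "prime_radical R +> c \<in> (\<lambda>x. prime_radical R +> x) ` carrier R"
      by (rule imageI)
    then show ?thesis
      unfolding C_prime_def regular_elements_def carrier zero
      using True by (simp add: mult eq cong: ball_cong)
  qed (simp add: C_prime_def)
qed

end

lemma (in ring) C_primeD:
  assumes "c \<in> C_prime R"
  shows "c \<in> carrier R"
    "a \<in> carrier R \<Longrightarrow> c \<otimes> a \<in> prime_radical R \<Longrightarrow> a \<in> prime_radical R"
    "a \<in> carrier R \<Longrightarrow> a \<otimes> c \<in> prime_radical R \<Longrightarrow> a \<in> prime_radical R"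
  using assms unfolding C_prime_iff by blast+

section \<open>The prime radical of a left Artinian ring\<close>

context left_artinian_ring
begin

lemma minimal_left_ideal:
  assumes "L0 \<in> F" "\<And>L. L \<in> F \<Longrightarrow> left_ideal L R"
  obtains M where "M \<in> F" "\<And>L. L \<in> F \<Longrightarrow> L \<subseteq> M \<Longrightarrow> L = M"
proof (rule ccontr)
  assume "\<not> thesis"
  note minimal = that
  have step: "\<exists>L' \<in> F. L' \<subset> L" if L: "L \<in> F" for L
  proof (rule ccontr)
    assume "\<not> (\<exists>L' \<in> F. L' \<subset> L)"
    then have thesis by (intro minimal[OF L]) blast
    with \<open>\<not> thesis\<close> show False ..
  qed
  define J where "J = rec_nat L0 (\<lambda>_ L. SOME L'. L' \<in> F \<and> L' \<subset> L)"
  have J_Suc: "J (Suc i) = (SOME L'. L' \<in> F \<and> L' \<subset> J i)" for i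
    by (simp add: J_def)
  have smaller: "(SOME L'. L' \<in> F \<and> L' \<subset> L) \<in> F \<and> (SOME L'. L' \<in> F \<and> L' \<subset> L) \<subset> L"
    if "L \<in> F" for L
    by (rule someI_ex) (use step[OF that] in blast)
  have J_F: "J i \<in> F" for i
  proof (induction i)
    case 0 then show ?case using assms(1) by (simp add: J_def)
  next
    case (Suc i)
    then show ?case
      unfolding J_Suc using smaller by blast
  qed
  have J_dec: "J (Suc i) \<subset> J i" for i
    unfolding J_Suc using smaller[OF J_F] by blast
  then obtain m where "\<forall>i\<ge>m. J i = J m"
    using descending_chain[of J] assms(2)[OF J_F] by blast
  then show False using J_dec[of m] by (metis le_Suc_eq order_refl psubset_eq)
qed

text \<open>Finite products of primes, repetitions allowed. The empty product is the whole ring, so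
  the family is nonempty and has a minimal member.\<close>

inductive_set prime_products :: "'a set set" where
  carrier: "carrier R \<in> prime_products"
| prod: "B \<in> prime_products \<Longrightarrow> nc_prime_ideal P R \<Longrightarrow> B \<cdot> P \<in> prime_products"

lemma prime_product_ideal: "B \<in> prime_products \<Longrightarrow> ideal B R"
  by (induction rule: prime_products.induct)
    (auto simp: oneideal nc_prime_ideal_def intro: ideal_prod_is_ideal)

text \<open>For a minimal product \<open>B\<close> of primes and a minimal left ideal \<open>L\<close> with \<open>BL \<noteq> 0\<close>, the
  annihilator of the simple module \<open>L/{y \<in> L. By = 0}\<close> is a prime \<open>P\<close> with \<open>BP \<noteq> B\<close>.\<close>

lemma zero_prime_product: "{\<zero>} \<in> prime_products"
proof -
  obtain B where B: "B \<in> prime_products"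
      and B_min: "\<And>C. C \<in> prime_products \<Longrightarrow> C \<subseteq> B \<Longrightarrow> C = B"
    by (rule minimal_left_ideal[OF prime_products.carrier])
      (auto intro: ideal.is_left_ideal prime_product_ideal)
  interpret B: ideal B R using B by (rule prime_product_ideal)
  \<comment> \<open>One more prime factor stays inside \<open>B\<close>, so minimality forces
    equality. It suffices to contradict this for the single prime constructed below.\<close>
  have BP: "B \<cdot> P = B" if "nc_prime_ideal P R" for P
    using B_min[OF prime_products.prod[OF B that]]
      ideal_prod_inter[OF B.is_ideal nc_prime_ideal.axioms(1)[OF that]] by blast
  have "B = {\<zero>}"
  proof (rule ccontr)
    assume "B \<noteq> {\<zero>}"
    then obtain b0 where b0: "b0 \<in> B" "b0 \<noteq> \<zero>" using B.zero_closed by blast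
    define F where "F = {L. left_ideal L R \<and> (\<exists>b \<in> B. \<exists>y \<in> L. b \<otimes> y \<noteq> \<zero>)}"
    have "carrier R \<in> F"
      unfolding F_def using b0 B.a_Hcarr[OF b0(1)] ideal.is_left_ideal[OF oneideal]
      by (intro CollectI conjI bexI[of _ b0] bexI[of _ \<one>]) simp_all
    then obtain L where L: "L \<in> F" and L_min: "\<And>K. K \<in> F \<Longrightarrow> K \<subseteq> L \<Longrightarrow> K = L"
      by (rule minimal_left_ideal) (auto simp: F_def)
    interpret L: left_ideal L R using L by (simp add: F_def)
    obtain b1 y1 where b1: "b1 \<in> B" "y1 \<in> L" "b1 \<otimes> y1 \<noteq> \<zero>" using L by (auto simp: F_def)
    define K where "K = {y \<in> L. \<forall>b \<in> B. b \<otimes> y = \<zero>}"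
    interpret K: left_ideal K R
    proof (rule left_idealI)
      fix y r assume y: "y \<in> K" and r: "r \<in> carrier R"
      have "b \<otimes> (r \<otimes> y) = \<zero>" if "b \<in> B" for b
        using y r that B.I_r_closed[OF that r] by (simp add: K_def m_assoc[symmetric])
      then show "r \<otimes> y \<in> K" using y r L.l_closed by (simp add: K_def)
    qed (auto simp: K_def r_distr)
    \<comment> \<open>This makes \<open>L/K\<close> simple: for \<open>y\<close> outside
      \<open>K\<close> the left ideal \<open>R y\<close> is not killed by \<open>B\<close>, so it
      belongs to \<open>F\<close>, and minimality of \<open>L\<close> gives
      \<open>R y = L\<close>.\<close>
    have gen: "\<exists>r \<in> carrier R. z = r \<otimes> y" if y: "y \<in> L" "y \<notin> K" and z: "z \<in> L" for y z
    proof -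
      have yc: "y \<in> carrier R" using y by simp
      have "left_ideal ((\<lambda>r. r \<otimes> y) ` carrier R) R"
      proof (rule left_idealI)
        show "\<zero> \<in> (\<lambda>r. r \<otimes> y) ` carrier R"
          using yc by (intro image_eqI[of _ _ \<zero>]) simp_all
      next
        fix u v assume "u \<in> (\<lambda>r. r \<otimes> y) ` carrier R" "v \<in> (\<lambda>r. r \<otimes> y) ` carrier R"
        then obtain r t where "r \<in> carrier R" "t \<in> carrier R" "u = r \<otimes> y" "v = t \<otimes> y" by blast
        then show "u \<oplus> v \<in> (\<lambda>r. r \<otimes> y) ` carrier R"
          using yc by (intro image_eqI[of _ _ "r \<oplus> t"]) (simp_all add: l_distr)
      next
        fix u a assume "u \<in> (\<lambda>r. r \<otimes> y) ` carrier R" and a: "a \<in> carrier R"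
        then obtain r where "r \<in> carrier R" "u = r \<otimes> y" by blast
        then show "a \<otimes> u \<in> (\<lambda>r. r \<otimes> y) ` carrier R"
          using yc a by (intro image_eqI[of _ _ "a \<otimes> r"]) (simp_all add: m_assoc)
      qed (use yc in auto)
      moreover obtain b where "b \<in> B" "b \<otimes> y \<noteq> \<zero>" using y by (auto simp: K_def)
      moreover have "y \<in> (\<lambda>r. r \<otimes> y) ` carrier R"
        using yc by (intro image_eqI[of _ _ \<one>]) simp_all
      ultimately have "(\<lambda>r. r \<otimes> y) ` carrier R \<in> F" unfolding F_def by blast
      moreover have "(\<lambda>r. r \<otimes> y) ` carrier R \<subseteq> L" using y L.l_closed by auto
      ultimately have "(\<lambda>r. r \<otimes> y) ` carrier R = L" by (rule L_min)
      then show ?thesis using z by blast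
    qed
    define P where "P = {r \<in> carrier R. \<forall>y \<in> L. r \<otimes> y \<in> K}"
    have "left_ideal P R"
    proof (rule left_idealI)
      fix r a assume "r \<in> P" "a \<in> carrier R"
      then show "a \<otimes> r \<in> P" by (auto simp: P_def m_assoc intro: K.l_closed)
    qed (auto simp: P_def l_distr)
    then have P_ideal: "ideal P R"
      by (rule idealI') (auto simp: P_def m_assoc intro: L.l_closed)
    have "nc_prime_ideal P R"
    proof (intro nc_prime_ideal.intro nc_prime_ideal_axioms.intro P_ideal)
      have "\<one> \<otimes> y1 \<notin> K" using b1 by (auto simp: K_def)
      then have "\<one> \<notin> P" using b1(2) unfolding P_def by blast
      then show "P \<noteq> carrier R" by auto
    next
      fix I J assume I: "ideal I R" and J: "ideal J R" and IJ: "I \<cdot> J \<subseteq> P"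
      interpret I: ideal I R by fact
      interpret J: ideal J R by fact
      have "I \<subseteq> P" if not_J: "\<not> J \<subseteq> P"
      proof
        obtain j y where j: "j \<in> J" "y \<in> L" "j \<otimes> y \<notin> K"
          using not_J J.a_Hcarr unfolding P_def by blast
        fix i assume i: "i \<in> I"
        \<comment> \<open>Since \<open>j y\<close> is outside \<open>K\<close>, it generates
          \<open>L\<close>. Thus \<open>z = r j y\<close> and \<open>i z = (i (r j)) y\<close>,
          where \<open>i (r j)\<close> lies in the product of the two ideals and therefore in
          \<open>P\<close>.\<close>
        have "i \<otimes> z \<in> K" if z: "z \<in> L" for z
        proof -
          obtain r where r: "r \<in> carrier R" "z = r \<otimes> (j \<otimes> y)"
            using gen[of "j \<otimes> y" z] j z L.l_closed[of y j] by auto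
          have "i \<otimes> (r \<otimes> j) \<in> P"
            using IJ ideal_prod.prod[OF i J.I_l_closed[OF j(1) r(1)]] by blast
          then have "(i \<otimes> (r \<otimes> j)) \<otimes> y \<in> K" using j by (simp add: P_def)
          then show ?thesis using i j r by (simp add: m_assoc)
        qed
        then show "i \<in> P" using i by (simp add: P_def)
      qed
      then show "I \<subseteq> P \<or> J \<subseteq> P" by blast
    qed
    \<comment> \<open>As \<open>B P = B\<close>, the element \<open>b1\<close> is a sum of products
      \<open>b p\<close> with \<open>p y1 \<in> K\<close>, and \<open>K\<close> is killed by
      \<open>B\<close>. Hence \<open>b1 y1 = 0\<close>, contrary to the choice of \<open>b1\<close>
      and \<open>y1\<close>.\<close>
    then have "b1 \<in> B \<cdot> P" using BP b1 by simp
    then have "b1 \<in> carrier R \<and> b1 \<otimes> y1 = \<zero>"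
    proof (induction rule: ideal_prod.induct)
      case (prod b p)
      then have "b \<otimes> (p \<otimes> y1) = \<zero>" using b1 by (auto simp: P_def K_def)
      then show ?case using prod b1 by (auto simp: m_assoc P_def)
    next
      case (sum u v) then show ?case using b1 by (simp add: l_distr)
    qed
    then show False using b1 by simp
  qed
  then show ?thesis using B by simp
qed

text \<open>Every prime contains the prime radical, so a power of it lies in each finite product of
  primes, and one such product is zero.\<close>

theorem nilpotent_prime_radical: "\<exists>k. ideal_pow R (prime_radical R) k = {\<zero>}"
proof -
  have "\<exists>k. ideal_pow R (prime_radical R) k \<subseteq> B" if "B \<in> prime_products" for B
    using that
  proof (induction rule: prime_products.induct)
    case carrier
    then show ?case by (intro exI[of _ 0]) simp
  next
    case (prod B P)
    then obtain k where "ideal_pow R (prime_radical R) k \<subseteq> B" by blast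
    then have "ideal_pow R (prime_radical R) (Suc k) \<subseteq> B \<cdot> P"
      using ideal_prod_mono[OF _ prime_radical_subset[OF prod(2)]] by simp
    then show ?case by blast
  qed
  then obtain k where "ideal_pow R (prime_radical R) k \<subseteq> {\<zero>}"
    using zero_prime_product by blast
  moreover have "\<zero> \<in> ideal_pow R (prime_radical R) k"
    by (rule additive_subgroup.zero_closed[OF ideal.axioms(1)])
      (rule ideal_pow_ideal[OF prime_radical_ideal])
  ultimately show ?thesis by blast
qed

end

section \<open>Ideals of a left Artinian localization\<close>

locale artinian_localization = left_localization +
  assumes artinian: "left_artinian_ring B"

sublocale artinian_localization \<subseteq> B: left_artinian_ring B
  by (rule artinian)

lemma (in ring_hom_ring) hom_ideal_pow:
  assumes "\<And>x. x \<in> I \<Longrightarrow> h x \<in> L" "I \<subseteq> carrier R" "ideal I R" "x \<in> ideal_pow R I k"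
  shows "h x \<in> ideal_pow S L k"
  using assms(4)
proof (induction k arbitrary: x)
  case (Suc k)
  from Suc.prems have "x \<in> ideal_pow R I k \<cdot>\<^bsub>R\<^esub> I" by simp
  then have "x \<in> carrier R \<and> h x \<in> ideal_pow S L k \<cdot>\<^bsub>S\<^esub> L"
  proof (induction rule: ideal_prod.induct)
    case (prod a b)
    then have "a \<in> carrier R" "b \<in> carrier R"
      using R.ideal_pow_subset_carrier[OF assms(3), of k] assms(2) by blast+
    then show ?case
      using ideal_prod.prod[OF Suc.IH[OF prod(1)] assms(1)[OF prod(2)], of S] by simp
  next
    case (sum a b)
    then show ?case by (simp add: ideal_prod.sum)
  qed
  then show ?case by simp
qed simp

context left_localization
begin

lemma ideal_contraction:
  assumes "ideal L B"
  shows "ideal (contraction L) A"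
proof -
  interpret L: ideal L B by fact
  have "left_ideal (contraction L) A"
    using saturated_contraction[OF L.is_left_ideal] by (simp add: saturated_left_ideal_def)
  then show ?thesis
    by (rule R.idealI') (auto simp: contraction_def L.I_r_closed)
qed

lemma Units_regular:
  assumes "c \<in> carrier A" "f c \<in> Units B"
    and f_eq_zero: "\<And>a. a \<in> carrier A \<Longrightarrow> f a = \<zero>\<^bsub>B\<^esub> \<Longrightarrow> a = \<zero>"
  shows "c \<in> regular_elements A"
proof (rule R.regular_elementsI[OF assms(1)])
  fix a assume a: "a \<in> carrier A"
  show "a = \<zero>" if "c \<otimes> a = \<zero>"
  proof -
    have "f c \<otimes>\<^bsub>B\<^esub> f a = f c \<otimes>\<^bsub>B\<^esub> \<zero>\<^bsub>B\<^esub>"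
      using that assms(1) a by (simp flip: hom_mult)
    then have "f a = \<zero>\<^bsub>B\<^esub>"
      using S.Units_l_cancel[OF assms(2), of "f a" "\<zero>\<^bsub>B\<^esub>"] a by simp
    then show ?thesis using f_eq_zero[OF a] by blast
  qed
  show "a = \<zero>" if "a \<otimes> c = \<zero>"
  proof -
    have "f a \<otimes>\<^bsub>B\<^esub> f c = \<zero>\<^bsub>B\<^esub>"
      using that assms(1) a by (simp flip: hom_mult)
    then have "f a \<otimes>\<^bsub>B\<^esub> f c \<otimes>\<^bsub>B\<^esub> inv\<^bsub>B\<^esub> f c = \<zero>\<^bsub>B\<^esub>"
      using assms(2) by simp
    then have "f a = \<zero>\<^bsub>B\<^esub>"
      using assms a by (simp add: S.m_assoc)
    then show ?thesis using f_eq_zero[OF a] by blast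
  qed
qed

end

context artinian_localization
begin

text \<open>Right multiplication by \<open>f a\<close> is immediate. The difficulty is right
  multiplication by the inverse of a denominator, and there the chain condition enters; a general
  element of \<open>B\<close> combines the two.\<close>

lemma ideal_extension:
  assumes "ideal I A"
  shows "ideal (extension I) B"
proof -
  interpret I: ideal I A by fact
  have left: "left_ideal (extension I) B"
    by (rule left_ideal_extension[OF I.is_left_ideal])
  interpret E: left_ideal "extension I" B by (rule left)
  have r_closed_f: "q \<otimes>\<^bsub>B\<^esub> f a \<in> extension I" if q: "q \<in> extension I" and a: "a \<in> carrier A" for q a
  proof -
    obtain s x where s: "q \<in> carrier B" "s \<in> S" "x \<in> I" "f s \<otimes>\<^bsub>B\<^esub> q = f x"
      using q by (rule extensionE)
    have "f s \<otimes>\<^bsub>B\<^esub> (q \<otimes>\<^bsub>B\<^esub> f a) = (f s \<otimes>\<^bsub>B\<^esub> q) \<otimes>\<^bsub>B\<^esub> f a"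
      using s(1,2) a by (simp add: S.m_assoc)
    also have "\<dots> = f (x \<otimes> a)"
      using s(3) a by (simp add: s(4))
    finally show ?thesis
      using s a I.I_r_closed[OF s(3) a] by (intro extensionI[of _ s "x \<otimes> a"]) simp_all
  qed
  have r_closed_inv: "q \<otimes>\<^bsub>B\<^esub> inv\<^bsub>B\<^esub> f s \<in> extension I" if q: "q \<in> extension I" and s: "s \<in> S" for q s
  proof -
    define w where "w = inv\<^bsub>B\<^esub> f s"
    have w [simp]: "w \<in> carrier B" and fsw: "f s \<otimes>\<^bsub>B\<^esub> w = \<one>\<^bsub>B\<^esub>" "w \<otimes>\<^bsub>B\<^esub> f s = \<one>\<^bsub>B\<^esub>"
      using s by (simp_all add: w_def)
    have fs [simp]: "f s \<in> carrier B" using s by simp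
    have fs_w: "f s [^]\<^bsub>B\<^esub> m \<otimes>\<^bsub>B\<^esub> w [^]\<^bsub>B\<^esub> m = \<one>\<^bsub>B\<^esub>" for m :: nat
    proof (induction m)
      case (Suc m)
      have "f s [^]\<^bsub>B\<^esub> Suc m \<otimes>\<^bsub>B\<^esub> w [^]\<^bsub>B\<^esub> Suc m =
          f s [^]\<^bsub>B\<^esub> m \<otimes>\<^bsub>B\<^esub> (f s \<otimes>\<^bsub>B\<^esub> w) \<otimes>\<^bsub>B\<^esub> w [^]\<^bsub>B\<^esub> m"
        unfolding S.nat_pow_Suc2[OF w, of m] by (simp add: S.m_assoc)
      then show ?case using Suc by (simp add: fsw)
    qed simp
    \<comment> \<open>As \<open>w\<close> inverts \<open>f s\<close>, this is
      \<open>extension I\<close> multiplied on the right by \<open>(f s)^m\<close>. Once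
      \<open>J (Suc m) = J m\<close>, the element \<open>q (f s)^m\<close> of \<open>J m\<close>
      shows that \<open>q w\<close> lies in \<open>extension I\<close>.\<close>
    define J where "J m = {p \<in> carrier B. p \<otimes>\<^bsub>B\<^esub> w [^]\<^bsub>B\<^esub> m \<in> extension I}" for m :: nat
    have "left_ideal (J m) B" for m
    proof (rule S.left_idealI)
      fix p a assume "p \<in> J m" "a \<in> carrier B"
      then show "a \<otimes>\<^bsub>B\<^esub> p \<in> J m"
        using E.l_closed[of "p \<otimes>\<^bsub>B\<^esub> w [^]\<^bsub>B\<^esub> m" a] by (simp add: J_def S.m_assoc)
    qed (auto simp: J_def S.l_distr)
    moreover have "J (Suc m) \<subseteq> J m" for m
    proof
      fix p assume p: "p \<in> J (Suc m)"
      then have "(p \<otimes>\<^bsub>B\<^esub> w [^]\<^bsub>B\<^esub> Suc m) \<otimes>\<^bsub>B\<^esub> f s \<in> extension I"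
        using s by (intro r_closed_f) (auto simp: J_def)
      then show "p \<in> J m"
        using p by (simp add: J_def S.m_assoc fsw)
    qed
    ultimately obtain m where m: "\<forall>i\<ge>m. J i = J m"
      using B.descending_chain[of J] by auto
    have qc: "q \<in> carrier B" using q by simp
    have "q \<otimes>\<^bsub>B\<^esub> f s [^]\<^bsub>B\<^esub> m \<in> J m"
      using q qc by (simp add: J_def S.m_assoc fs_w)
    moreover have "J (Suc m) = J m" by (rule m[rule_format]) simp
    ultimately have "q \<otimes>\<^bsub>B\<^esub> f s [^]\<^bsub>B\<^esub> m \<in> J (Suc m)" by simp
    then have "q \<otimes>\<^bsub>B\<^esub> (f s [^]\<^bsub>B\<^esub> m \<otimes>\<^bsub>B\<^esub> w [^]\<^bsub>B\<^esub> m) \<otimes>\<^bsub>B\<^esub> w \<in> extension I"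
      using qc by (simp add: J_def S.m_assoc)
    then have "q \<otimes>\<^bsub>B\<^esub> w \<in> extension I"
      using qc by (simp add: fs_w)
    then show ?thesis
      by (simp add: w_def)
  qed
  show ?thesis
  proof (rule S.idealI'[OF left])
    fix q b assume q: "q \<in> extension I" and b: "b \<in> carrier B"
    obtain s a where s: "s \<in> S" "a \<in> carrier A" "f s \<otimes>\<^bsub>B\<^esub> b = f a"
      using fraction_ex[OF b] by blast
    have "b = inv\<^bsub>B\<^esub> f s \<otimes>\<^bsub>B\<^esub> (f s \<otimes>\<^bsub>B\<^esub> b)"
      using s(1,2) b by (simp flip: S.m_assoc)
    then have "q \<otimes>\<^bsub>B\<^esub> b = (q \<otimes>\<^bsub>B\<^esub> inv\<^bsub>B\<^esub> f s) \<otimes>\<^bsub>B\<^esub> f a"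
      using q s b by (simp add: S.m_assoc)
    then show "q \<otimes>\<^bsub>B\<^esub> b \<in> extension I"
      using r_closed_f[OF r_closed_inv[OF q s(1)] s(2)] by simp
  qed
qed

text \<open>A product of fractions s^{-1}x and t^{-1}y contains \<open>x\<close> times the inverse
  of \<open>t\<close>. Because \<open>extension I\<close> is two-sided, this factor is again a
  fraction u^{-1}z with \<open>z \<in> I\<close>, and the product has numerator
  \<open>z y\<close>.\<close>

lemma extension_prod:
  assumes "ideal I A" "ideal J A"
  shows "extension (I \<cdot> J) = extension I \<cdot>\<^bsub>B\<^esub> extension J"
proof
  interpret I: ideal I A by fact
  interpret J: ideal J A by fact
  interpret EI: ideal "extension I" B by (rule ideal_extension) fact
  interpret EJ: ideal "extension J" B by (rule ideal_extension) fact
  interpret IJ: ideal "I \<cdot> J" A by (rule R.ideal_prod_is_ideal) fact+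
  interpret EIJ: ideal "extension (I \<cdot> J)" B by (rule ideal_extension) (rule IJ.is_ideal)
  interpret P: ideal "extension I \<cdot>\<^bsub>B\<^esub> extension J" B
    by (rule S.ideal_prod_is_ideal) (rule EI.is_ideal EJ.is_ideal)+
  show "extension I \<cdot>\<^bsub>B\<^esub> extension J \<subseteq> extension (I \<cdot> J)"
  proof (rule S.ideal_prod_subsetI[OF EIJ.is_ideal])
    fix p q assume p: "p \<in> extension I" and q: "q \<in> extension J"
    obtain s x where s: "p \<in> carrier B" "s \<in> S" "x \<in> I" "f s \<otimes>\<^bsub>B\<^esub> p = f x"
      using p by (rule extensionE)
    obtain t y where t: "q \<in> carrier B" "t \<in> S" "y \<in> J" "f t \<otimes>\<^bsub>B\<^esub> q = f y"
      using q by (rule extensionE)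
    have xy: "x \<in> carrier A" "y \<in> carrier A" using s t by auto
    have "f x \<otimes>\<^bsub>B\<^esub> inv\<^bsub>B\<^esub> f t \<in> extension I"
      using f_in_extension[OF I.a_subset s(3)] t(2) by (intro EI.I_r_closed) simp_all
    then obtain u z where u: "u \<in> S" "z \<in> I"
        "f u \<otimes>\<^bsub>B\<^esub> (f x \<otimes>\<^bsub>B\<^esub> inv\<^bsub>B\<^esub> f t) = f z"
      by (rule extensionE)
    have z: "z \<in> carrier A" using u by auto
    have "q = inv\<^bsub>B\<^esub> f t \<otimes>\<^bsub>B\<^esub> (f t \<otimes>\<^bsub>B\<^esub> q)"
      using t(1,2) by (simp flip: S.m_assoc)
    then have q_eq: "q = inv\<^bsub>B\<^esub> f t \<otimes>\<^bsub>B\<^esub> f y"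
      by (simp only: t(4))
    have "f (u \<otimes> s) \<otimes>\<^bsub>B\<^esub> (p \<otimes>\<^bsub>B\<^esub> q) = f u \<otimes>\<^bsub>B\<^esub> (f s \<otimes>\<^bsub>B\<^esub> p) \<otimes>\<^bsub>B\<^esub> q"
      using u(1) s(1,2) t(1) by (simp add: S.m_assoc)
    also have "\<dots> = f u \<otimes>\<^bsub>B\<^esub> (f x \<otimes>\<^bsub>B\<^esub> inv\<^bsub>B\<^esub> f t) \<otimes>\<^bsub>B\<^esub> f y"
      unfolding s(4) q_eq using u(1) t(2) xy by (simp add: S.m_assoc)
    also have "\<dots> = f (z \<otimes> y)"
      using z xy by (simp add: u(3))
    finally show "p \<otimes>\<^bsub>B\<^esub> q \<in> extension (I \<cdot> J)"
      using s(1,2) t(1) u(1) ideal_prod.prod[OF u(2) t(3), of A]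
      by (intro extensionI[of _ "u \<otimes> s" "z \<otimes> y"]) simp_all
  qed
  have f_prod: "f x \<in> extension I \<cdot>\<^bsub>B\<^esub> extension J" if "x \<in> I \<cdot> J" for x
  proof -
    have "x \<in> carrier A \<and> f x \<in> extension I \<cdot>\<^bsub>B\<^esub> extension J"
      using that
    proof (induction rule: ideal_prod.induct)
      case (prod i j)
      then show ?case
        using ideal_prod.prod[OF f_in_extension[OF I.a_subset prod(1)]
            f_in_extension[OF J.a_subset prod(2)], of B] by simp
    next
      case (sum a b)
      then show ?case by (simp add: ideal_prod.sum)
    qed
    then show ?thesis ..
  qed
  show "extension (I \<cdot> J) \<subseteq> extension I \<cdot>\<^bsub>B\<^esub> extension J"
  proof
    fix q assume "q \<in> extension (I \<cdot> J)"
    then obtain s x where s: "q \<in> carrier B" "s \<in> S" "x \<in> I \<cdot> J" "f s \<otimes>\<^bsub>B\<^esub> q = f x"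
      by (rule extensionE)
    have "q = inv\<^bsub>B\<^esub> f s \<otimes>\<^bsub>B\<^esub> (f s \<otimes>\<^bsub>B\<^esub> q)"
      using s(1,2) by (simp flip: S.m_assoc)
    then have "q = inv\<^bsub>B\<^esub> f s \<otimes>\<^bsub>B\<^esub> f x"
      by (simp only: s(4))
    then show "q \<in> extension I \<cdot>\<^bsub>B\<^esub> extension J"
      using P.I_l_closed[OF f_prod[OF s(3)], of "inv\<^bsub>B\<^esub> f s"] s(2) by simp
  qed
qed

lemma extension_pow:
  assumes "ideal I A"
  shows "extension (ideal_pow A I k) = ideal_pow B (extension I) k"
  by (induction k) (simp_all add: extension_prod R.ideal_pow_ideal assms)

text \<open>If \<open>I J\<close> is contained in the contraction of \<open>P\<close>, then the
  product of the extensions, being the extension of \<open>I J\<close>, is contained in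
  \<open>P\<close>, and primality of \<open>P\<close> applies.\<close>

lemma nc_prime_contraction:
  assumes "nc_prime_ideal P B"
  shows "nc_prime_ideal (contraction P) A"
proof -
  interpret P: nc_prime_ideal P B by fact
  have "\<one>\<^bsub>B\<^esub> \<notin> P" using P.proper P.one_imp_carrier by blast
  then have "\<one> \<notin> contraction P" by (simp add: contraction_def)
  then have proper: "contraction P \<noteq> carrier A" by auto
  have "I \<subseteq> contraction P \<or> J \<subseteq> contraction P"
    if I: "ideal I A" and J: "ideal J A" and IJ: "I \<cdot> J \<subseteq> contraction P" for I J
  proof -
    have "extension I \<cdot>\<^bsub>B\<^esub> extension J \<subseteq> P"
      using extension_mono[OF IJ] extension_prod[OF I J] extension_contraction[OF P.is_left_ideal]
      by simp
    then have "extension I \<subseteq> P \<or> extension J \<subseteq> P"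
      using P.prime[OF ideal_extension[OF I] ideal_extension[OF J]] by simp
    moreover have "K \<subseteq> contraction P" if "ideal K A" "extension K \<subseteq> P" for K
    proof
      fix x assume x: "x \<in> K"
      have "K \<subseteq> carrier A" using ideal.Icarr[OF that(1)] by blast
      then show "x \<in> contraction P"
        using that(2) f_in_extension[of K x] x by (auto simp: contraction_def)
    qed
    ultimately show ?thesis using I J by blast
  qed
  then show ?thesis
    by (intro nc_prime_ideal.intro nc_prime_ideal_axioms.intro ideal_contraction P.is_ideal proper)
qed

lemma prime_radical_subset_contraction: "prime_radical A \<subseteq> contraction (prime_radical B)"
proof
  fix x assume x: "x \<in> prime_radical A"
  then have "f x \<in> P" if "nc_prime_ideal P B" for P
    using nc_prime_contraction[OF that] by (auto simp: prime_radical_def contraction_def)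
  then show "x \<in> contraction (prime_radical B)"
    using x by (auto simp: prime_radical_def contraction_def)
qed

end

section \<open>Rings with a left Artinian left quotient ring\<close>

locale artinian_quotient_ring = artinian_localization +
  assumes S_regular: "S = regular_elements A"
begin

lemma f_eq_zero: "a \<in> carrier A \<Longrightarrow> f a = \<zero>\<^bsub>B\<^esub> \<longleftrightarrow> a = \<zero>"
  using kernel_torsion R.regular_elementsD(2) by (metis S_regular hom_zero)

lemma contraction_prime_radical_nilpotent:
  "\<exists>k. ideal_pow A (contraction (prime_radical B)) k = {\<zero>}"
proof -
  obtain k where k: "ideal_pow B (prime_radical B) k = {\<zero>\<^bsub>B\<^esub>}"
    using B.nilpotent_prime_radical by blast
  have ideal: "ideal (contraction (prime_radical B)) A"
    by (rule ideal_contraction) (rule S.prime_radical_ideal)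
  have "x = \<zero>" if "x \<in> ideal_pow A (contraction (prime_radical B)) k" for x
  proof -
    have "f x \<in> ideal_pow B (prime_radical B) k"
      using that by (intro hom_ideal_pow[OF _ _ ideal]) (auto simp: contraction_def)
    then show ?thesis
      using k f_eq_zero R.ideal_pow_subset_carrier[OF ideal, of k] that by auto
  qed
  moreover have "\<zero> \<in> ideal_pow A (contraction (prime_radical B)) k"
    by (rule additive_subgroup.zero_closed[OF ideal.axioms(1)]) (rule R.ideal_pow_ideal[OF ideal])
  ultimately show ?thesis by (intro exI[of _ k]) blast
qed

text \<open>One inclusion holds because primes of \<open>B\<close> contract to primes of
  \<open>A\<close>; the other because the contraction of the prime radical of \<open>B\<close> is
  nilpotent, hence inside every prime of \<open>A\<close>.\<close>

lemma prime_radical_eq: "prime_radical A = contraction (prime_radical B)"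
proof
  obtain k where k: "ideal_pow A (contraction (prime_radical B)) k = {\<zero>}"
    using contraction_prime_radical_nilpotent by blast
  have ideal: "ideal (contraction (prime_radical B)) A"
    by (rule ideal_contraction) (rule S.prime_radical_ideal)
  have "ideal_pow A (contraction (prime_radical B)) k \<subseteq> prime_radical A"
    using k additive_subgroup.zero_closed[OF ideal.axioms(1)[OF R.prime_radical_ideal]] by simp
  then show "contraction (prime_radical B) \<subseteq> prime_radical A"
    by (rule R.ideal_pow_subset_prime_radical[OF ideal])
qed (rule prime_radical_subset_contraction)

lemma nilpotent_prime_radical: "nilpotent_ideal A (prime_radical A)"
  unfolding nilpotent_ideal_def
  using R.prime_radical_ideal contraction_prime_radical_nilpotent prime_radical_eq by simp

lemma extension_prime_radical: "extension (prime_radical A) = prime_radical B"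
  unfolding prime_radical_eq
  by (rule extension_contraction) (rule ideal.is_left_ideal[OF S.prime_radical_ideal])

lemma extension_prime_radical_pow:
  "extension (ideal_pow A (prime_radical A) k) = ideal_pow B (prime_radical B) k"
  by (simp add: extension_pow R.prime_radical_ideal extension_prime_radical)

text \<open>Right cancellation of \<open>c\<close> modulo the radical passes to \<open>f c\<close>
  in \<open>B\<close>, so the chain condition gives \<open>q f(c) = \<one> \<ominus> v\<close> with
  \<open>v\<close> in the nilpotent radical. This difference is a unit, whence \<open>f c\<close>
  has a left inverse \<open>w\<close>, which is itself a unit.\<close>

lemma C_prime_Units:
  assumes c: "c \<in> C_prime A"
  shows "f c \<in> Units B"
proof -
  interpret N: ideal "prime_radical B" B by (rule S.prime_radical_ideal)
  note cc [simp] = R.C_primeD(1)[OF c] and c_reg = R.C_primeD(3)[OF c]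
  have cancel: "q \<in> prime_radical B" if q: "q \<in> carrier B" "q \<otimes>\<^bsub>B\<^esub> f c \<in> prime_radical B" for q
  proof -
    obtain s r where s: "s \<in> S" "r \<in> carrier A" "f s \<otimes>\<^bsub>B\<^esub> q = f r"
      using fraction_ex q by blast
    have "f s \<otimes>\<^bsub>B\<^esub> (q \<otimes>\<^bsub>B\<^esub> f c) = (f s \<otimes>\<^bsub>B\<^esub> q) \<otimes>\<^bsub>B\<^esub> f c"
      using s(1,2) q(1) by (simp add: S.m_assoc)
    then have "f (r \<otimes> c) \<in> prime_radical B"
      using s N.I_l_closed[OF q(2), of "f s"] by simp
    then have "r \<in> prime_radical A"
      using s(2) by (intro c_reg[of r]) (simp_all add: prime_radical_eq contraction_def)
    then show ?thesis
      using s q(1) extension_prime_radical by (metis extensionI)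
  qed
  obtain q where q: "q \<in> carrier B" "\<one>\<^bsub>B\<^esub> \<ominus>\<^bsub>B\<^esub> q \<otimes>\<^bsub>B\<^esub> f c \<in> prime_radical B"
    by (rule B.right_cancellable_left_invertible_mod[OF N.is_ideal hom_closed[OF cc] cancel])
  define v where "v = \<one>\<^bsub>B\<^esub> \<ominus>\<^bsub>B\<^esub> q \<otimes>\<^bsub>B\<^esub> f c"
  have v: "v \<in> carrier B" "v \<in> prime_radical B" and qc: "q \<otimes>\<^bsub>B\<^esub> f c = \<one>\<^bsub>B\<^esub> \<ominus>\<^bsub>B\<^esub> v"
    using q by (simp_all add: v_def S.minus_eq S.minus_add S.a_ac S.r_neg1 S.r_neg2)
  obtain k where k: "ideal_pow B (prime_radical B) k = {\<zero>\<^bsub>B\<^esub>}"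
    using B.nilpotent_prime_radical by blast
  have "q \<otimes>\<^bsub>B\<^esub> f c \<in> Units B"
    unfolding qc
  proof (rule B.right_cancellable_Units)
    fix x assume x: "x \<in> carrier B" "x \<otimes>\<^bsub>B\<^esub> (\<one>\<^bsub>B\<^esub> \<ominus>\<^bsub>B\<^esub> v) = \<zero>\<^bsub>B\<^esub>"
    then have "x \<ominus>\<^bsub>B\<^esub> x \<otimes>\<^bsub>B\<^esub> v = \<zero>\<^bsub>B\<^esub>"
      using v(1) by (simp add: S.minus_eq S.r_distr S.r_minus)
    then have xv: "x = x \<otimes>\<^bsub>B\<^esub> v"
      using x(1) v(1) S.minus_eq_zero_iff[of x "x \<otimes>\<^bsub>B\<^esub> v"] by simp
    \<comment> \<open>Iterating \<open>x = x v\<close> puts \<open>x\<close> into every power of the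
      radical.\<close>
    have "x \<in> ideal_pow B (prime_radical B) i" for i
    proof (induction i)
      case (Suc i)
      have "x \<otimes>\<^bsub>B\<^esub> v \<in> ideal_pow B (prime_radical B) (Suc i)"
        using ideal_prod.prod[OF Suc v(2), of B] by simp
      then show ?case using xv by simp
    qed (simp add: x)
    then show "x = \<zero>\<^bsub>B\<^esub>" using k by blast
  qed (simp add: v)
  then obtain u where u: "u \<in> carrier B" "u \<otimes>\<^bsub>B\<^esub> (q \<otimes>\<^bsub>B\<^esub> f c) = \<one>\<^bsub>B\<^esub>"
    by (auto simp: Units_def)
  define w where "w = u \<otimes>\<^bsub>B\<^esub> q"
  have w [simp]: "w \<in> carrier B" and wc: "w \<otimes>\<^bsub>B\<^esub> f c = \<one>\<^bsub>B\<^esub>"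
    using u q(1) by (simp_all add: w_def S.m_assoc)
  \<comment> \<open>Here \<open>x = x w f(c)\<close>, so \<open>x w = 0\<close> forces
    \<open>x = 0\<close> and \<open>w\<close> is right cancellable. Being a unit with
    \<open>w f(c) = \<one>\<close>, it has \<open>f c\<close> as its inverse.\<close>
  have "w \<in> Units B"
  proof (rule B.right_cancellable_Units)
    fix x assume x: "x \<in> carrier B" "x \<otimes>\<^bsub>B\<^esub> w = \<zero>\<^bsub>B\<^esub>"
    have "x \<otimes>\<^bsub>B\<^esub> w \<otimes>\<^bsub>B\<^esub> f c = x" using x(1) by (simp add: S.m_assoc wc)
    then show "x = \<zero>\<^bsub>B\<^esub>" using x(2) by simp
  qed simp
  then have "inv\<^bsub>B\<^esub> w \<otimes>\<^bsub>B\<^esub> (w \<otimes>\<^bsub>B\<^esub> f c) = f c"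
    by (simp flip: S.m_assoc)
  then have "f c = inv\<^bsub>B\<^esub> w"
    using \<open>w \<in> Units B\<close> by (simp add: wc)
  then show ?thesis using \<open>w \<in> Units B\<close> by simp
qed

theorem C_prime_eq: "C_prime A = regular_elements A"
proof
  show "C_prime A \<subseteq> regular_elements A"
    using C_prime_Units Units_regular f_eq_zero R.C_primeD(1) by blast
  show "regular_elements A \<subseteq> C_prime A"
  proof
    fix c assume "c \<in> regular_elements A"
    then have c: "c \<in> S" by (simp add: S_regular)
    interpret N: ideal "prime_radical B" B by (rule S.prime_radical_ideal)
    have "a \<in> prime_radical A" if a: "a \<in> carrier A" "c \<otimes> a \<in> prime_radical A" for a
    proof -
      have "inv\<^bsub>B\<^esub> f c \<otimes>\<^bsub>B\<^esub> (f c \<otimes>\<^bsub>B\<^esub> f a) \<in> prime_radical B"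
        using a c N.I_l_closed[of "f c \<otimes>\<^bsub>B\<^esub> f a" "inv\<^bsub>B\<^esub> f c"]
        by (simp add: prime_radical_eq contraction_def)
      moreover have "inv\<^bsub>B\<^esub> f c \<otimes>\<^bsub>B\<^esub> (f c \<otimes>\<^bsub>B\<^esub> f a) = f a"
        using a(1) c by (simp flip: S.m_assoc)
      ultimately show ?thesis
        using a(1) by (simp add: prime_radical_eq contraction_def)
    qed
    moreover have "a \<in> prime_radical A" if a: "a \<in> carrier A" "a \<otimes> c \<in> prime_radical A" for a
    proof -
      have "(f a \<otimes>\<^bsub>B\<^esub> f c) \<otimes>\<^bsub>B\<^esub> inv\<^bsub>B\<^esub> f c \<in> prime_radical B"
        using a c N.I_r_closed[of "f a \<otimes>\<^bsub>B\<^esub> f c" "inv\<^bsub>B\<^esub> f c"]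
        by (simp add: prime_radical_eq contraction_def)
      then show ?thesis
        using a(1) c by (simp add: prime_radical_eq contraction_def S.m_assoc)
    qed
    ultimately show "c \<in> C_prime A"
      using S_carrier[OF c] unfolding R.C_prime_iff by blast
  qed
qed

end

section \<open>The associated graded ring\<close>

declare ideal_pow.simps(2) [simp del]

lemma (in left_ideal) finsum_atMost_closed:
  assumes "\<And>i. i \<le> (m::nat) \<Longrightarrow> g i \<in> I"
  shows "(\<Oplus>i\<in>{..m}. g i) \<in> I"
  using assms
proof (induction m)
  case 0
  then show ?case by (simp add: Pi_def)
next
  case (Suc m)
  then have "(\<Oplus>i\<in>{..Suc m}. g i) = g (Suc m) \<oplus> (\<Oplus>i\<in>{..m}. g i)"
    by (intro finsum_Suc) (simp add: Pi_def)
  with Suc show ?case by simp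
qed

text \<open>Elements of \<open>gr R\<close> are handled through polynomials whose \<open>i\<close>-th coefficient lies
  in \<open>\<nn>\<^sup>i\<close>; \<open>gr_of R p\<close> is the element represented by \<open>p\<close>.\<close>

definition graded_reps :: "('a, 'b) ring_scheme \<Rightarrow> (nat \<Rightarrow> 'a) set" where
  "graded_reps R = {p \<in> up R. \<forall>i. p i \<in> ideal_pow R (prime_radical R) i}"

definition gr_of :: "('a, 'b) ring_scheme \<Rightarrow> (nat \<Rightarrow> 'a) \<Rightarrow> (nat \<Rightarrow> 'a set)" where
  "gr_of R p = (\<lambda>i. ideal_pow R (prime_radical R) (Suc i) +>\<^bsub>R\<^esub> p i)"

definition homogeneous :: "('a, 'b) ring_scheme \<Rightarrow> nat \<Rightarrow> 'a \<Rightarrow> (nat \<Rightarrow> 'a)" where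
  "homogeneous R n x = (\<lambda>i. if i = n then x else \<zero>\<^bsub>R\<^esub>)"

context ring
begin

abbreviation nn :: "nat \<Rightarrow> 'a set" where "nn \<equiv> ideal_pow R (prime_radical R)"
abbreviation U :: "(nat \<Rightarrow> 'a) set" where "U \<equiv> graded_reps R"

lemma nn_ideal: "ideal (nn i) R"
  by (rule ideal_pow_ideal[OF prime_radical_ideal])

lemma nn_carrier [simp]: "x \<in> nn i \<Longrightarrow> x \<in> carrier R"
  using ideal.Icarr[OF nn_ideal] .

lemma nn_zero [simp]: "\<zero> \<in> nn i"
  by (rule additive_subgroup.zero_closed[OF ideal.axioms(1)[OF nn_ideal]])

lemma nn_add [simp]: "x \<in> nn i \<Longrightarrow> y \<in> nn i \<Longrightarrow> x \<oplus> y \<in> nn i"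
  by (rule additive_subgroup.a_closed[OF ideal.axioms(1)[OF nn_ideal]])

lemma nn_uminus [simp]: "x \<in> nn i \<Longrightarrow> \<ominus> x \<in> nn i"
  by (rule additive_subgroup.a_inv_closed[OF ideal.axioms(1)[OF nn_ideal]])

lemma nn_minus [simp]: "x \<in> nn i \<Longrightarrow> y \<in> nn i \<Longrightarrow> x \<ominus> y \<in> nn i"
  by (simp add: minus_eq)

lemma nn_l_closed [simp]: "x \<in> nn i \<Longrightarrow> a \<in> carrier R \<Longrightarrow> a \<otimes> x \<in> nn i"
  by (rule ideal.I_l_closed[OF nn_ideal])

lemma nn_r_closed [simp]: "x \<in> nn i \<Longrightarrow> a \<in> carrier R \<Longrightarrow> x \<otimes> a \<in> nn i"
  by (rule ideal.I_r_closed[OF nn_ideal])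

lemma nn_mult: "x \<in> nn i \<Longrightarrow> y \<in> nn j \<Longrightarrow> x \<otimes> y \<in> nn (i + j)"
  by (rule ideal_pow_mult[OF prime_radical_ideal])

lemma nn_antimono: "i \<le> j \<Longrightarrow> nn j \<subseteq> nn i"
  by (rule ideal_pow_antimono[OF prime_radical_ideal])

lemma nn_one: "nn (Suc 0) = prime_radical R"
  by (rule ideal_pow_one[OF prime_radical_ideal])

lemma nn_coset_eq_iff:
  assumes "x \<in> carrier R" "y \<in> carrier R"
  shows "nn i +> x = nn i +> y \<longleftrightarrow> x \<ominus> y \<in> nn i"
proof -
  interpret N: ideal "nn i" R by (rule nn_ideal)
  show ?thesis
    using assms N.a_rcos_module_minus[OF ring_axioms, of y x] N.a_repr_independence'
      N.a_repr_independenceD N.a_rcos_self by metis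
qed

lemma nn_coset_zero: "nn i +> \<zero> = nn i"
  by (rule a_coset_add_zero) (simp add: subset_eq)

text \<open>The two factors are cosets of different powers. With \<open>a = m \<oplus> x\<close> and
  \<open>b = n \<oplus> y\<close> the error is \<open>a b \<ominus> x y = m b \<oplus> x n\<close>,
  and both terms have degree at least \<open>i + j + 1\<close>; so the union over all
  representatives is a single coset.\<close>

lemma rcoset_mult_homogeneous:
  assumes x: "x \<in> nn i" and y: "y \<in> nn j"
  shows "rcoset_mult R (nn (Suc (i + j))) (nn (Suc i) +> x) (nn (Suc j) +> y) =
    nn (Suc (i + j)) +> (x \<otimes> y)"
proof -
  have "nn (Suc (i + j)) +> (a \<otimes> b) = nn (Suc (i + j)) +> (x \<otimes> y)"
    if a: "a \<in> nn (Suc i) +> x" and b: "b \<in> nn (Suc j) +> y" for a b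
  proof -
    obtain m where m: "m \<in> nn (Suc i)" "a = m \<oplus> x" using a by (auto simp: a_r_coset_def')
    obtain n where n: "n \<in> nn (Suc j)" "b = n \<oplus> y" using b by (auto simp: a_r_coset_def')
    have mc: "m \<in> carrier R" "n \<in> carrier R" "x \<in> carrier R" "y \<in> carrier R"
      using m(1) n(1) x y nn_carrier by blast+
    have "b \<in> nn j" using n y nn_antimono[of j "Suc j"] by auto
    then have "m \<otimes> b \<in> nn (Suc (i + j))" "x \<otimes> n \<in> nn (Suc (i + j))"
      using nn_mult[OF m(1), of b j] nn_mult[OF x n(1)] by simp_all
    moreover have "a \<otimes> b \<ominus> x \<otimes> y = m \<otimes> b \<oplus> x \<otimes> n"
      unfolding m(2) n(2) using mc by algebra
    ultimately have "a \<otimes> b \<ominus> x \<otimes> y \<in> nn (Suc (i + j))" by simp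
    then show ?thesis
      using mc m(2) n(2) by (simp add: nn_coset_eq_iff)
  qed
  moreover have "x \<in> nn (Suc i) +> x" "y \<in> nn (Suc j) +> y"
    using x y by (auto simp: a_r_coset_def' intro!: bexI[of _ \<zero>])
  ultimately show ?thesis
    unfolding rcoset_mult_def by blast
qed

section \<open>Representing sequences for elements of the graded ring\<close>

lemma graded_repsD [simp]:
  assumes "p \<in> U"
  shows "p i \<in> nn i" "p i \<in> carrier R" "p \<in> up R"
proof -
  show "p i \<in> nn i" "p \<in> up R" using assms by (simp_all add: graded_reps_def)
  then show "p i \<in> carrier R" by (simp add: mem_upD)
qed

lemma graded_repsI:
  assumes "\<And>i. p i \<in> nn i" "\<And>i. i > n \<Longrightarrow> p i = \<zero>"
  shows "p \<in> U"
proof -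
  have "bound \<zero> n p" using assms(2) by (simp add: bound_def)
  then show ?thesis
    using assms(1) nn_carrier[OF assms(1)] unfolding graded_reps_def by (auto intro!: mem_upI)
qed

lemma graded_reps_bound:
  assumes "p \<in> U"
  obtains n where "\<And>i. i > n \<Longrightarrow> p i = \<zero>"
proof -
  have "p \<in> up R" using assms by simp
  then obtain n where "bound \<zero> n p" by blast
  then show thesis by (intro that[of n]) (simp add: bound_def)
qed

lemma homogeneous_mem [simp]: "x \<in> nn n \<Longrightarrow> homogeneous R n x \<in> U"
  by (rule graded_repsI[of _ n]) (auto simp: homogeneous_def)

lemma graded_reps_add [simp]: "p \<in> U \<Longrightarrow> q \<in> U \<Longrightarrow> (\<lambda>i. p i \<oplus> q i) \<in> U"
  unfolding graded_reps_def using up_add_closed by simp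

lemma graded_reps_minus [simp]: "p \<in> U \<Longrightarrow> q \<in> U \<Longrightarrow> (\<lambda>i. p i \<ominus> q i) \<in> U"
  unfolding graded_reps_def using up_minus_closed by simp

lemma graded_reps_mult [simp]:
  assumes "p \<in> U" "q \<in> U"
  shows "(\<lambda>n. \<Oplus>i\<in>{..n}. p i \<otimes> q (n - i)) \<in> U"
proof -
  have "(\<Oplus>i\<in>{..n}. p i \<otimes> q (n - i)) \<in> nn n" for n
  proof (rule left_ideal.finsum_atMost_closed[OF ideal.is_left_ideal[OF nn_ideal]])
    fix i assume "i \<le> n"
    then show "p i \<otimes> q (n - i) \<in> nn n"
      using nn_mult[of "p i" i "q (n - i)" "n - i"] assms by simp
  qed
  then show ?thesis
    unfolding graded_reps_def using up_mult_closed assms by simp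
qed

section \<open>Arithmetic of the graded ring in terms of representatives\<close>

lemma gr_of_carrier [simp]:
  assumes "p \<in> U"
  shows "gr_of R p \<in> carrier (gr R)"
proof -
  obtain n where "\<And>i. i > n \<Longrightarrow> p i = \<zero>"
    using assms by (rule graded_reps_bound) blast
  then have "{i. gr_of R p i \<noteq> nn (Suc i)} \<subseteq> {..n}"
    by (auto simp: gr_of_def nn_coset_zero simp flip: not_less)
  then have "finite {i. gr_of R p i \<noteq> nn (Suc i)}"
    by (rule finite_subset) simp
  then show ?thesis
    using assms by (simp add: gr_def gr_of_def Let_def)
qed

lemma gr_rep:
  assumes "u \<in> carrier (gr R)"
  obtains p where "p \<in> U" "u = gr_of R p"
proof -
  have u: "\<And>i. u i \<in> (\<lambda>x. nn (Suc i) +> x) ` nn i" and fin: "finite {i. u i \<noteq> nn (Suc i)}"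
    using assms by (auto simp: gr_def Let_def)
  \<comment> \<open>A trivial coset gets the representative \<open>\<zero>\<close>, so that finite
    support of \<open>u\<close> gives finite support of \<open>p\<close>.\<close>
  define p where "p i = (if u i = nn (Suc i) then \<zero> else SOME x. x \<in> nn i \<and> u i = nn (Suc i) +> x)" for i
  have p: "p i \<in> nn i \<and> u i = nn (Suc i) +> p i" for i
  proof (cases "u i = nn (Suc i)")
    case True
    then show ?thesis by (simp add: p_def nn_coset_zero)
  next
    case False
    have "\<exists>x. x \<in> nn i \<and> u i = nn (Suc i) +> x" using u[of i] by blast
    from someI_ex[OF this] show ?thesis using False by (simp add: p_def)
  qed
  obtain n where "\<forall>i \<in> {i. u i \<noteq> nn (Suc i)}. i \<le> n"
    using fin finite_nat_set_iff_bounded_le by blast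
  then have n: "u i = nn (Suc i)" if "i > n" for i
    using that by (metis (mono_tags) leD mem_Collect_eq)
  have "p i = \<zero>" if "i > n" for i
    using n[OF that] by (simp add: p_def)
  then have "p \<in> U" using p by (intro graded_repsI[of p n]) simp_all
  moreover have "u = gr_of R p" using p by (auto simp: gr_of_def)
  ultimately show thesis by (rule that)
qed

lemma gr_of_eq_iff:
  assumes "p \<in> U" "q \<in> U"
  shows "gr_of R p = gr_of R q \<longleftrightarrow> (\<forall>i. p i \<ominus> q i \<in> nn (Suc i))"
  using assms by (simp add: gr_of_def fun_eq_iff nn_coset_eq_iff)

lemma gr_zero: "\<zero>\<^bsub>gr R\<^esub> = gr_of R (\<lambda>i. \<zero>)"
  by (simp add: gr_def gr_of_def Let_def nn_coset_zero)

lemma gr_of_eq_zero_iff: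
  assumes "p \<in> U"
  shows "gr_of R p = \<zero>\<^bsub>gr R\<^esub> \<longleftrightarrow> (\<forall>i. p i \<in> nn (Suc i))"
proof -
  have "(\<lambda>i. \<zero>) \<in> U" by (rule graded_repsI) simp_all
  then show ?thesis
    using assms by (simp add: gr_zero gr_of_eq_iff minus_eq)
qed

lemma gr_one: "\<one>\<^bsub>gr R\<^esub> = gr_of R (homogeneous R 0 \<one>)"
  by (simp add: gr_def gr_of_def homogeneous_def Let_def nn_coset_zero fun_eq_iff)

lemma gr_add:
  assumes "p \<in> U" "q \<in> U"
  shows "gr_of R p \<oplus>\<^bsub>gr R\<^esub> gr_of R q = gr_of R (\<lambda>i. p i \<oplus> q i)"
proof
  fix i
  interpret N: ideal "nn (Suc i)" R by (rule nn_ideal)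
  show "(gr_of R p \<oplus>\<^bsub>gr R\<^esub> gr_of R q) i = gr_of R (\<lambda>i. p i \<oplus> q i) i"
    using assms by (simp add: gr_def gr_of_def Let_def N.a_rcos_sum)
qed

lemma gr_mult:
  assumes "p \<in> U" "q \<in> U"
  shows "gr_of R p \<otimes>\<^bsub>gr R\<^esub> gr_of R q = gr_of R (\<lambda>n. \<Oplus>i\<in>{..n}. p i \<otimes> q (n - i))"
proof
  fix n
  interpret N: ideal "nn (Suc n)" R by (rule nn_ideal)
  interpret Q: ring "R Quot nn (Suc n)" by (rule N.quotient_is_ring)
  interpret \<pi>: ring_hom_ring R "R Quot nn (Suc n)" "(+>) (nn (Suc n))"
    by (rule N.rcos_ring_hom_ring)
  have eq: "rcoset_mult R (nn (Suc n)) (nn (Suc i) +> p i) (nn (Suc (n - i)) +> q (n - i)) =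
      nn (Suc n) +> (p i \<otimes> q (n - i))" if "i \<le> n" for i
    using rcoset_mult_homogeneous[of "p i" i "q (n - i)" "n - i"] assms that
    by simp
  have "(gr_of R p \<otimes>\<^bsub>gr R\<^esub> gr_of R q) n = (\<Oplus>\<^bsub>R Quot nn (Suc n)\<^esub> i \<in> {..n}.
      rcoset_mult R (nn (Suc n)) (nn (Suc i) +> p i) (nn (Suc (n - i)) +> q (n - i)))"
    by (simp add: gr_def gr_of_def Let_def)
  also have "\<dots> = (\<Oplus>\<^bsub>R Quot nn (Suc n)\<^esub> i \<in> {..n}. nn (Suc n) +> (p i \<otimes> q (n - i)))"
    using assms by (intro Q.finsum_cong') (auto simp: eq intro!: \<pi>.hom_closed)
  also have "\<dots> = gr_of R (\<lambda>n. \<Oplus>i\<in>{..n}. p i \<otimes> q (n - i)) n"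
    using assms unfolding gr_of_def by (subst \<pi>.hom_finsum) (simp_all only: o_def, auto)
  finally show "(gr_of R p \<otimes>\<^bsub>gr R\<^esub> gr_of R q) n =
      gr_of R (\<lambda>n. \<Oplus>i\<in>{..n}. p i \<otimes> q (n - i)) n" .
qed

text \<open>Every element has a polynomial representative, and sums and products are represented by
  those of the polynomial ring \<open>UP R\<close>; the ring laws are therefore inherited from
  \<open>UP R\<close>.\<close>

theorem gr_ring: "ring (gr R)"
proof -
  let ?P = "UP R"
  interpret P: UP_ring R ?P by (simp add: UP_ring_def ring_axioms)
  interpret P: ring ?P by (rule P.UP_ring)
  have [simp]: "p \<in> carrier ?P" if "p \<in> U" for p using that by (simp add: UP_def)
  have add: "gr_of R p \<oplus>\<^bsub>gr R\<^esub> gr_of R q = gr_of R (p \<oplus>\<^bsub>?P\<^esub> q)" "p \<oplus>\<^bsub>?P\<^esub> q \<in> U"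
    if "p \<in> U" "q \<in> U" for p q
    using that by (simp_all add: gr_add UP_def)
  have mult: "gr_of R p \<otimes>\<^bsub>gr R\<^esub> gr_of R q = gr_of R (p \<otimes>\<^bsub>?P\<^esub> q)" "p \<otimes>\<^bsub>?P\<^esub> q \<in> U"
    if "p \<in> U" "q \<in> U" for p q
    using that by (simp_all add: gr_mult UP_def)
  have one: "\<one>\<^bsub>gr R\<^esub> = gr_of R \<one>\<^bsub>?P\<^esub>" "\<one>\<^bsub>?P\<^esub> \<in> U"
    using homogeneous_mem[of \<one> 0] by (simp_all add: gr_one homogeneous_def UP_def)
  have zero: "\<zero>\<^bsub>gr R\<^esub> = gr_of R \<zero>\<^bsub>?P\<^esub>" "\<zero>\<^bsub>?P\<^esub> \<in> U"
    by (simp_all add: gr_zero UP_def graded_repsI)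
  show ?thesis
  proof (rule ringI)
    show "abelian_group (gr R)"
    proof (rule abelian_groupI)
      fix u v w assume u: "u \<in> carrier (gr R)" and v: "v \<in> carrier (gr R)"
      obtain p where p: "p \<in> U" "u = gr_of R p" using u by (rule gr_rep)
      obtain q where q: "q \<in> U" "v = gr_of R q" using v by (rule gr_rep)
      show "u \<oplus>\<^bsub>gr R\<^esub> v \<in> carrier (gr R)" "u \<oplus>\<^bsub>gr R\<^esub> v = v \<oplus>\<^bsub>gr R\<^esub> u"
        using p q by (simp_all add: add P.a_comm)
      assume w: "w \<in> carrier (gr R)"
      obtain r where r: "r \<in> U" "w = gr_of R r" using w by (rule gr_rep)
      show "u \<oplus>\<^bsub>gr R\<^esub> v \<oplus>\<^bsub>gr R\<^esub> w = u \<oplus>\<^bsub>gr R\<^esub> (v \<oplus>\<^bsub>gr R\<^esub> w)"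
        using p q r by (simp add: add P.a_assoc)
    next
      fix u assume u: "u \<in> carrier (gr R)"
      obtain p where p: "p \<in> U" "u = gr_of R p" using u by (rule gr_rep)
      show "\<zero>\<^bsub>gr R\<^esub> \<oplus>\<^bsub>gr R\<^esub> u = u" using p by (simp add: add zero)
      have z: "(\<lambda>i. \<zero>) \<in> U" using zero(2) by (simp add: UP_def)
      have "gr_of R (\<lambda>i. \<zero> \<ominus> p i) \<oplus>\<^bsub>gr R\<^esub> u = gr_of R (\<lambda>i. (\<zero> \<ominus> p i) \<oplus> p i)"
        unfolding p(2) by (rule gr_add[OF graded_reps_minus[OF z p(1)] p(1)])
      also have "\<dots> = \<zero>\<^bsub>gr R\<^esub>"
        using p(1) by (simp add: gr_zero minus_eq l_neg)
      finally show "\<exists>v\<in>carrier (gr R). v \<oplus>\<^bsub>gr R\<^esub> u = \<zero>\<^bsub>gr R\<^esub>"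
        using gr_of_carrier[OF graded_reps_minus[OF z p(1)]] by blast
    qed (simp add: zero)
    show "Group.monoid (gr R)"
    proof (rule monoidI)
      fix u v w assume u: "u \<in> carrier (gr R)" and v: "v \<in> carrier (gr R)"
      obtain p where p: "p \<in> U" "u = gr_of R p" using u by (rule gr_rep)
      obtain q where q: "q \<in> U" "v = gr_of R q" using v by (rule gr_rep)
      show "u \<otimes>\<^bsub>gr R\<^esub> v \<in> carrier (gr R)"
        using p q by (simp add: mult)
      assume w: "w \<in> carrier (gr R)"
      obtain r where r: "r \<in> U" "w = gr_of R r" using w by (rule gr_rep)
      show "u \<otimes>\<^bsub>gr R\<^esub> v \<otimes>\<^bsub>gr R\<^esub> w = u \<otimes>\<^bsub>gr R\<^esub> (v \<otimes>\<^bsub>gr R\<^esub> w)"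
        using p q r by (simp add: mult P.m_assoc)
    next
      fix u assume u: "u \<in> carrier (gr R)"
      obtain p where p: "p \<in> U" "u = gr_of R p" using u by (rule gr_rep)
      show "\<one>\<^bsub>gr R\<^esub> \<otimes>\<^bsub>gr R\<^esub> u = u" "u \<otimes>\<^bsub>gr R\<^esub> \<one>\<^bsub>gr R\<^esub> = u" using p by (simp_all add: mult one)
    qed (simp add: one)
  next
    fix u v w assume u: "u \<in> carrier (gr R)" and v: "v \<in> carrier (gr R)" and w: "w \<in> carrier (gr R)"
    obtain p where p: "p \<in> U" "u = gr_of R p" using u by (rule gr_rep)
    obtain q where q: "q \<in> U" "v = gr_of R q" using v by (rule gr_rep)
    obtain r where r: "r \<in> U" "w = gr_of R r" using w by (rule gr_rep)
    show "(u \<oplus>\<^bsub>gr R\<^esub> v) \<otimes>\<^bsub>gr R\<^esub> w = u \<otimes>\<^bsub>gr R\<^esub> w \<oplus>\<^bsub>gr R\<^esub> v \<otimes>\<^bsub>gr R\<^esub> w"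
      "w \<otimes>\<^bsub>gr R\<^esub> (u \<oplus>\<^bsub>gr R\<^esub> v) = w \<otimes>\<^bsub>gr R\<^esub> u \<oplus>\<^bsub>gr R\<^esub> w \<otimes>\<^bsub>gr R\<^esub> v"
      using p q r by (simp_all add: add mult P.l_distr P.r_distr)
  qed
qed

lemma gr_minus:
  assumes "p \<in> U" "q \<in> U"
  shows "gr_of R p \<ominus>\<^bsub>gr R\<^esub> gr_of R q = gr_of R (\<lambda>i. p i \<ominus> q i)"
proof -
  interpret G: ring "gr R" by (rule gr_ring)
  have "(\<lambda>i. p i \<ominus> q i \<oplus> q i) = p"
    using assms by (auto simp: minus_eq a_assoc l_neg)
  then have "gr_of R (\<lambda>i. p i \<ominus> q i) \<oplus>\<^bsub>gr R\<^esub> gr_of R q = gr_of R p"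
    using gr_add[OF graded_reps_minus[OF assms] assms(2)] by simp
  then have "gr_of R p \<ominus>\<^bsub>gr R\<^esub> gr_of R q =
      gr_of R (\<lambda>i. p i \<ominus> q i) \<oplus>\<^bsub>gr R\<^esub> gr_of R q \<ominus>\<^bsub>gr R\<^esub> gr_of R q"
    by simp
  then show ?thesis
    using gr_of_carrier[OF graded_reps_minus[OF assms]] gr_of_carrier[OF assms(2)]
    by (simp add: G.minus_eq G.a_assoc G.r_neg)
qed

lemma gr_mult_homogeneous_left:
  assumes "c \<in> carrier R" "p \<in> U"
  shows "gr_of R (homogeneous R 0 c) \<otimes>\<^bsub>gr R\<^esub> gr_of R p = gr_of R (\<lambda>i. c \<otimes> p i)"
proof -
  have "(\<Oplus>i\<in>{..n}. homogeneous R 0 c i \<otimes> p (n - i)) = c \<otimes> p n" for n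
  proof -
    have "(\<Oplus>i\<in>{..n}. homogeneous R 0 c i \<otimes> p (n - i)) =
        (\<Oplus>i\<in>{..n}. if 0 = i then c \<otimes> p (n - i) else \<zero>)"
      using assms by (intro finsum_cong') (auto simp: homogeneous_def)
    also have "\<dots> = c \<otimes> p n"
      using assms finsum_singleton[of 0 "{..n}" "\<lambda>i. c \<otimes> p (n - i)"] by simp
    finally show ?thesis .
  qed
  then show ?thesis
    using assms by (simp add: gr_mult)
qed

lemma gr_mult_homogeneous_right:
  assumes "c \<in> carrier R" "p \<in> U"
  shows "gr_of R p \<otimes>\<^bsub>gr R\<^esub> gr_of R (homogeneous R 0 c) = gr_of R (\<lambda>i. p i \<otimes> c)"
proof -
  have "(\<Oplus>i\<in>{..n}. p i \<otimes> homogeneous R 0 c (n - i)) = p n \<otimes> c" for n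
  proof -
    have "(\<Oplus>i\<in>{..n}. p i \<otimes> homogeneous R 0 c (n - i)) =
        (\<Oplus>i\<in>{..n}. if n = i then p i \<otimes> c else \<zero>)"
      using assms by (intro finsum_cong') (auto simp: homogeneous_def)
    also have "\<dots> = p n \<otimes> c"
      using assms finsum_singleton[of n "{..n}" "\<lambda>i. p i \<otimes> c"] by simp
    finally show ?thesis .
  qed
  then show ?thesis
    using assms by (simp add: gr_mult)
qed

lemma graded_reps_mult_left [simp]:
  assumes "c \<in> carrier R" "p \<in> U"
  shows "(\<lambda>i. c \<otimes> p i) \<in> U"
proof -
  obtain n where "\<And>i. i > n \<Longrightarrow> p i = \<zero>"
    using assms(2) by (rule graded_reps_bound) blast
  then show ?thesis using assms by (intro graded_repsI[of _ n]) simp_all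
qed

lemma graded_reps_mult_right [simp]:
  assumes "c \<in> carrier R" "p \<in> U"
  shows "(\<lambda>i. p i \<otimes> c) \<in> U"
proof -
  obtain n where "\<And>i. i > n \<Longrightarrow> p i = \<zero>"
    using assms(2) by (rule graded_reps_bound) blast
  then show ?thesis using assms by (intro graded_repsI[of _ n]) simp_all
qed

lemma C_bar_eq: "C_bar R = (\<lambda>c. gr_of R (homogeneous R 0 c)) ` C_prime R"
proof -
  interpret N: ideal "prime_radical R" R by (rule prime_radical_ideal)
  have *: "gr_degree_zero R (prime_radical R +> c) = gr_of R (homogeneous R 0 c)" for c
    by (simp add: gr_degree_zero_def gr_of_def homogeneous_def nn_coset_zero nn_one fun_eq_iff)
  have "regular_elements (R Quot prime_radical R) = (\<lambda>c. prime_radical R +> c) ` C_prime R"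
    by (auto simp: C_prime_def regular_elements_def FactRing_def A_RCOSETS_def' a_r_coset_def')
  then show ?thesis
    by (simp add: C_bar_def image_image *)
qed

lemma submonoid_C_prime: "submonoid (C_prime R) R"
proof
  show "C_prime R \<subseteq> carrier R" using C_primeD(1) by blast
  show "\<one> \<in> C_prime R" by (simp add: C_prime_iff)
  fix c d assume c: "c \<in> C_prime R" and d: "d \<in> C_prime R"
  note [simp] = C_primeD(1)[OF c] C_primeD(1)[OF d]
  have cd1: "a \<in> prime_radical R" if "a \<in> carrier R" "(c \<otimes> d) \<otimes> a \<in> prime_radical R" for a
    using C_primeD(2)[OF c, of "d \<otimes> a"] C_primeD(2)[OF d, of a] that by (simp add: m_assoc)
  have cd2: "a \<in> prime_radical R" if "a \<in> carrier R" "a \<otimes> (c \<otimes> d) \<in> prime_radical R" for a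
    using C_primeD(3)[OF d, of "a \<otimes> c"] C_primeD(3)[OF c, of a] that by (simp add: m_assoc)
  show "c \<otimes> d \<in> C_prime R"
    unfolding C_prime_iff by (intro conjI ballI impI; (elim cd1 cd2)?) simp_all
qed

lemma submonoid_C_bar: "submonoid (C_bar R) (gr R)"
proof
  show "C_bar R \<subseteq> carrier (gr R)"
    using C_primeD(1) by (auto simp: C_bar_eq)
  show "\<one>\<^bsub>gr R\<^esub> \<in> C_bar R"
    using submonoid.one_closed[OF submonoid_C_prime] by (auto simp: C_bar_eq gr_one)
  fix u v assume "u \<in> C_bar R" "v \<in> C_bar R"
  then obtain c d where c: "c \<in> C_prime R" "u = gr_of R (homogeneous R 0 c)"
    and d: "d \<in> C_prime R" "v = gr_of R (homogeneous R 0 d)"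
    by (auto simp: C_bar_eq)
  note [simp] = C_primeD(1)[OF c(1)] C_primeD(1)[OF d(1)]
  have "u \<otimes>\<^bsub>gr R\<^esub> v = gr_of R (\<lambda>i. c \<otimes> homogeneous R 0 d i)"
    unfolding c(2) d(2) by (rule gr_mult_homogeneous_left) simp_all
  also have "(\<lambda>i. c \<otimes> homogeneous R 0 d i) = homogeneous R 0 (c \<otimes> d)"
    by (auto simp: homogeneous_def)
  finally show "u \<otimes>\<^bsub>gr R\<^esub> v \<in> C_bar R"
    using submonoid.m_closed[OF submonoid_C_prime c(1) d(1)] by (auto simp: C_bar_eq)
qed

end

section \<open>The graded ring of a left Artinian ring\<close>

context left_artinian_ring
begin

text \<open>The preimage in the \<open>i\<close>-th power of the radical of the
  degree-\<open>i\<close> components of those elements of \<open>L\<close> that vanish in lower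
  degrees. Taking coefficients in \<open>R\<close> instead of cosets yields left ideals of
  \<open>R\<close>, to which its chain condition applies.\<close>

definition leading_ideal :: "(nat \<Rightarrow> 'a set) set \<Rightarrow> nat \<Rightarrow> 'a set" where
  "leading_ideal L i = {p i | p. p \<in> U \<and> gr_of R p \<in> L \<and> (\<forall>j<i. p j = \<zero>)}"

lemma leading_idealI:
  "p \<in> U \<Longrightarrow> gr_of R p \<in> L \<Longrightarrow> (\<And>j. j < i \<Longrightarrow> p j = \<zero>) \<Longrightarrow> p i \<in> leading_ideal L i"
  unfolding leading_ideal_def by blast

lemma leading_idealE:
  assumes "x \<in> leading_ideal L i"
  obtains p where "p \<in> U" "gr_of R p \<in> L" "\<And>j. j < i \<Longrightarrow> p j = \<zero>" "p i = x"
  using assms unfolding leading_ideal_def by blast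

lemma left_ideal_leading_ideal:
  assumes "left_ideal L (gr R)"
  shows "left_ideal (leading_ideal L i) R"
proof -
  interpret G: ring "gr R" by (rule gr_ring)
  interpret L: left_ideal L "gr R" by fact
  show ?thesis
  proof (rule left_idealI)
    show "leading_ideal L i \<subseteq> carrier R"
      by (auto simp: leading_ideal_def)
    have "(\<lambda>i. \<zero>) \<in> U" by (rule graded_repsI) simp_all
    then show "\<zero> \<in> leading_ideal L i"
      using leading_idealI[of "\<lambda>i. \<zero>" L i] L.zero_closed by (simp add: gr_zero)
  next
    fix x y assume x: "x \<in> leading_ideal L i" and y: "y \<in> leading_ideal L i"
    obtain p where p: "p \<in> U" "gr_of R p \<in> L" "\<And>j. j < i \<Longrightarrow> p j = \<zero>" "p i = x"
      using x by (rule leading_idealE) blast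
    obtain q where q: "q \<in> U" "gr_of R q \<in> L" "\<And>j. j < i \<Longrightarrow> q j = \<zero>" "q i = y"
      using y by (rule leading_idealE) blast
    have "gr_of R (\<lambda>i. p i \<oplus> q i) \<in> L"
      using p(1,2) q(1,2) by (simp flip: gr_add)
    then show "x \<oplus> y \<in> leading_ideal L i"
      using leading_idealI[of "\<lambda>i. p i \<oplus> q i" L i] p q by simp
  next
    fix x a assume x: "x \<in> leading_ideal L i" and a: "a \<in> carrier R"
    obtain p where p: "p \<in> U" "gr_of R p \<in> L" "\<And>j. j < i \<Longrightarrow> p j = \<zero>" "p i = x"
      using x by (rule leading_idealE) blast
    have "gr_of R (homogeneous R 0 a) \<otimes>\<^bsub>gr R\<^esub> gr_of R p \<in> L"
      using L.l_closed[OF p(2)] homogeneous_mem[of a 0] a by simp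
    then have "gr_of R (\<lambda>i. a \<otimes> p i) \<in> L"
      using gr_mult_homogeneous_left[OF a p(1)] by simp
    then show "a \<otimes> x \<in> leading_ideal L i"
      using leading_idealI[of "\<lambda>i. a \<otimes> p i" L i] p a by simp
  qed
qed

text \<open>If \<open>p\<close> represents an element of \<open>L'\<close> and starts in degree
  \<open>i\<close>, some \<open>q\<close> representing an element of \<open>L\<close> has the same
  coefficient there, and \<open>p \<ominus> q\<close> starts in degree \<open>i + 1\<close>. The
  difference stays in \<open>L'\<close> as \<open>L \<subseteq> L'\<close>. In degree
  \<open>k\<close> nothing is left.\<close>

lemma leading_ideal_determines:
  assumes L: "left_ideal L (gr R)" and L': "left_ideal L' (gr R)" and sub: "L \<subseteq> L'"
    and eq: "\<And>i. i < k \<Longrightarrow> leading_ideal L' i \<subseteq> leading_ideal L i" and k: "nn k = {\<zero>}"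
  shows "L = L'"
proof -
  interpret G: ring "gr R" by (rule gr_ring)
  interpret L: left_ideal L "gr R" by fact
  interpret L': left_ideal L' "gr R" by fact
  have main: "i \<le> k \<Longrightarrow> p \<in> U \<Longrightarrow> gr_of R p \<in> L' \<Longrightarrow> (\<And>j. j < i \<Longrightarrow> p j = \<zero>) \<Longrightarrow> gr_of R p \<in> L" for i p
  proof (induction "k - i" arbitrary: i p)
    case 0
    have "p j = \<zero>" for j
    proof (cases "j < i")
      case True then show ?thesis by (rule 0(5))
    next
      case False
      then show ?thesis
        using k nn_antimono[of k j] graded_repsD(1)[OF 0(3), of j] 0(1,2) by auto
    qed
    then have "p = (\<lambda>i. \<zero>)" by (simp add: fun_eq_iff)
    then show ?case using L.zero_closed by (simp add: gr_zero)
  next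
    case (Suc m)
    then have "i < k" by simp
    have "p i \<in> leading_ideal L' i"
      by (rule leading_idealI[OF Suc(4,5,6)])
    then have "p i \<in> leading_ideal L i"
      using eq[OF \<open>i < k\<close>] by blast
    then obtain q where q: "q \<in> U" "gr_of R q \<in> L" "\<And>j. j < i \<Longrightarrow> q j = \<zero>" "q i = p i"
      by (rule leading_idealE) blast
    have "gr_of R p \<ominus>\<^bsub>gr R\<^esub> gr_of R q \<in> L'"
      using Suc(5) q(2) sub by (simp add: G.minus_eq subset_eq)
    then have "gr_of R (\<lambda>i. p i \<ominus> q i) \<in> L'"
      using Suc(4) q(1) by (simp add: gr_minus)
    moreover have "p j \<ominus> q j = \<zero>" if "j < Suc i" for j
    proof (cases "j = i")
      case True
      then show ?thesis using q(4) Suc(4) by (simp add: minus_eq r_neg)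
    next
      case False
      then have "j < i" using that by simp
      then show ?thesis using q(3) Suc(6) by (simp add: minus_eq)
    qed
    ultimately have "gr_of R (\<lambda>i. p i \<ominus> q i) \<in> L"
      using Suc(1)[of "Suc i" "\<lambda>i. p i \<ominus> q i"] Suc(2) \<open>i < k\<close> Suc(4) q(1) by simp
    then have "(gr_of R p \<ominus>\<^bsub>gr R\<^esub> gr_of R q) \<oplus>\<^bsub>gr R\<^esub> gr_of R q \<in> L"
      using q Suc(4) by (simp add: gr_minus)
    then show ?case
      using q(1) Suc(4) by (simp add: G.minus_eq G.a_assoc G.l_neg)
  qed
  have "u \<in> L" if u: "u \<in> L'" for u
  proof -
    obtain p where "p \<in> U" "u = gr_of R p"
      using L'.a_Hcarr[OF u] by (rule gr_rep)
    then show ?thesis using main[of 0 p] u by simp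
  qed
  then show ?thesis using sub by blast
qed

theorem left_artinian_gr: "left_artinian_ring (gr R)"
proof -
  interpret G: ring "gr R" by (rule gr_ring)
  obtain k where k: "nn k = {\<zero>}" using nilpotent_prime_radical by blast
  show ?thesis
  proof
    fix J :: "nat \<Rightarrow> (nat \<Rightarrow> 'a set) set"
    assume J: "\<And>i. left_ideal (J i) (gr R)" "\<And>i. J (Suc i) \<subseteq> J i"
    have "\<exists>m. \<forall>l\<ge>m. leading_ideal (J l) i = leading_ideal (J m) i" for i
    proof (rule descending_chain)
      show "leading_ideal (J (Suc l)) i \<subseteq> leading_ideal (J l) i" for l
        using J(2)[of l] unfolding leading_ideal_def by blast
    qed (rule left_ideal_leading_ideal[OF J(1)])
    then obtain m where m: "\<And>i l. l \<ge> m i \<Longrightarrow> leading_ideal (J l) i = leading_ideal (J (m i)) i"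
      by metis
    \<comment> \<open>Only the degrees below \<open>k\<close> matter, so finitely many stopping
      indices have a maximum; the inserted \<open>0\<close> covers \<open>k = 0\<close>.\<close>
    define M where "M = Max (insert 0 (m ` {..<k}))"
    have M: "m i \<le> M" if "i < k" for i
      unfolding M_def by (rule Max_ge) (use that in auto)
    have "J l = J M" if "l \<ge> M" for l
    proof (rule leading_ideal_determines[OF J(1) J(1) _ _ k])
      show "J l \<subseteq> J M" using antimono_chain[of J, OF J(2) that] .
      fix i assume "i < k"
      then show "leading_ideal (J M) i \<subseteq> leading_ideal (J l) i"
        using m[of i M] m[of i l] M[of i] that by simp
    qed
    then show "\<exists>m. \<forall>i\<ge>m. J i = J m" by blast
  qed
qed

end

section \<open>Graded rings and localization\<close>

text \<open>Any representative of a coset will do, because \<open>f\<close> maps powers of the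
  radical into the same powers in \<open>B\<close>. The chosen sequence need not have finite
  support; only the cosets of its images count.\<close>

definition gr_map :: "('c, 'd) ring_scheme \<Rightarrow> ('a \<Rightarrow> 'c) \<Rightarrow> (nat \<Rightarrow> 'a set) \<Rightarrow> (nat \<Rightarrow> 'c set)" where
  "gr_map B f u = gr_of B (\<lambda>i. f (SOME x. x \<in> u i))"

context artinian_quotient_ring
begin

lemma f_nn: "x \<in> R.nn i \<Longrightarrow> f x \<in> S.nn i"
  using f_in_extension[of "R.nn i" x] extension_prime_radical_pow[of i] by (simp add: subset_eq)

lemma f_graded_reps [simp]:
  assumes "p \<in> R.U"
  shows "(\<lambda>i. f (p i)) \<in> S.U"
proof -
  obtain n where "\<And>i. i > n \<Longrightarrow> p i = \<zero>"
    using assms by (rule R.graded_reps_bound) blast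
  then show ?thesis using assms by (intro S.graded_repsI[of _ n]) (simp_all add: f_nn)
qed

lemma gr_map_gr_of:
  assumes p: "p \<in> R.U"
  shows "gr_map B f (gr_of A p) = gr_of B (\<lambda>i. f (p i))"
proof
  fix i
  interpret N: ideal "R.nn (Suc i)" A by (rule R.nn_ideal)
  define x where "x = (SOME x. x \<in> gr_of A p i)"
  have pc: "p i \<in> carrier A" using p by simp
  have "\<exists>x. x \<in> gr_of A p i"
    using N.a_rcos_self[OF pc] by (auto simp: gr_of_def)
  then have "x \<in> gr_of A p i"
    unfolding x_def by (rule someI_ex)
  then obtain n where n: "n \<in> R.nn (Suc i)" "x = n \<oplus> p i"
    by (auto simp: gr_of_def a_r_coset_def')
  have nc: "n \<in> carrier A" using n by simp
  have "f x \<ominus>\<^bsub>B\<^esub> f (p i) = f n"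
    unfolding n(2) using nc pc by (simp add: S.minus_eq S.a_assoc S.r_neg)
  then have "f x \<ominus>\<^bsub>B\<^esub> f (p i) \<in> S.nn (Suc i)"
    using f_nn[OF n(1)] by simp
  then show "gr_map B f (gr_of A p) i = gr_of B (\<lambda>i. f (p i)) i"
    using nc pc n(2) by (simp add: gr_map_def gr_of_def[of B] S.nn_coset_eq_iff flip: x_def)
qed

lemma gr_map_hom: "ring_hom_ring (gr A) (gr B) (gr_map B f)"
proof (rule ring_hom_ringI[OF R.gr_ring S.gr_ring])
  fix u assume u: "u \<in> carrier (gr A)"
  obtain p where p: "p \<in> R.U" "u = gr_of A p" using u by (rule R.gr_rep)
  show "gr_map B f u \<in> carrier (gr B)"
    using p by (simp add: gr_map_gr_of)
  fix v assume v: "v \<in> carrier (gr A)"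
  obtain q where q: "q \<in> R.U" "v = gr_of A q" using v by (rule R.gr_rep)
  show "gr_map B f (u \<oplus>\<^bsub>gr A\<^esub> v) = gr_map B f u \<oplus>\<^bsub>gr B\<^esub> gr_map B f v"
    using p q by (simp add: gr_map_gr_of R.gr_add S.gr_add)
  have "f (\<Oplus>i\<in>{..n}. p i \<otimes> q (n - i)) = (\<Oplus>\<^bsub>B\<^esub>i\<in>{..n}. f (p i) \<otimes>\<^bsub>B\<^esub> f (q (n - i)))" for n
  proof -
    have "f (\<Oplus>i\<in>{..n}. p i \<otimes> q (n - i)) = (\<Oplus>\<^bsub>B\<^esub>i\<in>{..n}. f (p i \<otimes> q (n - i)))"
      using p q by (subst hom_finsum) (auto simp: o_def)
    then show ?thesis using p q by simp
  qed
  then show "gr_map B f (u \<otimes>\<^bsub>gr A\<^esub> v) = gr_map B f u \<otimes>\<^bsub>gr B\<^esub> gr_map B f v"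
    using p q by (simp add: gr_map_gr_of R.gr_mult S.gr_mult)
next
  have "(\<lambda>i. f (homogeneous A 0 \<one> i)) = homogeneous B 0 \<one>\<^bsub>B\<^esub>"
    by (auto simp: homogeneous_def)
  then show "gr_map B f \<one>\<^bsub>gr A\<^esub> = \<one>\<^bsub>gr B\<^esub>"
    by (simp add: R.gr_one S.gr_one gr_map_gr_of)
qed

lemma f_homogeneous: "(\<lambda>i. f (homogeneous A n x i)) = homogeneous B n (f x)"
  by (auto simp: homogeneous_def)

text \<open>Beyond the support bound the numerators are set to \<open>\<zero>\<close>, so that they
  form a finitely supported sequence again.\<close>

lemma common_denominator_all:
  assumes "\<And>i. i > (n::nat) \<Longrightarrow> q i = \<zero>\<^bsub>B\<^esub>" "\<And>i. left_ideal (I i) A" "\<And>i. q i \<in> extension (I i)"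
  obtains s x where "s \<in> S" "\<And>i. x i \<in> I i" "\<And>i. f s \<otimes>\<^bsub>B\<^esub> q i = f (x i)" "\<And>i. i > n \<Longrightarrow> x i = \<zero>"
proof -
  obtain s where s: "s \<in> S" "\<And>i. i \<le> n \<Longrightarrow> \<exists>x \<in> I i. f s \<otimes>\<^bsub>B\<^esub> q i = f x"
    using common_denominator[of "{..n}" I q] assms by auto
  have "\<exists>x \<in> I i. f s \<otimes>\<^bsub>B\<^esub> q i = f x \<and> (i > n \<longrightarrow> x = \<zero>)" for i
  proof (cases "i \<le> n")
    case True then show ?thesis using s(2)[of i] by auto
  next
    case False
    have "\<zero> \<in> I i" using assms(2)[of i] by (simp add: left_ideal_def additive_subgroup.zero_closed)
    then show ?thesis
      using False assms(1)[of i] s(1) by (intro bexI[of _ \<zero>]) simp_all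
  qed
  then obtain x where "\<And>i. x i \<in> I i \<and> f s \<otimes>\<^bsub>B\<^esub> q i = f (x i) \<and> (i > n \<longrightarrow> x i = \<zero>)"
    by metis
  then show thesis using s(1) by (intro that[of s x]) auto
qed

text \<open>Fractions and kernel both rest on the fact that the powers of the radical of
  \<open>A\<close> extend to those of \<open>B\<close>. A coefficient of degree \<open>i\<close>
  gets a numerator of degree \<open>i\<close>; and if each \<open>f (p i)\<close> has degree
  \<open>i + 1\<close>, a common \<open>s\<close> puts each \<open>s p i\<close> into degree
  \<open>i + 1\<close>, so the element is torsion.\<close>

theorem gr_localization: "left_localization (gr A) (gr B) (gr_map B f) (C_bar A)"
proof (intro left_localization.intro left_localization_axioms.intro gr_map_hom R.submonoid_C_bar)
  fix s assume "s \<in> C_bar A"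
  then obtain c where c: "c \<in> S" "s = gr_of A (homogeneous A 0 c)"
    by (auto simp: R.C_bar_eq C_prime_eq S_regular)
  define w where "w = inv\<^bsub>B\<^esub> f c"
  have w: "w \<in> carrier B" "f c \<otimes>\<^bsub>B\<^esub> w = \<one>\<^bsub>B\<^esub>" "w \<otimes>\<^bsub>B\<^esub> f c = \<one>\<^bsub>B\<^esub>" "f c \<in> carrier B"
    using c(1) by (simp_all add: w_def)
  have eq: "gr_map B f s = gr_of B (homogeneous B 0 (f c))"
    using c by (simp add: gr_map_gr_of f_homogeneous)
  have "gr_of B (homogeneous B 0 x) \<otimes>\<^bsub>gr B\<^esub> gr_of B (homogeneous B 0 y) = \<one>\<^bsub>gr B\<^esub>"
    if "x \<in> carrier B" "y \<in> carrier B" "x \<otimes>\<^bsub>B\<^esub> y = \<one>\<^bsub>B\<^esub>" for x y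
  proof -
    have "(\<lambda>i. x \<otimes>\<^bsub>B\<^esub> homogeneous B 0 y i) = homogeneous B 0 \<one>\<^bsub>B\<^esub>"
      using that by (auto simp: homogeneous_def)
    then show ?thesis
      using S.gr_mult_homogeneous_left[of x "homogeneous B 0 y"] that by (simp add: S.gr_one)
  qed
  then show "gr_map B f s \<in> Units (gr B)"
    unfolding eq Units_def using w
    by (intro CollectI conjI bexI[of _ "gr_of B (homogeneous B 0 w)"]) simp_all
next
  fix u assume u: "u \<in> carrier (gr B)"
  obtain q where q: "q \<in> S.U" "u = gr_of B q" using u by (rule S.gr_rep)
  obtain n where n: "\<And>i. i > n \<Longrightarrow> q i = \<zero>\<^bsub>B\<^esub>"
    using q(1) by (rule S.graded_reps_bound) blast
  obtain s x where s: "s \<in> S" "\<And>i. x i \<in> R.nn i" "\<And>i. f s \<otimes>\<^bsub>B\<^esub> q i = f (x i)"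
      "\<And>i. i > n \<Longrightarrow> x i = \<zero>"
  proof (rule common_denominator_all[OF n])
    show "left_ideal (R.nn i) A" for i by (rule ideal.is_left_ideal[OF R.nn_ideal])
    show "q i \<in> extension (R.nn i)" for i using q(1) by (simp add: extension_prime_radical_pow)
  qed (assumption | blast)+
  have x: "x \<in> R.U" using s(2,4) by (rule R.graded_repsI)
  have "gr_map B f (gr_of A (homogeneous A 0 s)) \<otimes>\<^bsub>gr B\<^esub> u = gr_of B (\<lambda>i. f s \<otimes>\<^bsub>B\<^esub> q i)"
    using s(1) q by (simp add: gr_map_gr_of f_homogeneous S.gr_mult_homogeneous_left)
  also have "\<dots> = gr_map B f (gr_of A x)"
    using x s(3) by (simp add: gr_map_gr_of)
  finally show "\<exists>s\<in>C_bar A. \<exists>a\<in>carrier (gr A). gr_map B f s \<otimes>\<^bsub>gr B\<^esub> u = gr_map B f a"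
    using s(1) x R.gr_of_carrier[OF x] unfolding R.C_bar_eq C_prime_eq S_regular by blast
next
  fix u assume u: "u \<in> carrier (gr A)" "gr_map B f u = \<zero>\<^bsub>gr B\<^esub>"
  obtain p where p: "p \<in> R.U" "u = gr_of A p" using u(1) by (rule R.gr_rep)
  obtain n where n: "\<And>i. i > n \<Longrightarrow> p i = \<zero>"
    using p(1) by (rule R.graded_reps_bound) blast
  have fp: "f (p i) \<in> S.nn (Suc i)" for i
    using u(2) p S.gr_of_eq_zero_iff[OF f_graded_reps[OF p(1)]] by (simp add: gr_map_gr_of)
  obtain s x where s: "s \<in> S" "\<And>i. x i \<in> R.nn (Suc i)" "\<And>i. f s \<otimes>\<^bsub>B\<^esub> f (p i) = f (x i)"
      "\<And>i. i > n \<Longrightarrow> x i = \<zero>"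
  proof (rule common_denominator_all)
    show "left_ideal (R.nn (Suc i)) A" for i by (rule ideal.is_left_ideal[OF R.nn_ideal])
    show "f (p i) \<in> extension (R.nn (Suc i))" for i using fp by (simp add: extension_prime_radical_pow)
    show "f (p i) = \<zero>\<^bsub>B\<^esub>" if "i > n" for i using n[OF that] by simp
  qed (assumption | blast)+
  have "s \<otimes> p i = x i" for i
  proof -
    have "f (s \<otimes> p i \<ominus> x i) = \<zero>\<^bsub>B\<^esub>"
      using s(1,3) R.nn_carrier[OF s(2)] p(1) by (simp add: R.minus_eq S.r_neg)
    then show ?thesis
      using s(1) R.nn_carrier[OF s(2)] p(1) f_eq_zero[of "s \<otimes> p i \<ominus> x i"]
        R.minus_eq_zero_iff[of "s \<otimes> p i" "x i"] by simp
  qed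
  then have "s \<otimes> p i \<in> R.nn (Suc i)" for i
    using s(2) by simp
  moreover have "(\<lambda>i. s \<otimes> p i) \<in> R.U"
    using s(1) p(1) by simp
  ultimately have "gr_of A (homogeneous A 0 s) \<otimes>\<^bsub>gr A\<^esub> u = \<zero>\<^bsub>gr A\<^esub>"
    using p s(1) R.gr_of_eq_zero_iff[of "\<lambda>i. s \<otimes> p i"]
    by (simp add: R.gr_mult_homogeneous_left)
  then show "\<exists>s\<in>C_bar A. s \<otimes>\<^bsub>gr A\<^esub> u = \<zero>\<^bsub>gr A\<^esub>"
    using s(1) unfolding R.C_bar_eq C_prime_eq S_regular by blast
qed

end

section \<open>The quotient by the torsion ideal\<close>

lemma a_kernel_iff: "a \<in> a_kernel R S h \<longleftrightarrow> a \<in> carrier R \<and> h a = \<zero>\<^bsub>S\<^esub>"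
  by (simp add: a_kernel_def kernel_def)

context left_localization
begin

text \<open>Consequently the torsion set is an ideal, and \<open>gr_torsion R\<close> is the kernel
  of each localization map of \<open>gr R\<close> at \<open>C_bar R\<close>.\<close>

lemma torsion_eq_kernel: "{a \<in> carrier A. \<exists>s \<in> S. s \<otimes> a = \<zero>} = a_kernel A B f"
proof -
  have "f a = \<zero>\<^bsub>B\<^esub>" if "a \<in> carrier A" "s \<in> S" "s \<otimes> a = \<zero>" for a s
  proof -
    have "f s \<otimes>\<^bsub>B\<^esub> f a = f s \<otimes>\<^bsub>B\<^esub> \<zero>\<^bsub>B\<^esub>"
      using that by (simp flip: hom_mult)
    then show ?thesis
      using f_cancel[of s "f a" "\<zero>\<^bsub>B\<^esub>"] that by simp
  qed
  then show ?thesis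
    using kernel_torsion a_kernel_iff[of _ A B f] by blast
qed

section \<open>The localization map induced on the quotient by the torsion ideal\<close>

definition quotient_map :: "'a set \<Rightarrow> 'c" where
  "quotient_map X = f (SOME x. x \<in> X)"

lemma quotient_map_coset:
  assumes "a \<in> carrier A"
  shows "quotient_map (a_kernel A B f +> a) = f a"
proof -
  interpret K: ideal "a_kernel A B f" A by (rule kernel_is_ideal)
  define x where "x = (SOME x. x \<in> a_kernel A B f +> a)"
  have "\<exists>x. x \<in> a_kernel A B f +> a"
    using K.a_rcos_self[OF assms] by blast
  then have "x \<in> a_kernel A B f +> a"
    unfolding x_def by (rule someI_ex)
  then obtain n where "n \<in> a_kernel A B f" and x: "x = n \<oplus> a"
    unfolding a_r_coset_def' by blast
  then have n: "n \<in> carrier A" "f n = \<zero>\<^bsub>B\<^esub>"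
    using a_kernel_iff[of n A B f] by blast+
  then show ?thesis
    using assms x by (simp add: quotient_map_def flip: x_def)
qed

lemma quotient_carrierE:
  assumes "X \<in> carrier (A Quot a_kernel A B f)"
  obtains a where "a \<in> carrier A" "X = a_kernel A B f +> a"
  using assms by (auto simp: FactRing_def A_RCOSETS_def' a_r_coset_def')

lemma quotient_localization:
  "left_localization (A Quot a_kernel A B f) B quotient_map ((+>) (a_kernel A B f) ` S)"
proof -
  let ?K = "a_kernel A B f" and ?Q = "A Quot a_kernel A B f"
  interpret K: ideal ?K A by (rule kernel_is_ideal)
  interpret Q: ring ?Q by (rule K.quotient_is_ring)
  interpret \<rho>: ring_hom_ring A ?Q "(+>) ?K" by (rule K.rcos_ring_hom_ring)
  have zero: "?K +> a = \<zero>\<^bsub>?Q\<^esub> \<longleftrightarrow> f a = \<zero>\<^bsub>B\<^esub>" if "a \<in> carrier A" for a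
  proof -
    have "?K +> a = ?K \<longleftrightarrow> a \<in> ?K"
      using that K.a_rcos_const K.rcos_const_imp_mem by blast
    also have "\<dots> \<longleftrightarrow> f a = \<zero>\<^bsub>B\<^esub>" by (simp only: a_kernel_iff that simp_thms)
    finally have "?K +> a = ?K \<longleftrightarrow> f a = \<zero>\<^bsub>B\<^esub>" .
    moreover have zero: "\<zero>\<^bsub>?Q\<^esub> = ?K" by (simp only: FactRing_def ring.simps)
    ultimately show ?thesis by (simp only: zero)
  qed
  show ?thesis
  proof (intro left_localization.intro left_localization_axioms.intro ring_hom_ringI
      Q.ring_axioms S.ring_axioms)
    fix X assume X: "X \<in> carrier ?Q"
    obtain a where a: "a \<in> carrier A" "X = ?K +> a" using X by (rule quotient_carrierE)
    show "quotient_map X \<in> carrier B" using a by (simp add: quotient_map_coset)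
    show "\<exists>s\<in>(+>) ?K ` S. s \<otimes>\<^bsub>?Q\<^esub> X = \<zero>\<^bsub>?Q\<^esub>" if "quotient_map X = \<zero>\<^bsub>B\<^esub>"
    proof -
      have "X = \<zero>\<^bsub>?Q\<^esub>" using that a zero by (simp add: quotient_map_coset)
      then have "\<one>\<^bsub>?Q\<^esub> \<otimes>\<^bsub>?Q\<^esub> X = \<zero>\<^bsub>?Q\<^esub>" by simp
      moreover have "\<one>\<^bsub>?Q\<^esub> \<in> (+>) ?K ` S"
        using imageI[OF S_one, of "(+>) ?K"] by simp
      ultimately show ?thesis by blast
    qed
    fix Y assume Y: "Y \<in> carrier ?Q"
    obtain b where b: "b \<in> carrier A" "Y = ?K +> b" using Y by (rule quotient_carrierE)
    show "quotient_map (X \<otimes>\<^bsub>?Q\<^esub> Y) = quotient_map X \<otimes>\<^bsub>B\<^esub> quotient_map Y"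
      using a b by (simp add: quotient_map_coset flip: \<rho>.hom_mult)
    show "quotient_map (X \<oplus>\<^bsub>?Q\<^esub> Y) = quotient_map X \<oplus>\<^bsub>B\<^esub> quotient_map Y"
      using a b by (simp add: quotient_map_coset flip: \<rho>.hom_add)
  next
    show "quotient_map \<one>\<^bsub>?Q\<^esub> = \<one>\<^bsub>B\<^esub>"
      using quotient_map_coset[OF R.one_closed] by simp
    show "submonoid ((+>) ?K ` S) ?Q"
    proof
      show "(+>) ?K ` S \<subseteq> carrier ?Q" by auto
      show "\<one>\<^bsub>?Q\<^esub> \<in> (+>) ?K ` S" using S_one by (metis \<rho>.hom_one imageI)
      fix X Y assume "X \<in> (+>) ?K ` S" "Y \<in> (+>) ?K ` S"
      then obtain s t where "s \<in> S" "t \<in> S" "X = ?K +> s" "Y = ?K +> t" by blast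
      then show "X \<otimes>\<^bsub>?Q\<^esub> Y \<in> (+>) ?K ` S"
        using S_mult[of s t] by (simp flip: \<rho>.hom_mult)
    qed
  next
    fix X assume "X \<in> (+>) ?K ` S"
    then obtain s where "s \<in> S" "X = ?K +> s" by blast
    then show "quotient_map X \<in> Units B" using f_Units by (simp add: quotient_map_coset)
  next
    fix b assume "b \<in> carrier B"
    then obtain s a where s: "s \<in> S" "a \<in> carrier A" "f s \<otimes>\<^bsub>B\<^esub> b = f a" using fraction_ex by blast
    then have "quotient_map (?K +> s) \<otimes>\<^bsub>B\<^esub> b = quotient_map (?K +> a)"
      by (simp add: quotient_map_coset)
    then show "\<exists>s\<in>(+>) ?K ` S. \<exists>a\<in>carrier ?Q. quotient_map s \<otimes>\<^bsub>B\<^esub> b = quotient_map a"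
      using s(1) \<rho>.hom_closed[OF s(2)] by blast
  qed
qed

lemma quotient_image_regular:
  "(+>) (a_kernel A B f) ` S \<subseteq> regular_elements (A Quot a_kernel A B f)"
proof -
  let ?K = "a_kernel A B f" and ?Q = "A Quot a_kernel A B f"
  interpret K: ideal ?K A by (rule kernel_is_ideal)
  interpret L: left_localization ?Q B quotient_map "(+>) ?K ` S" by (rule quotient_localization)
  show ?thesis
  proof
    fix X assume X: "X \<in> (+>) ?K ` S"
    show "X \<in> regular_elements ?Q"
    proof (rule L.Units_regular[OF L.S_carrier[OF X] L.f_Units[OF X]])
      fix Y assume Y: "Y \<in> carrier ?Q" "quotient_map Y = \<zero>\<^bsub>B\<^esub>"
      obtain a where a: "a \<in> carrier A" "Y = ?K +> a" using Y(1) by (rule quotient_carrierE)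
      have "f a = quotient_map Y" by (simp only: a(2) quotient_map_coset[OF a(1)])
      then have "f a = \<zero>\<^bsub>B\<^esub>" by (simp only: Y(2))
      then have "a \<in> ?K" using a(1) a_kernel_iff[of a A B f] by blast
      then show "Y = \<zero>\<^bsub>?Q\<^esub>"
        by (simp only: a(2) K.a_rcos_const FactRing_def ring.simps)
    qed
  qed
qed

text \<open>\<open>B\<close> inverts only the image of \<open>S\<close> in the quotient. That image
  is an Ore set of regular elements with the chain condition, which gives the Ore condition for all
  regular elements; the chain condition survives the enlargement.\<close>

lemma torsion_quotient_left_quotient_ring:
  assumes "left_artinian_ring B"
  shows "has_left_quotient_ring (A Quot a_kernel A B f)"
    and "left_artinian_ring (left_quotient_ring (A Quot a_kernel A B f))"
proof -
  let ?Q = "A Quot a_kernel A B f" and ?S = "(+>) (a_kernel A B f) ` S"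
  interpret L: left_localization ?Q B quotient_map ?S by (rule quotient_localization)
  have dcc: "saturated_dcc ?Q ?S" using assms L.left_artinian_iff by simp
  have ore: "left_ore_set ?Q ?S"
    using L.left_denominator_set by (simp add: left_denominator_set_def)
  show has: "has_left_quotient_ring ?Q"
    unfolding has_left_quotient_ring_def
    by (rule L.R.left_ore_set_regular_elements[OF ore quotient_image_regular dcc])
  interpret M: left_localization ?Q "left_quotient_ring ?Q"
      "left_frac ?Q (regular_elements ?Q) \<one>\<^bsub>?Q\<^esub>" "regular_elements ?Q"
    by (rule L.R.left_localization_left_quotient_ring[OF has])
  show "left_artinian_ring (left_quotient_ring ?Q)"
    using M.left_artinian_iff saturated_dcc_mono[OF dcc quotient_image_regular] by simp
qed

lemma contraction_extensionE:
  assumes "left_ideal I A" "a \<in> contraction (extension I)"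
  obtains s where "s \<in> S" "s \<otimes> a \<in> I"
proof -
  interpret I: left_ideal I A by fact
  obtain s x where s: "a \<in> carrier A" "s \<in> S" "x \<in> I" "f s \<otimes>\<^bsub>B\<^esub> f a = f x"
    using assms(2) by (auto simp: extension_def contraction_def)
  then obtain t where t: "t \<in> S" "t \<otimes> (s \<otimes> a) = t \<otimes> x"
    using eq_imp_torsion[of "s \<otimes> a" x] by auto
  then have "(t \<otimes> s) \<otimes> a \<in> I"
    using s(1-3) I.l_closed[of x t] by (simp add: R.m_assoc)
  then show thesis using that[of "t \<otimes> s"] s(2) t(1) by simp
qed

end

section \<open>The degree filtration of the graded ring\<close>

context ring
begin

text \<open>The ideal of elements of degree at least \<open>i\<close>, described by a representative
  that vanishes below \<open>i\<close>; \<open>gr_filtration_iff\<close> is the test for an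
  arbitrary representative.\<close>

definition gr_filtration :: "nat \<Rightarrow> (nat \<Rightarrow> 'a set) set" where
  "gr_filtration i = {gr_of R p | p. p \<in> U \<and> (\<forall>j<i. p j = \<zero>)}"

lemma gr_filtrationI: "p \<in> U \<Longrightarrow> (\<And>j. j < i \<Longrightarrow> p j = \<zero>) \<Longrightarrow> gr_of R p \<in> gr_filtration i"
  unfolding gr_filtration_def by blast

lemma gr_filtrationE:
  assumes "u \<in> gr_filtration i"
  obtains p where "p \<in> U" "\<And>j. j < i \<Longrightarrow> p j = \<zero>" "u = gr_of R p"
  using assms unfolding gr_filtration_def by blast

lemma gr_filtration_carrier: "gr_filtration i \<subseteq> carrier (gr R)"
  by (auto simp: gr_filtration_def)

lemma graded_reps_truncate [simp]:
  assumes "p \<in> U"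
  shows "(\<lambda>j. if j < i then \<zero> else p j) \<in> U"
proof -
  obtain n where "\<And>i. i > n \<Longrightarrow> p i = \<zero>"
    using assms by (rule graded_reps_bound) blast
  then show ?thesis using assms by (intro graded_repsI[of _ n]) simp_all
qed

lemma gr_of_truncate:
  assumes "p \<in> U" "\<And>j. j < i \<Longrightarrow> p j \<in> nn (Suc j)"
  shows "gr_of R (\<lambda>j. if j < i then \<zero> else p j) = gr_of R p"
  using assms by (auto simp: gr_of_eq_iff minus_eq r_neg)

lemma gr_filtration_iff:
  assumes "p \<in> U"
  shows "gr_of R p \<in> gr_filtration i \<longleftrightarrow> (\<forall>j<i. p j \<in> nn (Suc j))"
proof
  assume "gr_of R p \<in> gr_filtration i"
  then obtain q where q: "q \<in> U" "\<And>j. j < i \<Longrightarrow> q j = \<zero>" "gr_of R p = gr_of R q"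
    by (rule gr_filtrationE) blast
  show "\<forall>j<i. p j \<in> nn (Suc j)"
  proof (intro allI impI)
    fix j assume "j < i"
    have "p j \<ominus> q j \<in> nn (Suc j)" using q assms by (simp add: gr_of_eq_iff)
    then show "p j \<in> nn (Suc j)" using q(2)[OF \<open>j < i\<close>] assms by (simp add: minus_eq)
  qed
next
  assume "\<forall>j<i. p j \<in> nn (Suc j)"
  then have "gr_of R p = gr_of R (\<lambda>j. if j < i then \<zero> else p j)"
    using gr_of_truncate[OF assms] by simp
  then show "gr_of R p \<in> gr_filtration i"
    using assms by (simp add: gr_filtrationI)
qed

lemma gr_filtration_mult:
  assumes "u \<in> gr_filtration i" "v \<in> gr_filtration j"
  shows "u \<otimes>\<^bsub>gr R\<^esub> v \<in> gr_filtration (i + j)"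
proof -
  obtain p where p: "p \<in> U" "\<And>j. j < i \<Longrightarrow> p j = \<zero>" "u = gr_of R p"
    using assms(1) by (rule gr_filtrationE) blast
  obtain q where q: "q \<in> U" "\<And>i. i < j \<Longrightarrow> q i = \<zero>" "v = gr_of R q"
    using assms(2) by (rule gr_filtrationE) blast
  have "(\<Oplus>l\<in>{..n}. p l \<otimes> q (n - l)) = \<zero>" if "n < i + j" for n
  proof -
    have "p l \<otimes> q (n - l) = \<zero>" if "l \<le> n" for l
    proof (cases "l < i")
      case True then show ?thesis using p(2) q(1) by simp
    next
      case False
      then have "n - l < j" using that \<open>n < i + j\<close> by linarith
      then show ?thesis using q(2) p(1) by simp
    qed
    then have "(\<Oplus>l\<in>{..n}. p l \<otimes> q (n - l)) = (\<Oplus>l\<in>{..n}. \<zero>)"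
      by (intro finsum_cong') auto
    then show ?thesis by (simp add: finsum_zero)
  qed
  then show ?thesis
    using p(1,3) q(1,3) by (simp add: gr_mult gr_filtrationI)
qed

lemma gr_filtration_0: "gr_filtration 0 = carrier (gr R)"
  using gr_filtration_carrier gr_rep gr_filtrationI by (metis less_nat_zero_code subsetI subset_antisym)

lemma gr_filtration_ideal: "ideal (gr_filtration i) (gr R)"
proof -
  interpret G: ring "gr R" by (rule gr_ring)
  have "left_ideal (gr_filtration i) (gr R)"
  proof (rule G.left_idealI[OF gr_filtration_carrier])
    have "(\<lambda>i. \<zero>) \<in> U" by (rule graded_repsI) simp_all
    then show "\<zero>\<^bsub>gr R\<^esub> \<in> gr_filtration i"
      using gr_filtrationI[of "\<lambda>i. \<zero>" i] by (simp add: gr_zero)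
  next
    fix u v assume u: "u \<in> gr_filtration i" and v: "v \<in> gr_filtration i"
    obtain p where p: "p \<in> U" "\<And>j. j < i \<Longrightarrow> p j = \<zero>" "u = gr_of R p"
      using u by (rule gr_filtrationE) blast
    obtain q where q: "q \<in> U" "\<And>j. j < i \<Longrightarrow> q j = \<zero>" "v = gr_of R q"
      using v by (rule gr_filtrationE) blast
    show "u \<oplus>\<^bsub>gr R\<^esub> v \<in> gr_filtration i"
      using p q by (simp add: gr_add gr_filtrationI)
  next
    fix u a assume "u \<in> gr_filtration i" "a \<in> carrier (gr R)"
    then show "a \<otimes>\<^bsub>gr R\<^esub> u \<in> gr_filtration i"
      using gr_filtration_mult[of a 0 u i] by (simp add: gr_filtration_0)
  qed
  then show ?thesis
  proof (rule G.idealI')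
    fix u a assume "u \<in> gr_filtration i" "a \<in> carrier (gr R)"
    then show "u \<otimes>\<^bsub>gr R\<^esub> a \<in> gr_filtration i"
      using gr_filtration_mult[of u i a 0] by (simp add: gr_filtration_0)
  qed
qed

lemma gr_filtration_antimono: "i \<le> j \<Longrightarrow> gr_filtration j \<subseteq> gr_filtration i"
  unfolding gr_filtration_def by force

lemma gr_filtration_zero:
  assumes "nn k = {\<zero>}"
  shows "gr_filtration k = {\<zero>\<^bsub>gr R\<^esub>}"
proof
  show "gr_filtration k \<subseteq> {\<zero>\<^bsub>gr R\<^esub>}"
  proof
    fix u assume "u \<in> gr_filtration k"
    then obtain p where p: "p \<in> U" "\<And>j. j < k \<Longrightarrow> p j = \<zero>" "u = gr_of R p"
      by (rule gr_filtrationE) blast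
    have "p j = \<zero>" for j
    proof (cases "j < k")
      case False
      then show ?thesis using assms nn_antimono[of k j] graded_repsD(1)[OF p(1), of j] by auto
    qed (rule p(2))
    then have "p = (\<lambda>i. \<zero>)" by (simp add: fun_eq_iff)
    then show "u \<in> {\<zero>\<^bsub>gr R\<^esub>}" using p(3) by (simp add: gr_zero)
  qed
  show "{\<zero>\<^bsub>gr R\<^esub>} \<subseteq> gr_filtration k"
    using additive_subgroup.zero_closed[OF ideal.axioms(1)[OF gr_filtration_ideal]] by simp
qed

text \<open>The Ore condition yields a factor \<open>y\<close> of unknown degree. Since
  \<open>t\<close> sits in degree zero, the components of \<open>y t\<close> are those of
  \<open>y\<close> times \<open>t\<close>, and dropping the components of \<open>y\<close> below
  \<open>i\<close> only removes parts that \<open>t\<close> kills.\<close>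

lemma gr_filtration_cancel:
  assumes "y \<in> carrier (gr R)" "t \<in> C_bar R" "y \<otimes>\<^bsub>gr R\<^esub> t \<in> gr_filtration i"
  obtains y' where "y' \<in> gr_filtration i" "y' \<otimes>\<^bsub>gr R\<^esub> t = y \<otimes>\<^bsub>gr R\<^esub> t"
proof -
  obtain q where q: "q \<in> U" "y = gr_of R q" using assms(1) by (rule gr_rep)
  obtain c where c: "c \<in> C_prime R" "t = gr_of R (homogeneous R 0 c)"
    using assms(2) by (auto simp: C_bar_eq)
  have cc: "c \<in> carrier R" by (rule C_primeD(1)[OF c(1)])
  have yt: "y \<otimes>\<^bsub>gr R\<^esub> t = gr_of R (\<lambda>i. q i \<otimes> c)"
    using q c cc by (simp add: gr_mult_homogeneous_right)
  have mem: "(\<lambda>i. q i \<otimes> c) \<in> U" using q(1) cc by simp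
  have qc: "q j \<otimes> c \<in> nn (Suc j)" if "j < i" for j
    using assms(3) gr_filtration_iff[OF mem] that by (simp add: yt)
  let ?q = "\<lambda>j. if j < i then \<zero> else q j"
  have "(\<lambda>j. ?q j \<otimes> c) = (\<lambda>j. if j < i then \<zero> else q j \<otimes> c)"
    using cc by auto
  then have "gr_of R ?q \<otimes>\<^bsub>gr R\<^esub> t = gr_of R (\<lambda>j. if j < i then \<zero> else q j \<otimes> c)"
    using gr_mult_homogeneous_right[OF cc graded_reps_truncate[OF q(1)]] c(2) by simp
  also have "\<dots> = y \<otimes>\<^bsub>gr R\<^esub> t"
    unfolding yt by (rule gr_of_truncate[OF mem qc])
  finally show thesis
    using q(1) by (intro that[of "gr_of R ?q"] gr_filtrationI) simp_all
qed

lemma gr_split_degree_zero: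
  assumes "p \<in> U"
  obtains v where "v \<in> gr_filtration 1" "gr_of R p = gr_of R (homogeneous R 0 (p 0)) \<oplus>\<^bsub>gr R\<^esub> v"
proof (rule that)
  let ?q = "\<lambda>j. if j < 1 then \<zero> else p j"
  have q: "?q \<in> U" by (rule graded_reps_truncate[OF assms])
  show "gr_of R ?q \<in> gr_filtration 1" by (rule gr_filtrationI[OF q]) simp
  have "(\<lambda>i. homogeneous R 0 (p 0) i \<oplus> ?q i) = p"
    using assms by (auto simp: homogeneous_def)
  then show "gr_of R p = gr_of R (homogeneous R 0 (p 0)) \<oplus>\<^bsub>gr R\<^esub> gr_of R ?q"
    using gr_add[OF homogeneous_mem q, of "p 0" 0] assms by simp
qed

text \<open>An element \<open>t + v\<close> with \<open>t \<in> C_bar R\<close> and \<open>v\<close> of positive degree is a unit up to a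
  denominator: if \<open>t' v = y t\<close> then \<open>(t' - y)(t + v) = t' t - y v\<close>, where \<open>y v\<close> has higher degree.\<close>

lemma C_bar_left_multiple:
  assumes den: "left_denominator_set (gr R) (C_bar R)" and k: "nn k = {\<zero>}"
    and p: "p \<in> U" "p 0 \<in> C_prime R"
  obtains w where "w \<in> carrier (gr R)" "w \<otimes>\<^bsub>gr R\<^esub> gr_of R p \<in> C_bar R"
proof -
  interpret D: left_denominator "gr R" "C_bar R"
    by (intro left_denominator.intro left_denominator_axioms.intro gr_ring den)
  let ?u = "gr_of R p"
  have u: "?u \<in> carrier (gr R)" using p(1) by simp
  have "\<exists>w \<in> carrier (gr R). \<exists>t \<in> C_bar R. \<exists>v \<in> gr_filtration (Suc i). w \<otimes>\<^bsub>gr R\<^esub> ?u = t \<oplus>\<^bsub>gr R\<^esub> v" for i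
  proof (induction i)
    case 0
    obtain v where v: "v \<in> gr_filtration 1" "?u = gr_of R (homogeneous R 0 (p 0)) \<oplus>\<^bsub>gr R\<^esub> v"
      using p(1) by (rule gr_split_degree_zero)
    have "\<one>\<^bsub>gr R\<^esub> \<otimes>\<^bsub>gr R\<^esub> ?u = gr_of R (homogeneous R 0 (p 0)) \<oplus>\<^bsub>gr R\<^esub> v"
      using D.l_one[OF u] v(2) by simp
    moreover have "gr_of R (homogeneous R 0 (p 0)) \<in> C_bar R"
      using p(2) by (auto simp: C_bar_eq)
    ultimately show ?case
      using v(1) D.one_closed unfolding One_nat_def by blast
  next
    case (Suc i)
    then obtain w t v where w: "w \<in> carrier (gr R)" "t \<in> C_bar R" "v \<in> gr_filtration (Suc i)"
        "w \<otimes>\<^bsub>gr R\<^esub> ?u = t \<oplus>\<^bsub>gr R\<^esub> v"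
      by blast
    have v: "v \<in> carrier (gr R)" using w(3) gr_filtration_carrier by blast
    obtain t' y0 where t': "t' \<in> C_bar R" "y0 \<in> carrier (gr R)" "t' \<otimes>\<^bsub>gr R\<^esub> v = y0 \<otimes>\<^bsub>gr R\<^esub> t"
      by (rule D.ore[OF v w(2)])
    have "t' \<otimes>\<^bsub>gr R\<^esub> v \<in> gr_filtration (Suc i)"
      using w(3) t'(1) by (intro ideal.I_l_closed[OF gr_filtration_ideal]) simp_all
    then have "y0 \<otimes>\<^bsub>gr R\<^esub> t \<in> gr_filtration (Suc i)"
      by (simp only: t'(3))
    then obtain y where y: "y \<in> gr_filtration (Suc i)" "y \<otimes>\<^bsub>gr R\<^esub> t = t' \<otimes>\<^bsub>gr R\<^esub> v"
      by (rule gr_filtration_cancel[OF t'(2) w(2)]) (simp add: t'(3))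
    have yc: "y \<in> carrier (gr R)" using y(1) gr_filtration_carrier by blast
    \<comment> \<open>The degree of \<open>y v\<close> is even at least \<open>2 i + 2\<close>; a
      gain of one degree is enough, as the filtration vanishes from \<open>k\<close> on.\<close>
    have yv: "y \<otimes>\<^bsub>gr R\<^esub> v \<in> gr_filtration (Suc (Suc i))"
      using gr_filtration_mult[OF y(1) w(3)] gr_filtration_antimono[of "Suc (Suc i)" "Suc i + Suc i"]
      by auto
    note carr = w(1) D.S_carrier[OF w(2)] v D.S_carrier[OF t'(1)] yc u
    have "((t' \<ominus>\<^bsub>gr R\<^esub> y) \<otimes>\<^bsub>gr R\<^esub> w) \<otimes>\<^bsub>gr R\<^esub> ?u = (t' \<ominus>\<^bsub>gr R\<^esub> y) \<otimes>\<^bsub>gr R\<^esub> (t \<oplus>\<^bsub>gr R\<^esub> v)"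
      using carr by (simp add: D.m_assoc w(4))
    also have "\<dots> = (t' \<otimes>\<^bsub>gr R\<^esub> t \<oplus>\<^bsub>gr R\<^esub> t' \<otimes>\<^bsub>gr R\<^esub> v) \<ominus>\<^bsub>gr R\<^esub> (y \<otimes>\<^bsub>gr R\<^esub> t \<oplus>\<^bsub>gr R\<^esub> y \<otimes>\<^bsub>gr R\<^esub> v)"
      using carr by (simp add: D.minus_eq D.l_distr D.r_distr D.l_minus D.minus_add D.a_ac)
    also have "\<dots> = t' \<otimes>\<^bsub>gr R\<^esub> t \<ominus>\<^bsub>gr R\<^esub> y \<otimes>\<^bsub>gr R\<^esub> v"
      unfolding y(2) using carr by (simp add: D.minus_eq D.minus_add D.a_ac D.r_neg1 D.r_neg2)
    also have "\<dots> = t' \<otimes>\<^bsub>gr R\<^esub> t \<oplus>\<^bsub>gr R\<^esub> (\<ominus>\<^bsub>gr R\<^esub> (y \<otimes>\<^bsub>gr R\<^esub> v))"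
      by (simp add: D.minus_eq)
    finally have "((t' \<ominus>\<^bsub>gr R\<^esub> y) \<otimes>\<^bsub>gr R\<^esub> w) \<otimes>\<^bsub>gr R\<^esub> ?u =
        t' \<otimes>\<^bsub>gr R\<^esub> t \<oplus>\<^bsub>gr R\<^esub> (\<ominus>\<^bsub>gr R\<^esub> (y \<otimes>\<^bsub>gr R\<^esub> v))" .
    moreover have "\<ominus>\<^bsub>gr R\<^esub> (y \<otimes>\<^bsub>gr R\<^esub> v) \<in> gr_filtration (Suc (Suc i))"
      by (rule additive_subgroup.a_inv_closed[OF ideal.axioms(1)[OF gr_filtration_ideal] yv])
    moreover have "(t' \<ominus>\<^bsub>gr R\<^esub> y) \<otimes>\<^bsub>gr R\<^esub> w \<in> carrier (gr R)"
      using carr by simp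
    ultimately show ?case
      using D.S_mult[OF t'(1) w(2)] by blast
  qed
  then obtain w t v where w: "w \<in> carrier (gr R)" "t \<in> C_bar R" "v \<in> gr_filtration (Suc k)"
      "w \<otimes>\<^bsub>gr R\<^esub> ?u = t \<oplus>\<^bsub>gr R\<^esub> v"
    by blast
  have "v = \<zero>\<^bsub>gr R\<^esub>"
    using w(3) gr_filtration_antimono[of k "Suc k"] gr_filtration_zero[OF k] by auto
  then have "w \<otimes>\<^bsub>gr R\<^esub> ?u \<in> C_bar R" using w by simp
  with w(1) show thesis by (rule that)
qed

end

section \<open>From the graded ring back to the ring\<close>

context ring
begin

text \<open>For a left ideal \<open>I\<close> this is its associated graded left ideal for the
  filtration induced by the powers of the radical.\<close>

definition gr_coefficients_in :: "'a set \<Rightarrow> (nat \<Rightarrow> 'a set) set" where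
  "gr_coefficients_in I = {gr_of R p | p. p \<in> U \<and> (\<forall>i. p i \<in> I)}"

lemma gr_coefficients_inI: "p \<in> U \<Longrightarrow> (\<And>i. p i \<in> I) \<Longrightarrow> gr_of R p \<in> gr_coefficients_in I"
  unfolding gr_coefficients_in_def by blast

lemma gr_coefficients_inE:
  assumes "u \<in> gr_coefficients_in I"
  obtains p where "p \<in> U" "\<And>i. p i \<in> I" "u = gr_of R p"
  using assms unfolding gr_coefficients_in_def by blast

lemma left_ideal_gr_coefficients_in:
  assumes "left_ideal I R"
  shows "left_ideal (gr_coefficients_in I) (gr R)"
proof -
  interpret G: ring "gr R" by (rule gr_ring)
  interpret I: left_ideal I R by fact
  show ?thesis
  proof (rule G.left_idealI)
    show "gr_coefficients_in I \<subseteq> carrier (gr R)"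
      by (auto simp: gr_coefficients_in_def)
    have "(\<lambda>i. \<zero>) \<in> U" by (rule graded_repsI) simp_all
    then show "\<zero>\<^bsub>gr R\<^esub> \<in> gr_coefficients_in I"
      using gr_coefficients_inI[of "\<lambda>i. \<zero>" I] by (simp add: gr_zero)
  next
    fix u v assume u: "u \<in> gr_coefficients_in I" and v: "v \<in> gr_coefficients_in I"
    obtain p where p: "p \<in> U" "\<And>i. p i \<in> I" "u = gr_of R p"
      using u by (rule gr_coefficients_inE) blast
    obtain q where q: "q \<in> U" "\<And>i. q i \<in> I" "v = gr_of R q"
      using v by (rule gr_coefficients_inE) blast
    have "gr_of R (\<lambda>i. p i \<oplus> q i) \<in> gr_coefficients_in I"
      by (rule gr_coefficients_inI) (use p(1,2) q(1,2) in simp_all)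
    then show "u \<oplus>\<^bsub>gr R\<^esub> v \<in> gr_coefficients_in I"
      using p(1,3) q(1,3) by (simp add: gr_add)
  next
    fix u a assume u: "u \<in> gr_coefficients_in I" and a: "a \<in> carrier (gr R)"
    obtain p where p: "p \<in> U" "\<And>i. p i \<in> I" "u = gr_of R p"
      using u by (rule gr_coefficients_inE) blast
    obtain q where q: "q \<in> U" "a = gr_of R q" using a by (rule gr_rep)
    have "(\<Oplus>i\<in>{..n}. q i \<otimes> p (n - i)) \<in> I" for n
      by (rule I.finsum_atMost_closed) (rule I.l_closed[OF p(2) graded_repsD(2)[OF q(1)]])
    then have "gr_of R (\<lambda>n. \<Oplus>i\<in>{..n}. q i \<otimes> p (n - i)) \<in> gr_coefficients_in I"
      by (intro gr_coefficients_inI graded_reps_mult p(1) q(1))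
    then show "a \<otimes>\<^bsub>gr R\<^esub> u \<in> gr_coefficients_in I"
      using p(1,3) q by (simp add: gr_mult)
  qed
qed

text \<open>The Ore condition and the chain condition lift from \<open>gr R\<close> to \<open>R\<close> by descending
  induction on the degree, since \<open>\<nn>\<^sup>k = 0\<close>.\<close>

lemma left_ore_set_C_prime:
  assumes den: "left_denominator_set (gr R) (C_bar R)" and k: "nn k = {\<zero>}"
  shows "left_ore_set R (C_prime R)"
proof -
  interpret D: left_denominator "gr R" "C_bar R"
    by (intro left_denominator.intro left_denominator_axioms.intro gr_ring den)
  have main: "\<exists>t \<in> C_prime R. \<exists>b \<in> carrier R. t \<otimes> x = b \<otimes> c"
    if "i \<le> k" "x \<in> nn i" "c \<in> C_prime R" for i x c
    using that
  proof (induction "k - i" arbitrary: i x)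
    case 0
    then have "x = \<zero>" using k by simp
    then show ?case
      using submonoid.one_closed[OF submonoid_C_prime] C_primeD(1)[OF 0(4)]
      by (intro bexI[of _ \<one>] bexI[of _ \<zero>]) simp_all
  next
    case (Suc m)
    note x = Suc(4) and c = Suc(5)
    have cc: "c \<in> carrier R" by (rule C_primeD(1)[OF c])
    have xc: "x \<in> carrier R" using x by simp
    have "gr_of R (homogeneous R 0 c) \<in> C_bar R" using c by (auto simp: C_bar_eq)
    then obtain t0 v where t0: "t0 \<in> C_bar R" "v \<in> carrier (gr R)"
        "t0 \<otimes>\<^bsub>gr R\<^esub> gr_of R (homogeneous R i x) = v \<otimes>\<^bsub>gr R\<^esub> gr_of R (homogeneous R 0 c)"
      using D.ore[of "gr_of R (homogeneous R i x)" "gr_of R (homogeneous R 0 c)"] x by auto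
    obtain t where t: "t \<in> C_prime R" "t0 = gr_of R (homogeneous R 0 t)"
      using t0(1) by (auto simp: C_bar_eq)
    have tc: "t \<in> carrier R" by (rule C_primeD(1)[OF t(1)])
    obtain q where q: "q \<in> U" "v = gr_of R q" using t0(2) by (rule gr_rep)
    have "gr_of R (\<lambda>j. t \<otimes> homogeneous R i x j) = gr_of R (\<lambda>j. q j \<otimes> c)"
      using t0(3) q t x cc tc by (simp add: gr_mult_homogeneous_left gr_mult_homogeneous_right)
    \<comment> \<open>Only degree \<open>i\<close> of the Ore equation in \<open>gr R\<close> is
      read. It says that \<open>t x\<close> is a left multiple of \<open>c\<close> up to an error of
      degree \<open>i + 1\<close>, to which the induction hypothesis applies.\<close>
    then have "t \<otimes> homogeneous R i x i \<ominus> q i \<otimes> c \<in> nn (Suc i)"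
      using q(1) x cc tc by (subst (asm) gr_of_eq_iff) auto
    then have "t \<otimes> x \<ominus> q i \<otimes> c \<in> nn (Suc i)" by (simp add: homogeneous_def)
    moreover have "m = k - Suc i" "Suc i \<le> k" using Suc(2,3) by linarith+
    ultimately obtain t' b where t': "t' \<in> C_prime R" "b \<in> carrier R"
        "t' \<otimes> (t \<otimes> x \<ominus> q i \<otimes> c) = b \<otimes> c"
      using Suc(1)[of "Suc i" "t \<otimes> x \<ominus> q i \<otimes> c"] c by blast
    have tc': "t' \<in> carrier R" by (rule C_primeD(1)[OF t'(1)])
    have qi: "q i \<in> carrier R" using q(1) by simp
    have "(t' \<otimes> t) \<otimes> x = t' \<otimes> (t \<otimes> x \<ominus> q i \<otimes> c) \<oplus> (t' \<otimes> q i) \<otimes> c"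
      using tc tc' xc cc qi by (simp add: minus_eq r_distr r_minus m_assoc a_assoc l_neg)
    also have "\<dots> = (b \<oplus> t' \<otimes> q i) \<otimes> c"
      using t'(2) tc' cc qi by (simp add: t'(3) l_distr)
    finally show ?case
      using submonoid.m_closed[OF submonoid_C_prime t'(1) t(1)] t'(2) tc' qi
      by (intro bexI[of _ "t' \<otimes> t"] bexI[of _ "b \<oplus> t' \<otimes> q i"]) simp_all
  qed
  show ?thesis
    unfolding left_ore_set_def
    using submonoid_C_prime main[of 0] by simp
qed

lemma saturated_dcc_C_prime:
  assumes den: "left_denominator_set (gr R) (C_bar R)" and k: "nn k = {\<zero>}"
    and dcc: "saturated_dcc (gr R) (C_bar R)"
  shows "saturated_dcc R (C_prime R)"
  unfolding saturated_dcc_def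
proof (intro allI impI; elim conjE)
  fix J :: "nat \<Rightarrow> 'a set"
  assume J: "\<forall>i. saturated_left_ideal R (C_prime R) (J i)" "\<forall>i. J (Suc i) \<subseteq> J i"
  interpret D: left_denominator "gr R" "C_bar R"
    by (intro left_denominator.intro left_denominator_axioms.intro gr_ring den)
  interpret L: left_localization "gr R" "left_fractions (gr R) (C_bar R)"
      "left_frac (gr R) (C_bar R) \<one>\<^bsub>gr R\<^esub>" "C_bar R"
    by (rule D.left_localization_left_fractions)
  have J_left: "left_ideal (J i) R" for i
    using J(1) by (simp add: saturated_left_ideal_def)
  have J_sat: "x \<in> J i" if "c \<in> C_prime R" "x \<in> carrier R" "c \<otimes> x \<in> J i" for c x i
    using J(1) that unfolding saturated_left_ideal_def by blast
  have J_mono: "J l \<subseteq> J m" if "m \<le> l" for l m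
    by (rule antimono_chain[OF _ that]) (use J(2) in blast)
  \<comment> \<open>The saturation of the associated graded left ideal of \<open>J i\<close>, taken
    so that the chain condition for saturated left ideals of \<open>gr R\<close> applies.\<close>
  define G where "G i = L.contraction (L.extension (gr_coefficients_in (J i)))" for i
  have G_left: "left_ideal (gr_coefficients_in (J i)) (gr R)" for i
    by (rule left_ideal_gr_coefficients_in[OF J_left])
  have "saturated_left_ideal (gr R) (C_bar R) (G i)" for i
    unfolding G_def by (rule L.saturated_contraction[OF L.left_ideal_extension[OF G_left]])
  moreover have "G (Suc i) \<subseteq> G i" for i
  proof -
    have "gr_coefficients_in (J (Suc i)) \<subseteq> gr_coefficients_in (J i)"
      using J(2) unfolding gr_coefficients_in_def by blast
    then have "L.extension (gr_coefficients_in (J (Suc i))) \<subseteq> L.extension (gr_coefficients_in (J i))"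
      by (rule L.extension_mono)
    then show ?thesis unfolding G_def L.contraction_def by blast
  qed
  ultimately obtain m where m: "\<And>i. i \<ge> m \<Longrightarrow> G i = G m"
    using saturated_dccD[OF dcc, of G] by blast
  have main: "x \<in> J l" if "l \<ge> m" "i \<le> k" "x \<in> J m" "x \<in> nn i" for l i x
    using that(2-)
  proof (induction "k - i" arbitrary: i x)
    case 0
    then have "x = \<zero>" using k by simp
    then show ?case
      using left_ideal.axioms(1)[OF J_left] additive_subgroup.zero_closed by blast
  next
    case (Suc d)
    note x = Suc(4,5)
    interpret Jm: left_ideal "J m" R by (rule J_left)
    interpret Jl: left_ideal "J l" R by (rule J_left)
    have xc: "x \<in> carrier R" using x(2) by simp
    have hx: "homogeneous R i x \<in> U" using x(2) by simp
    have "gr_of R (homogeneous R i x) \<in> gr_coefficients_in (J m)"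
      by (rule gr_coefficients_inI[OF hx]) (use x(1) in \<open>simp add: homogeneous_def\<close>)
    then have "gr_of R (homogeneous R i x) \<in> G m"
      using L.f_in_extension[of "gr_coefficients_in (J m)"] left_ideal.axioms(1)[OF G_left]
        additive_subgroup.a_subset gr_of_carrier[OF hx]
      unfolding G_def L.contraction_def by blast
    then have "gr_of R (homogeneous R i x) \<in> G l"
      using m[OF \<open>l \<ge> m\<close>] by simp
    then obtain s where s: "s \<in> C_bar R"
        "s \<otimes>\<^bsub>gr R\<^esub> gr_of R (homogeneous R i x) \<in> gr_coefficients_in (J l)"
      unfolding G_def by (rule L.contraction_extensionE[OF G_left])
    obtain c where c: "c \<in> C_prime R" "s = gr_of R (homogeneous R 0 c)"
      using s(1) by (auto simp: C_bar_eq)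
    have cc: "c \<in> carrier R" by (rule C_primeD(1)[OF c(1)])
    obtain p where p: "p \<in> U" "\<And>i. p i \<in> J l"
        "s \<otimes>\<^bsub>gr R\<^esub> gr_of R (homogeneous R i x) = gr_of R p"
      using s(2) by (rule gr_coefficients_inE) blast
    have "gr_of R (\<lambda>j. c \<otimes> homogeneous R i x j) = gr_of R p"
      using p(3) gr_mult_homogeneous_left[OF cc hx] c(2) by simp
    then have "c \<otimes> homogeneous R i x i \<ominus> p i \<in> nn (Suc i)"
      using p(1) graded_reps_mult_left[OF cc hx] by (subst (asm) gr_of_eq_iff) auto
    then have z: "c \<otimes> x \<ominus> p i \<in> nn (Suc i)" by (simp add: homogeneous_def)
    have pc: "p i \<in> carrier R" using p(1) by simp
    \<comment> \<open>The difference \<open>c x \<ominus> p i\<close> lies in \<open>J m\<close> and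
      one degree higher than \<open>x\<close>, so by induction it lies in \<open>J l\<close>. Adding
      \<open>p i\<close> back gives \<open>c x \<in> J l\<close>, and saturation of
      \<open>J l\<close> removes \<open>c\<close>.\<close>
    have "p i \<in> J m" using p(2) J_mono[OF \<open>l \<ge> m\<close>] by blast
    then have "c \<otimes> x \<ominus> p i \<in> J m"
      using Jm.l_closed[OF x(1) cc] by (simp add: minus_eq)
    moreover have "d = k - Suc i" "Suc i \<le> k" using Suc(2,3) by linarith+
    ultimately have "c \<otimes> x \<ominus> p i \<in> J l"
      using Suc(1)[of "Suc i" "c \<otimes> x \<ominus> p i"] z by blast
    then have "(c \<otimes> x \<ominus> p i) \<oplus> p i \<in> J l"
      using p(2) by (rule Jl.a_closed)
    then have "c \<otimes> x \<in> J l"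
      using cc xc pc by (simp add: minus_eq a_assoc l_neg)
    then show ?case by (rule J_sat[OF c(1) xc])
  qed
  have "J l = J m" if "l \<ge> m" for l
  proof
    show "J l \<subseteq> J m" by (rule J_mono[OF that])
    show "J m \<subseteq> J l"
    proof
      fix x assume x: "x \<in> J m"
      then have "x \<in> nn 0"
        using additive_subgroup.a_Hcarr[OF left_ideal.axioms(1)[OF J_left]] by simp
      then show "x \<in> J l" by (rule main[OF that le0 x])
    qed
  qed
  then show "\<exists>m. \<forall>i\<ge>m. J i = J m" by blast
qed

theorem left_artinian_left_quotient_ring_from_gr:
  assumes den: "left_denominator_set (gr R) (C_bar R)"
    and art: "left_artinian_ring (left_fractions (gr R) (C_bar R))"
    and nil: "nilpotent_ideal R (prime_radical R)" and reg: "C_prime R \<subseteq> regular_elements R"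
  shows "has_left_quotient_ring R" "left_artinian_ring (left_quotient_ring R)"
proof -
  interpret D: left_denominator "gr R" "C_bar R"
    by (intro left_denominator.intro left_denominator_axioms.intro gr_ring den)
  interpret L: left_localization "gr R" "left_fractions (gr R) (C_bar R)"
      "left_frac (gr R) (C_bar R) \<one>\<^bsub>gr R\<^esub>" "C_bar R"
    by (rule D.left_localization_left_fractions)
  obtain k where k: "nn k = {\<zero>}" using nil by (auto simp: nilpotent_ideal_def)
  have dcc: "saturated_dcc R (C_prime R)"
    by (rule saturated_dcc_C_prime[OF den k]) (use art L.left_artinian_iff in simp)
  show has: "has_left_quotient_ring R"
    unfolding has_left_quotient_ring_def
    by (rule left_ore_set_regular_elements[OF left_ore_set_C_prime[OF den k] reg dcc])
  show "left_artinian_ring (left_quotient_ring R)"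
    using left_localization.left_artinian_iff[OF left_localization_left_quotient_ring[OF has]]
      saturated_dcc_mono[OF dcc reg] by simp
qed

text \<open>The preimage in \<open>R\<close> of the projection of \<open>L\<close> to the
  degree-zero component of \<open>gr R\<close>.\<close>

definition degree_zero_part :: "(nat \<Rightarrow> 'a set) set \<Rightarrow> 'a set" where
  "degree_zero_part L = {p 0 | p. p \<in> U \<and> gr_of R p \<in> L}"

lemma degree_zero_partI: "p \<in> U \<Longrightarrow> gr_of R p \<in> L \<Longrightarrow> p 0 \<in> degree_zero_part L"
  unfolding degree_zero_part_def by blast

lemma degree_zero_partE:
  assumes "x \<in> degree_zero_part L"
  obtains p where "p \<in> U" "gr_of R p \<in> L" "p 0 = x"
  using assms unfolding degree_zero_part_def by blast

lemma degree_zero_part_ideal: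
  assumes "ideal L (gr R)"
  shows "ideal (degree_zero_part L) R"
proof -
  interpret L: ideal L "gr R" by fact
  have "left_ideal (degree_zero_part L) R"
  proof (rule left_idealI)
    show "degree_zero_part L \<subseteq> carrier R"
      by (auto simp: degree_zero_part_def)
    have "(\<lambda>i. \<zero>) \<in> U" by (rule graded_repsI) simp_all
    moreover have "gr_of R (\<lambda>i. \<zero>) \<in> L"
      using additive_subgroup.zero_closed[OF ideal.axioms(1)[OF assms]] by (simp only: gr_zero)
    ultimately show "\<zero> \<in> degree_zero_part L"
      by (rule degree_zero_partI)
  next
    fix x y assume x: "x \<in> degree_zero_part L" and y: "y \<in> degree_zero_part L"
    obtain p where p: "p \<in> U" "gr_of R p \<in> L" "p 0 = x" using x by (rule degree_zero_partE)
    obtain q where q: "q \<in> U" "gr_of R q \<in> L" "q 0 = y" using y by (rule degree_zero_partE)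
    have "gr_of R (\<lambda>i. p i \<oplus> q i) \<in> L"
      using additive_subgroup.a_closed[OF ideal.axioms(1)[OF assms] p(2) q(2)] gr_add[OF p(1) q(1)] by simp
    then show "x \<oplus> y \<in> degree_zero_part L"
      using degree_zero_partI[of "\<lambda>i. p i \<oplus> q i" L] p q by simp
  next
    fix x a assume x: "x \<in> degree_zero_part L" and a: "a \<in> carrier R"
    obtain p where p: "p \<in> U" "gr_of R p \<in> L" "p 0 = x" using x by (rule degree_zero_partE)
    have "gr_of R (homogeneous R 0 a) \<in> carrier (gr R)" using a by simp
    then have "gr_of R (\<lambda>i. a \<otimes> p i) \<in> L"
      using L.I_l_closed[OF p(2)] gr_mult_homogeneous_left[OF a p(1)] by metis
    then show "a \<otimes> x \<in> degree_zero_part L"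
      using degree_zero_partI[of "\<lambda>i. a \<otimes> p i" L] p a by simp
  qed
  then show ?thesis
  proof (rule idealI')
    fix x a assume x: "x \<in> degree_zero_part L" and a: "a \<in> carrier R"
    obtain p where p: "p \<in> U" "gr_of R p \<in> L" "p 0 = x" using x by (rule degree_zero_partE)
    have "gr_of R (homogeneous R 0 a) \<in> carrier (gr R)" using a by simp
    then have "gr_of R (\<lambda>i. p i \<otimes> a) \<in> L"
      using L.I_r_closed[OF p(2)] gr_mult_homogeneous_right[OF a p(1)] by metis
    then show "x \<otimes> a \<in> degree_zero_part L"
      using degree_zero_partI[of "\<lambda>i. p i \<otimes> a" L] p a by simp
  qed
qed

text \<open>The degree-zero coefficient of a product is the product of the degree-zero
  coefficients.\<close>

lemma degree_zero_part_pow: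
  assumes "ideal L (gr R)"
  shows "ideal_pow R (degree_zero_part L) j \<subseteq> degree_zero_part (ideal_pow (gr R) L j)"
proof (induction j)
  case 0
  show ?case
  proof
    fix x assume "x \<in> ideal_pow R (degree_zero_part L) 0"
    then have "homogeneous R 0 x \<in> U" by simp
    then show "x \<in> degree_zero_part (ideal_pow (gr R) L 0)"
      using degree_zero_partI[of "homogeneous R 0 x"] by (simp add: homogeneous_def)
  qed
next
  case (Suc j)
  interpret G: ring "gr R" by (rule gr_ring)
  have "x \<otimes> y \<in> degree_zero_part (ideal_pow (gr R) L (Suc j))"
    if x: "x \<in> ideal_pow R (degree_zero_part L) j" and y: "y \<in> degree_zero_part L" for x y
  proof -
    obtain p where p: "p \<in> U" "gr_of R p \<in> ideal_pow (gr R) L j" "p 0 = x"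
      using x Suc.IH degree_zero_partE by blast
    obtain q where q: "q \<in> U" "gr_of R q \<in> L" "q 0 = y" using y by (rule degree_zero_partE)
    have "gr_of R (\<lambda>n. \<Oplus>i\<in>{..n}. p i \<otimes> q (n - i)) \<in> ideal_pow (gr R) L (Suc j)"
      using ideal_prod.prod[OF p(2) q(2), of "gr R"] gr_mult[OF p(1) q(1)]
      by (simp add: ideal_pow.simps)
    then have "(\<Oplus>i\<in>{..0}. p i \<otimes> q (0 - i)) \<in> degree_zero_part (ideal_pow (gr R) L (Suc j))"
      using degree_zero_partI[OF graded_reps_mult[OF p(1) q(1)]] by blast
    also have "(\<Oplus>i\<in>{..0}. p i \<otimes> q (0 - i)) = x \<otimes> y"
      using p(1,3) q(1,3) by (subst finsum_0) auto
    finally show ?thesis .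
  qed
  then show ?case
    unfolding ideal_pow.simps(2)[of R]
    by (intro ideal_prod_subsetI[OF degree_zero_part_ideal[OF G.ideal_pow_ideal[OF assms]]])
qed

end

lemma (in ring_hom_ring) ideal_image:
  assumes "carrier S \<subseteq> h ` carrier R" "ideal I R"
  shows "ideal (h ` I) S"
proof -
  interpret I: ideal I R by fact
  have "left_ideal (h ` I) S"
  proof (rule S.left_idealI)
    show "h ` I \<subseteq> carrier S" by auto
    show "\<zero>\<^bsub>S\<^esub> \<in> h ` I" using imageI[OF I.zero_closed, of h] by simp
    fix x y assume "x \<in> h ` I" "y \<in> h ` I"
    then obtain a b where "a \<in> I" "b \<in> I" "x = h a" "y = h b" by blast
    then show "x \<oplus>\<^bsub>S\<^esub> y \<in> h ` I" by (intro image_eqI[of _ _ "a \<oplus>\<^bsub>R\<^esub> b"]) auto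
  next
    fix x b assume "x \<in> h ` I" "b \<in> carrier S"
    then obtain a c where "a \<in> I" "x = h a" "c \<in> carrier R" "b = h c" using assms(1) by blast
    then show "b \<otimes>\<^bsub>S\<^esub> x \<in> h ` I"
      using I.I_l_closed[of a c] by (intro image_eqI[of _ _ "c \<otimes>\<^bsub>R\<^esub> a"]) auto
  qed
  then show ?thesis
  proof (rule S.idealI')
    fix x b assume "x \<in> h ` I" "b \<in> carrier S"
    then obtain a c where "a \<in> I" "x = h a" "c \<in> carrier R" "b = h c" using assms(1) by blast
    then show "x \<otimes>\<^bsub>S\<^esub> b \<in> h ` I"
      using I.I_r_closed[of a c] by (intro image_eqI[of _ _ "a \<otimes>\<^bsub>R\<^esub> c"]) auto
  qed
qed

section \<open>The left quotient ring of the torsion-free graded ring\<close>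

context ring
begin

text \<open>The left quotient ring inverts all regular elements of the torsion-free quotient,
  whereas only the images of \<open>C_bar R\<close> should serve as denominators. The point is to
  show that a regular element has degree-zero coefficient in \<open>C_prime R\<close>; then
  \<open>C_bar_left_multiple\<close> applies.\<close>

theorem torsion_quotient_localization:
  assumes den: "left_denominator_set (gr R) (C_bar R)"
    and nil: "nilpotent_ideal R (prime_radical R)"
    and has: "has_left_quotient_ring (gr R Quot gr_torsion R)"
    and art: "left_artinian_ring (left_quotient_ring (gr R Quot gr_torsion R))"
  shows "\<exists>g. left_localization (gr R) (left_quotient_ring (gr R Quot gr_torsion R)) g (C_bar R)"
proof -
  let ?G = "gr R" and ?T = "gr_torsion R"
  let ?A = "?G Quot ?T"
  let ?Q = "left_quotient_ring ?A" and ?f = "left_frac ?A (regular_elements ?A) \<one>\<^bsub>?A\<^esub>"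
  let ?\<rho> = "(+>\<^bsub>?G\<^esub>) ?T"
  interpret D: left_denominator ?G "C_bar R"
    by (intro left_denominator.intro left_denominator_axioms.intro gr_ring den)
  interpret L: left_localization ?G "left_fractions ?G (C_bar R)"
      "left_frac ?G (C_bar R) \<one>\<^bsub>?G\<^esub>" "C_bar R"
    by (rule D.left_localization_left_fractions)
  have T: "?T = a_kernel ?G (left_fractions ?G (C_bar R)) (left_frac ?G (C_bar R) \<one>\<^bsub>?G\<^esub>)"
    unfolding gr_torsion_def by (rule L.torsion_eq_kernel)
  interpret T: ideal ?T ?G unfolding T by (rule L.kernel_is_ideal)
  interpret \<rho>: ring_hom_ring ?G ?A ?\<rho> by (rule T.rcos_ring_hom_ring)
  have \<rho>_surj: "carrier ?A \<subseteq> ?\<rho> ` carrier ?G"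
    by (auto simp: FactRing_def A_RCOSETS_def' a_r_coset_def')
  have \<rho>_zero: "?\<rho> u = \<zero>\<^bsub>?A\<^esub> \<longleftrightarrow> u \<in> ?T" if "u \<in> carrier ?G" for u
  proof -
    have "?\<rho> u = ?T \<longleftrightarrow> u \<in> ?T"
      using that T.a_rcos_const T.rcos_const_imp_mem by blast
    moreover have zero: "\<zero>\<^bsub>?A\<^esub> = ?T" by (simp only: FactRing_def ring.simps)
    ultimately show ?thesis by (simp only: zero)
  qed
  have C_bar_regular: "?\<rho> s \<in> regular_elements ?A" if "s \<in> C_bar R" for s
    using L.quotient_image_regular that unfolding T by blast
  interpret F: artinian_quotient_ring ?A ?Q ?f "regular_elements ?A"
    by (intro artinian_quotient_ring.intro artinian_quotient_ring_axioms.intro refl art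
        artinian_localization.intro artinian_localization_axioms.intro
        \<rho>.S.left_localization_left_quotient_ring has)
  obtain k where k: "nn k = {\<zero>}" using nil by (auto simp: nilpotent_ideal_def)

  define E where "E = ?\<rho> ` gr_filtration 1"
  have E: "ideal E ?A"
    unfolding E_def by (rule \<rho>.ideal_image[OF \<rho>_surj gr_filtration_ideal])
  have E_pow: "ideal_pow ?A E j \<subseteq> ?\<rho> ` gr_filtration j" for j
  proof (induction j)
    case 0
    then show ?case using \<rho>_surj by (simp add: gr_filtration_0)
  next
    case (Suc j)
    have "x \<otimes>\<^bsub>?A\<^esub> y \<in> ?\<rho> ` gr_filtration (Suc j)" if "x \<in> ideal_pow ?A E j" "y \<in> E" for x y
    proof -
      obtain u v where u: "u \<in> gr_filtration j" "v \<in> gr_filtration 1" "x = ?\<rho> u" "y = ?\<rho> v"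
        using \<open>x \<in> ideal_pow ?A E j\<close> \<open>y \<in> E\<close> Suc.IH unfolding E_def by blast
      have "u \<in> carrier ?G" "v \<in> carrier ?G" using u(1,2) gr_filtration_carrier by blast+
      then have "x \<otimes>\<^bsub>?A\<^esub> y = ?\<rho> (u \<otimes>\<^bsub>?G\<^esub> v)" using u(3,4) by simp
      then show ?thesis using gr_filtration_mult[OF u(1,2)] by simp
    qed
    then show ?case
      unfolding ideal_pow.simps(2)
      by (intro \<rho>.S.ideal_prod_subsetI[OF \<rho>.ideal_image[OF \<rho>_surj gr_filtration_ideal]])
  qed
  interpret EE: ideal "F.extension E" ?Q by (rule F.ideal_extension[OF E])
  \<comment> \<open>\<open>E\<close> is the image of the positive-degree part, so its
    \<open>k\<close>-th power is zero; as extension of ideals is multiplicative over an Artinian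
    quotient ring, nilpotency carries over.\<close>
  have EE_pow: "ideal_pow ?Q (F.extension E) k \<subseteq> {\<zero>\<^bsub>?Q\<^esub>}"
  proof -
    have "ideal_pow ?A E k \<subseteq> {\<zero>\<^bsub>?A\<^esub>}"
      using E_pow[of k] gr_filtration_zero[OF k] by simp
    then have "F.extension (ideal_pow ?A E k) \<subseteq> F.extension {\<zero>\<^bsub>?A\<^esub>}"
      by (rule F.extension_mono)
    moreover have "F.extension {\<zero>\<^bsub>?A\<^esub>} \<subseteq> {\<zero>\<^bsub>?Q\<^esub>}"
    proof
      fix q assume "q \<in> F.extension {\<zero>\<^bsub>?A\<^esub>}"
      then obtain s where s: "q \<in> carrier ?Q" "s \<in> regular_elements ?A"
          "?f s \<otimes>\<^bsub>?Q\<^esub> q = ?f \<zero>\<^bsub>?A\<^esub>"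
        by (auto elim: F.extensionE)
      then have "q = \<zero>\<^bsub>?Q\<^esub>" using F.f_cancel[of s q "\<zero>\<^bsub>?Q\<^esub>"] by simp
      then show "q \<in> {\<zero>\<^bsub>?Q\<^esub>}" by simp
    qed
    ultimately show ?thesis by (simp add: F.extension_pow[OF E])
  qed

  \<comment> \<open>The elements of \<open>gr R\<close> that become of positive degree after
    inverting regular elements. The aim is that inverting them produces nothing new in degree
    zero.\<close>
  define K where "K = {u \<in> carrier ?G. ?f (?\<rho> u) \<in> F.extension E}"
  interpret f\<rho>: ring_hom_ring ?G ?Q "\<lambda>u. ?f (?\<rho> u)"
    by (rule ring_hom_ringI) (simp_all add: gr_ring F.S.ring_axioms)
  have K: "ideal K ?G"
    unfolding K_def by (rule f\<rho>.ideal_vimage[OF EE.is_ideal])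
  have K_pow: "ideal_pow ?G K k \<subseteq> ?T"
  proof
    fix u assume u: "u \<in> ideal_pow ?G K k"
    then have uc: "u \<in> carrier ?G" using D.ideal_pow_subset_carrier[OF K] by blast
    have "?f (?\<rho> u) \<in> ideal_pow ?Q (F.extension E) k"
      by (rule f\<rho>.hom_ideal_pow[OF _ _ K u]) (auto simp: K_def)
    then have "?f (?\<rho> u) = \<zero>\<^bsub>?Q\<^esub>" using EE_pow by blast
    then show "u \<in> ?T" using F.f_eq_zero[of "?\<rho> u"] \<rho>_zero[OF uc] uc by simp
  qed
  \<comment> \<open>The \<open>k\<close>-th power of the degree-zero part consists of degree-zero
    coefficients of torsion elements. Such a coefficient \<open>x\<close> satisfies
    \<open>c x \<in> prime_radical R\<close> for some \<open>c \<in> C_prime R\<close>, so it lies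
    in the prime radical; semiprimeness removes the power.\<close>
  have K_nn: "degree_zero_part K \<subseteq> prime_radical R"
  proof (rule ideal_pow_subset_prime_radical[OF degree_zero_part_ideal[OF K]])
    show "ideal_pow R (degree_zero_part K) k \<subseteq> prime_radical R"
    proof
      fix x assume "x \<in> ideal_pow R (degree_zero_part K) k"
      then have "x \<in> degree_zero_part (ideal_pow ?G K k)"
        using degree_zero_part_pow[OF K] by blast
      then obtain p where p: "p \<in> U" "gr_of R p \<in> ?T" "p 0 = x"
        using K_pow by (meson degree_zero_partE subsetD)
      then obtain s where "s \<in> C_bar R" "s \<otimes>\<^bsub>?G\<^esub> gr_of R p = \<zero>\<^bsub>?G\<^esub>"
        unfolding gr_torsion_def by blast
      then obtain c where c: "c \<in> C_prime R"
          "gr_of R (homogeneous R 0 c) \<otimes>\<^bsub>?G\<^esub> gr_of R p = \<zero>\<^bsub>?G\<^esub>"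
        by (auto simp: C_bar_eq)
      have cc: "c \<in> carrier R" by (rule C_primeD(1)[OF c(1)])
      have "c \<otimes> p 0 \<in> nn (Suc 0)"
        using c(2) gr_mult_homogeneous_left[OF cc p(1)]
          gr_of_eq_zero_iff[OF graded_reps_mult_left[OF cc p(1)]] by simp
      then show "x \<in> prime_radical R"
        using C_primeD(2)[OF c(1), of "p 0"] p(3) graded_repsD(2)[OF p(1), of 0]
        by (simp add: nn_one)
    qed
  qed

  \<comment> \<open>The regular element becomes a unit of \<open>?Q\<close>. If \<open>p 0\<close>
    times \<open>a\<close> lies in the radical, on either side, then the unit times the image of
    \<open>a\<close> lies in the two-sided ideal \<open>F.extension E\<close>; cancelling the unit
    puts the class of \<open>a\<close> into \<open>K\<close>, and \<open>K_nn\<close>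
    concludes.\<close>
  have regular_degree_zero: "p 0 \<in> C_prime R"
    if p: "p \<in> U" and reg: "?\<rho> (gr_of R p) \<in> regular_elements ?A" for p
  proof -
    let ?v = "?f (?\<rho> (gr_of R p))"
    have v: "?v \<in> Units ?Q" by (rule F.f_Units[OF reg])
    have vc: "?v \<in> carrier ?Q" using p by simp
    have in_ext: "?f (?\<rho> u) \<in> F.extension E" if "u \<in> gr_filtration 1" for u
      using F.f_in_extension[of E "?\<rho> u"] ideal.Icarr[OF E] that unfolding E_def by blast
    have mem: "a \<in> prime_radical R"
      if a: "a \<in> carrier R" and "?f (?\<rho> (gr_of R (homogeneous R 0 a))) \<in> F.extension E" for a
    proof -
      have ha: "homogeneous R 0 a \<in> U" using a by simp
      have "gr_of R (homogeneous R 0 a) \<in> K"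
        using that(2) gr_of_carrier[OF ha] by (simp add: K_def)
      then have "homogeneous R 0 a 0 \<in> degree_zero_part K"
        by (rule degree_zero_partI[OF ha])
      then show ?thesis using K_nn by (auto simp: homogeneous_def)
    qed
    have "a \<in> prime_radical R" if a: "a \<in> carrier R" "p 0 \<otimes> a \<in> prime_radical R" for a
    proof -
      let ?a = "gr_of R (homogeneous R 0 a)"
      have ac: "?a \<in> carrier ?G" using a(1) by simp
      have "gr_of R p \<otimes>\<^bsub>?G\<^esub> ?a \<in> gr_filtration 1"
        unfolding gr_mult_homogeneous_right[OF a(1) p]
        using gr_filtration_iff[OF graded_reps_mult_right[OF a(1) p]] a(2) by (simp add: nn_one)
      then have "?f (?\<rho> (gr_of R p \<otimes>\<^bsub>?G\<^esub> ?a)) \<in> F.extension E" by (rule in_ext)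
      then have "?v \<otimes>\<^bsub>?Q\<^esub> ?f (?\<rho> ?a) \<in> F.extension E"
        using p ac f\<rho>.hom_mult[of "gr_of R p" ?a] by simp
      then have "inv\<^bsub>?Q\<^esub> ?v \<otimes>\<^bsub>?Q\<^esub> (?v \<otimes>\<^bsub>?Q\<^esub> ?f (?\<rho> ?a)) \<in> F.extension E"
        by (rule EE.I_l_closed) (rule F.S.Units_inv_closed[OF v])
      moreover have "inv\<^bsub>?Q\<^esub> ?v \<otimes>\<^bsub>?Q\<^esub> (?v \<otimes>\<^bsub>?Q\<^esub> ?f (?\<rho> ?a)) = ?f (?\<rho> ?a)"
        using F.S.m_assoc[OF F.S.Units_inv_closed[OF v] vc f\<rho>.hom_closed[OF ac]]
          F.S.Units_l_inv[OF v] F.S.l_one[OF f\<rho>.hom_closed[OF ac]] by metis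
      ultimately show ?thesis using mem[OF a(1)] by simp
    qed
    moreover have "a \<in> prime_radical R" if a: "a \<in> carrier R" "a \<otimes> p 0 \<in> prime_radical R" for a
    proof -
      let ?a = "gr_of R (homogeneous R 0 a)"
      have ac: "?a \<in> carrier ?G" using a(1) by simp
      have "?a \<otimes>\<^bsub>?G\<^esub> gr_of R p \<in> gr_filtration 1"
        unfolding gr_mult_homogeneous_left[OF a(1) p]
        using gr_filtration_iff[OF graded_reps_mult_left[OF a(1) p]] a(2) by (simp add: nn_one)
      then have "?f (?\<rho> (?a \<otimes>\<^bsub>?G\<^esub> gr_of R p)) \<in> F.extension E" by (rule in_ext)
      then have "?f (?\<rho> ?a) \<otimes>\<^bsub>?Q\<^esub> ?v \<in> F.extension E"
        using p ac f\<rho>.hom_mult[of ?a "gr_of R p"] by simp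
      then have "(?f (?\<rho> ?a) \<otimes>\<^bsub>?Q\<^esub> ?v) \<otimes>\<^bsub>?Q\<^esub> inv\<^bsub>?Q\<^esub> ?v \<in> F.extension E"
        by (rule EE.I_r_closed) (rule F.S.Units_inv_closed[OF v])
      moreover have "(?f (?\<rho> ?a) \<otimes>\<^bsub>?Q\<^esub> ?v) \<otimes>\<^bsub>?Q\<^esub> inv\<^bsub>?Q\<^esub> ?v = ?f (?\<rho> ?a)"
        using F.S.m_assoc[OF f\<rho>.hom_closed[OF ac] vc F.S.Units_inv_closed[OF v]]
          F.S.Units_r_inv[OF v] F.S.r_one[OF f\<rho>.hom_closed[OF ac]] by metis
      ultimately show ?thesis using mem[OF a(1)] by simp
    qed
    moreover have "p 0 \<in> carrier R" using p by simp
    ultimately show ?thesis unfolding C_prime_iff by blast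
  qed

  have "left_localization ?G ?Q (\<lambda>u. ?f (?\<rho> u)) (C_bar R)"
  proof (intro left_localization.intro left_localization_axioms.intro f\<rho>.ring_hom_ring_axioms
      submonoid_C_bar)
    fix s assume "s \<in> C_bar R"
    then show "?f (?\<rho> s) \<in> Units ?Q" by (rule F.f_Units[OF C_bar_regular])
  next
    fix b assume b: "b \<in> carrier ?Q"
    obtain X Y where X: "X \<in> regular_elements ?A" "Y \<in> carrier ?A" "?f X \<otimes>\<^bsub>?Q\<^esub> b = ?f Y"
      using F.fraction_ex[OF b] by blast
    obtain u y where u: "u \<in> carrier ?G" "X = ?\<rho> u" "y \<in> carrier ?G" "Y = ?\<rho> y"
      using X(2) F.S_carrier[OF X(1)] \<rho>_surj by blast
    obtain p where p: "p \<in> U" "u = gr_of R p" using u(1) by (rule gr_rep)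
    \<comment> \<open>The regular denominator is traded for one from \<open>C_bar R\<close>:
      multiplication by the image of \<open>w\<close> replaces \<open>u\<close> by
      \<open>w u\<close>.\<close>
    have "p 0 \<in> C_prime R" by (rule regular_degree_zero[OF p(1)]) (use X(1) u(2) p(2) in simp)
    then obtain w where w: "w \<in> carrier ?G" "w \<otimes>\<^bsub>?G\<^esub> u \<in> C_bar R"
      using C_bar_left_multiple[OF den k p(1)] p(2) by blast
    have "?f (?\<rho> (w \<otimes>\<^bsub>?G\<^esub> u)) \<otimes>\<^bsub>?Q\<^esub> b = ?f (?\<rho> w) \<otimes>\<^bsub>?Q\<^esub> (?f X \<otimes>\<^bsub>?Q\<^esub> b)"
      unfolding u(2) f\<rho>.hom_mult[OF w(1) u(1)]
      by (rule F.S.m_assoc[OF f\<rho>.hom_closed[OF w(1)] f\<rho>.hom_closed[OF u(1)] b])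
    also have "\<dots> = ?f (?\<rho> (w \<otimes>\<^bsub>?G\<^esub> y))"
      unfolding X(3) u(4) by (rule f\<rho>.hom_mult[OF w(1) u(3), symmetric])
    finally show "\<exists>s\<in>C_bar R. \<exists>a\<in>carrier ?G. ?f (?\<rho> s) \<otimes>\<^bsub>?Q\<^esub> b = ?f (?\<rho> a)"
      using w D.m_closed[OF w(1) u(3)] by blast
  next
    fix u assume u: "u \<in> carrier ?G" "?f (?\<rho> u) = \<zero>\<^bsub>?Q\<^esub>"
    then have "u \<in> ?T" using F.f_eq_zero[OF \<rho>.hom_closed[OF u(1)]] \<rho>_zero[OF u(1)] by blast
    then show "\<exists>s\<in>C_bar R. s \<otimes>\<^bsub>?G\<^esub> u = \<zero>\<^bsub>?G\<^esub>" unfolding gr_torsion_def by blast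
  qed
  then show ?thesis by blast
qed

end

theorem theorem3p1:
  fixes R :: "('a, 'b) ring_scheme"
  assumes "ring R"
  shows
    "let cond1 =
           (has_left_quotient_ring R \<and> left_artinian_ring (left_quotient_ring R));
         cond2 =
           (left_denominator_set (gr R) (C_bar R) \<and>
            left_artinian_ring (left_fractions (gr R) (C_bar R)) \<and>
            nilpotent_ideal R (prime_radical R) \<and>
            C_prime R \<subseteq> regular_elements R);
         cond3 =
           (left_denominator_set (gr R) (C_bar R) \<and>
            has_left_quotient_ring (gr R Quot gr_torsion R) \<and>
            left_artinian_ring (left_quotient_ring (gr R Quot gr_torsion R)) \<and>
            nilpotent_ideal R (prime_radical R) \<and>
            C_prime R \<subseteq> regular_elements R)
     in (cond1 \<longleftrightarrow> cond2) \<and> (cond2 \<longleftrightarrow> cond3) \<and>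
        (cond1 \<or> cond2 \<or> cond3 \<longrightarrow>
           gr (left_quotient_ring R) \<simeq> left_quotient_ring (gr R Quot gr_torsion R) \<and>
           left_quotient_ring (gr R Quot gr_torsion R) \<simeq> left_fractions (gr R) (C_bar R))"
proof -
  interpret R: ring R by fact
  let ?Q = "left_quotient_ring R" and ?F = "left_fractions (gr R) (C_bar R)"
  let ?A = "gr R Quot gr_torsion R"
  define cond1 where "cond1 \<longleftrightarrow> has_left_quotient_ring R \<and> left_artinian_ring ?Q"
  define cond2 where "cond2 \<longleftrightarrow> left_denominator_set (gr R) (C_bar R) \<and> left_artinian_ring ?F \<and>
    nilpotent_ideal R (prime_radical R) \<and> C_prime R \<subseteq> regular_elements R"
  define cond3 where "cond3 \<longleftrightarrow> left_denominator_set (gr R) (C_bar R) \<and>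
    has_left_quotient_ring ?A \<and> left_artinian_ring (left_quotient_ring ?A) \<and>
    nilpotent_ideal R (prime_radical R) \<and> C_prime R \<subseteq> regular_elements R"
  have loc_F: "left_localization (gr R) ?F (left_frac (gr R) (C_bar R) \<one>\<^bsub>gr R\<^esub>) (C_bar R)"
    if "left_denominator_set (gr R) (C_bar R)"
    by (intro left_denominator.left_localization_left_fractions left_denominator.intro
        left_denominator_axioms.intro R.gr_ring that)
  have loc_gr: "cond2 \<and> (\<exists>g. left_localization (gr R) (gr ?Q) g (C_bar R))" if "cond1"
  proof -
    have has: "has_left_quotient_ring R" and art: "left_artinian_ring ?Q"
      using that cond1_def by blast+
    interpret Q: artinian_quotient_ring R ?Q "left_frac R (regular_elements R) \<one>\<^bsub>R\<^esub>"
        "regular_elements R"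
      by (intro artinian_quotient_ring.intro artinian_quotient_ring_axioms.intro refl art
          artinian_localization.intro artinian_localization_axioms.intro
          R.left_localization_left_quotient_ring has)
    note loc = Q.gr_localization
    have den: "left_denominator_set (gr R) (C_bar R)"
      by (rule left_localization.left_denominator_set[OF loc])
    \<comment> \<open>\<open>gr ?Q\<close> and \<open>?F\<close> are localizations of
      \<open>gr R\<close> at the same set, so the chain condition on saturated left ideals transfers
      Artinianity from one to the other.\<close>
    have "left_artinian_ring ?F"
      using left_localization.left_artinian_iff[OF loc_F[OF den]]
        left_localization.left_artinian_iff[OF loc] Q.B.left_artinian_gr by blast
    then have "cond2"
      using den Q.nilpotent_prime_radical Q.C_prime_eq by (simp add: cond2_def)
    then show ?thesis using loc by blast
  qed
  have loc_A: "cond2 \<and> (\<exists>g. left_localization (gr R) (left_quotient_ring ?A) g (C_bar R))" if c3: "cond3"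
  proof -
    have den: "left_denominator_set (gr R) (C_bar R)" using that cond3_def by blast
    obtain g where loc: "left_localization (gr R) (left_quotient_ring ?A) g (C_bar R)"
      using R.torsion_quotient_localization c3 cond3_def by blast
    have "left_artinian_ring ?F"
      using left_localization.left_artinian_iff[OF loc_F[OF den]]
        left_localization.left_artinian_iff[OF loc] that cond3_def by blast
    then have "cond2" using that cond2_def cond3_def by blast
    then show ?thesis using loc by blast
  qed
  have "cond1" if "cond2"
    using R.left_artinian_left_quotient_ring_from_gr that cond1_def cond2_def by blast
  moreover have "cond3" if "cond2"
  proof -
    have den: "left_denominator_set (gr R) (C_bar R)" and art: "left_artinian_ring ?F"
      using that cond2_def by blast+
    have "gr_torsion R = a_kernel (gr R) ?F (left_frac (gr R) (C_bar R) \<one>\<^bsub>gr R\<^esub>)"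
      unfolding gr_torsion_def by (rule left_localization.torsion_eq_kernel[OF loc_F[OF den]])
    then have "has_left_quotient_ring ?A" "left_artinian_ring (left_quotient_ring ?A)"
      using left_localization.torsion_quotient_left_quotient_ring[OF loc_F[OF den] art] by simp_all
    then show ?thesis using that cond2_def cond3_def by blast
  qed
  moreover have "gr ?Q \<simeq> left_quotient_ring ?A" "left_quotient_ring ?A \<simeq> ?F" if "cond1" "cond3"
    using loc_gr[OF that(1)] loc_A[OF that(2)] loc_F left_localization_unique that(2) cond3_def
    by blast+
  ultimately have "(cond1 \<longleftrightarrow> cond2) \<and> (cond2 \<longleftrightarrow> cond3) \<and>
      (cond1 \<or> cond2 \<or> cond3 \<longrightarrow> gr ?Q \<simeq> left_quotient_ring ?A \<and> left_quotient_ring ?A \<simeq> ?F)"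
    using loc_gr loc_A by blast
  then show ?thesis
    unfolding Let_def cond1_def cond2_def cond3_def .
qed

end
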